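(* Let $(X,r)$ be a finite bijective left non-degenerate solution of the Yang--Baxter equation, let $M=M(X,r)$ and let $K$ be a field. Then the following properties hold: (1) $I(\eta_M)=\operatorname{Ann}_{K[M]}(w^m)=\operatorname{Ann}_{K[M]}(M_X^m)$ for some $w\in M_X\cap \mathrm Z(M)$ and some $m\ge1$. (2) $I(\eta_M)\subseteq P$ for any prime ideal $P$ of $K[M]$ such that $P\cap M=\varnothing$. (3) $M_X\subseteq P$ for any prime ideal $P$ of $K[M]$ such that $P\cap M\ne\varnothing$. In particular, $w\in P$ (with $w$ as in (1)). (4) There exists at least one minimal prime ideal $P$ of $K[M]$ such that $P\cap M=\varnothing$. (5) If $\operatorname{char}K=0$ then $$\mathcal J(K[M])=\mathcal B(K[M])=I(\eta_M)\cap\bigcap_{P\in\mathcal P}P,$$ where $\mathcal P=\{P\in\operatorname{Spec}(K[M]):P\cap M\ne\varnothing\}=\{P\in\operatorname{Spec}(K[M]):w\in P\}$ (with $w$ as in (1)).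
   Context: Let $X$ be a non-empty set. A (set-theoretic) solution of the Yang--Baxter equation is a pair $(X,r)$ with $r\colon X\times X\to X\times X$, written $r(x,y)=(\lambda_x(y),\rho_y(x))$, such that $(r\times\mathrm{id})(\mathrm{id}\times r)(r\times\mathrm{id})=(\mathrm{id}\times r)(r\times\mathrm{id})(\mathrm{id}\times r)$. It is finite if $X$ is finite, bijective if $r$ is bijective, left non-degenerate if every $\lambda_x\colon X\to X$ is bijective. The structure monoid is $M=M(X,r)=\langle X\mid xy=\lambda_x(y)\rho_y(x)\text{ for all }x,y\in X\rangle$, and $K[M]$ is its monoid algebra. $M_X=\bigcap_{x\in X}xM$ is the set of elements of $M$ left divisible by every generator $x\in X$ (it is an ideal of $M$), and $M_X^m$ is the set of products of $m$ elements of $M_X$. $\mathrm Z(M)$ is the center of $M$. $\eta_M=\{(x,y)\in M\times M: xz=yz\text{ for some }z\in M\}$, which is the cancellative congruence of $M$ (the smallest congruence with cancellative quotient), and $I(\eta_M)=\operatorname{Span}_K\{x-y:(x,y)\in\eta_M\}$ is the corresponding ideal of $K[M]$. $\operatorname{Ann}_{K[M]}(\cdot)$ denotes the annihilator in $K[M]$ (the set of $\alpha\in K[M]$ with $\alpha\,\cdot=0$). $\mathcal J$ and $\mathcal B$ denote the Jacobson radical and the prime radical, $\operatorname{Spec}$ the set of prime ideals. *)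

theory Defs
  imports
    HOL.Vector_Spaces
    "HOL-Algebra.Ideal_Product"
    "HOL-Library.Poly_Mapping"
begin

section \<open>Set-theoretic solutions of the Yang--Baxter equation\<close>

text \<open>
  The non-empty set $X$ is the universe of a type \<^typ>\<open>'x\<close>, and
  $r(x,y) = (\lambda_x(y), \rho_y(x))$.  Triples associate to the right, so
  \<open>r_id\<close> and \<open>id_r\<close> below are $r \times \mathrm{id}$ and $\mathrm{id} \times r$ on $X^3$.
\<close>

definition r_id :: "('x \<times> 'x \<Rightarrow> 'x \<times> 'x) \<Rightarrow> 'x \<times> 'x \<times> 'x \<Rightarrow> 'x \<times> 'x \<times> 'x"
  where "r_id r = (\<lambda>(x, y, z). (fst (r (x, y)), snd (r (x, y)), z))"

definition id_r :: "('x \<times> 'x \<Rightarrow> 'x \<times> 'x) \<Rightarrow> 'x \<times> 'x \<times> 'x \<Rightarrow> 'x \<times> 'x \<times> 'x"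
  where "id_r r = (\<lambda>(x, y, z). (x, r (y, z)))"

definition yang_baxter :: "('x \<times> 'x \<Rightarrow> 'x \<times> 'x) \<Rightarrow> bool"
  where "yang_baxter r \<longleftrightarrow> r_id r \<circ> id_r r \<circ> r_id r = id_r r \<circ> r_id r \<circ> id_r r"

definition left_nondegenerate :: "('x \<times> 'x \<Rightarrow> 'x \<times> 'x) \<Rightarrow> bool"
  where "left_nondegenerate r \<longleftrightarrow> (\<forall>x. bij (\<lambda>y. fst (r (x, y))))"


section \<open>The structure monoid\<close>

text \<open>
  The congruence on the free monoid of words that is generated by the defining relations
  $xy = \lambda_x(y)\rho_y(x)$.
\<close>

inductive word_cong :: "('x \<times> 'x \<Rightarrow> 'x \<times> 'x) \<Rightarrow> 'x list \<Rightarrow> 'x list \<Rightarrow> bool"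
  for r
  where
    rel: "word_cong r [x, y] [fst (r (x, y)), snd (r (x, y))]"
  | refl: "word_cong r u u"
  | sym: "word_cong r u v \<Longrightarrow> word_cong r v u"
  | trans: "word_cong r u v \<Longrightarrow> word_cong r v w \<Longrightarrow> word_cong r u w"
  | append: "word_cong r u v \<Longrightarrow> word_cong r u' v' \<Longrightarrow> word_cong r (u @ u') (v @ v')"

definition word_class :: "('x \<times> 'x \<Rightarrow> 'x \<times> 'x) \<Rightarrow> 'x list \<Rightarrow> 'x list set"
  where "word_class r u = {v. word_cong r u v}"

definition structure_monoid :: "('x \<times> 'x \<Rightarrow> 'x \<times> 'x) \<Rightarrow> 'x list set monoid"
  where "structure_monoid r =
    \<lparr>carrier = range (word_class r),
     mult = (\<lambda>A B. \<Union>u\<in>A. \<Union>v\<in>B. word_class r (u @ v)),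
     one = word_class r []\<rparr>"

definition generator :: "('x \<times> 'x \<Rightarrow> 'x \<times> 'x) \<Rightarrow> 'x \<Rightarrow> 'x list set"
  where "generator r x = word_class r [x]"

text \<open>$M_X = \bigcap_{x \in X} xM$.\<close>

definition M_X :: "('x \<times> 'x \<Rightarrow> 'x \<times> 'x) \<Rightarrow> 'x list set set"
  where "M_X r = (\<Inter>x. generator r x <#\<^bsub>structure_monoid r\<^esub> carrier (structure_monoid r))"


section \<open>Monoids\<close>

primrec set_power :: "('m, 'c) monoid_scheme \<Rightarrow> 'm set \<Rightarrow> nat \<Rightarrow> 'm set"
  where
    "set_power G A 0 = {\<one>\<^bsub>G\<^esub>}"
  | "set_power G A (Suc n) = A <#>\<^bsub>G\<^esub> set_power G A n"

definition monoid_center :: "('m, 'c) monoid_scheme \<Rightarrow> 'm set"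
  where "monoid_center G =
    {z \<in> carrier G. \<forall>x\<in>carrier G. z \<otimes>\<^bsub>G\<^esub> x = x \<otimes>\<^bsub>G\<^esub> z}"

definition eta :: "('m, 'c) monoid_scheme \<Rightarrow> ('m \<times> 'm) set"
  where "eta G = {(x, y) \<in> carrier G \<times> carrier G. \<exists>z\<in>carrier G. x \<otimes>\<^bsub>G\<^esub> z = y \<otimes>\<^bsub>G\<^esub> z}"


section \<open>Monoid algebras\<close>

text \<open>
  The elements of $K[M]$ are the finitely supported \<^typ>\<open>'k\<close>-valued functions whose support lies
  in the carrier of $M$.  The type-class product on \<^typ>\<open>'m \<Rightarrow>\<^sub>0 'k\<close> is not available here, as
  the monoid is not given by a type.
\<close>

definition monoid_algebra :: "('m, 'c) monoid_scheme \<Rightarrow> ('m \<Rightarrow>\<^sub>0 'k::field) ring"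
  where "monoid_algebra G =
    \<lparr>carrier = {f. Poly_Mapping.keys f \<subseteq> carrier G},
     mult = (\<lambda>f g. \<Sum>x\<in>Poly_Mapping.keys f. \<Sum>y\<in>Poly_Mapping.keys g.
        Poly_Mapping.single (x \<otimes>\<^bsub>G\<^esub> y) (Poly_Mapping.lookup f x * Poly_Mapping.lookup g y)),
     one = Poly_Mapping.single \<one>\<^bsub>G\<^esub> 1,
     zero = 0,
     add = (+)\<rparr>"

definition basis_elem :: "'m \<Rightarrow> 'm \<Rightarrow>\<^sub>0 'k::field"
  where "basis_elem x = Poly_Mapping.single x 1"

definition scale :: "'k \<Rightarrow> ('m \<Rightarrow>\<^sub>0 'k) \<Rightarrow> 'm \<Rightarrow>\<^sub>0 'k::field"
  where "scale c = Poly_Mapping.map ((*) c)"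

definition congruence_ideal :: "('m \<times> 'm) set \<Rightarrow> ('m \<Rightarrow>\<^sub>0 'k::field) set"
  where "congruence_ideal E = Modules.module.span scale {basis_elem x - basis_elem y | x y. (x, y) \<in> E}"


section \<open>Ideals of noncommutative rings\<close>

definition annihilator :: "('a, 'c) ring_scheme \<Rightarrow> 'a set \<Rightarrow> 'a set"
  where "annihilator R S = {a \<in> carrier R. \<forall>s\<in>S. a \<otimes>\<^bsub>R\<^esub> s = \<zero>\<^bsub>R\<^esub>}"

text \<open>
  The library's \<^locale>\<open>primeideal\<close> is restricted to commutative rings (and is elementwise), hence
  the following definition by products of two-sided ideals.
\<close>

definition prime_ideal :: "('a, 'c) ring_scheme \<Rightarrow> 'a set \<Rightarrow> bool"
  where "prime_ideal R P \<longleftrightarrow> ideal P R \<and> P \<noteq> carrier R \<and>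
    (\<forall>I J. ideal I R \<longrightarrow> ideal J R \<longrightarrow> I \<cdot>\<^bsub>R\<^esub> J \<subseteq> P \<longrightarrow> I \<subseteq> P \<or> J \<subseteq> P)"

definition Spec :: "('a, 'c) ring_scheme \<Rightarrow> 'a set set"
  where "Spec R = {P. prime_ideal R P}"

definition minimal_prime_ideal :: "('a, 'c) ring_scheme \<Rightarrow> 'a set \<Rightarrow> bool"
  where "minimal_prime_ideal R P \<longleftrightarrow> P \<in> Spec R \<and> (\<forall>Q\<in>Spec R. Q \<subseteq> P \<longrightarrow> Q = P)"

definition left_ideal :: "('a, 'c) ring_scheme \<Rightarrow> 'a set \<Rightarrow> bool"
  where "left_ideal R I \<longleftrightarrow> additive_subgroup I R \<and>
    (\<forall>a\<in>I. \<forall>x\<in>carrier R. x \<otimes>\<^bsub>R\<^esub> a \<in> I)"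

definition maximal_left_ideal :: "('a, 'c) ring_scheme \<Rightarrow> 'a set \<Rightarrow> bool"
  where "maximal_left_ideal R I \<longleftrightarrow> left_ideal R I \<and> I \<noteq> carrier R \<and>
    (\<forall>J. left_ideal R J \<longrightarrow> I \<subseteq> J \<longrightarrow> J = I \<or> J = carrier R)"

definition jacobson_radical :: "('a, 'c) ring_scheme \<Rightarrow> 'a set"
  where "jacobson_radical R = carrier R \<inter> \<Inter>{I. maximal_left_ideal R I}"

definition prime_radical :: "('a, 'c) ring_scheme \<Rightarrow> 'a set"
  where "prime_radical R = carrier R \<inter> \<Inter>(Spec R)"


section \<open>Well-definedness\<close>

lemma lookup_scale: "Poly_Mapping.lookup (scale c f) x = c * Poly_Mapping.lookup f x"
  by (simp add: scale_def map.rep_eq when_def)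

lemma vector_space_scale: "vector_space (scale :: 'k::field \<Rightarrow> ('m \<Rightarrow>\<^sub>0 'k) \<Rightarrow> _)"
  by (standard; rule poly_mapping_eqI) (simp_all add: lookup_scale lookup_add ring_distribs mult.assoc)

lemma word_class_eq_iff: "word_class r u = word_class r v \<longleftrightarrow> word_cong r u v"
  unfolding word_class_def by (blast intro: word_cong.intros)

lemma mult_word_class:
  "word_class r u \<otimes>\<^bsub>structure_monoid r\<^esub> word_class r v = word_class r (u @ v)"
proof -
  have eq: "word_class r (u' @ v') = word_class r (u @ v)"
    if "u' \<in> word_class r u" "v' \<in> word_class r v" for u' v'
    unfolding word_class_eq_iff
    using that by (simp add: word_class_def word_cong.sym word_cong.append)
  have ne: "word_class r u \<noteq> {}" "word_class r v \<noteq> {}"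
    by (auto simp: word_class_def intro: word_cong.refl)
  have "word_class r u \<otimes>\<^bsub>structure_monoid r\<^esub> word_class r v =
      (\<Union>u'\<in>word_class r u. \<Union>v'\<in>word_class r v. word_class r (u' @ v'))"
    by (simp add: structure_monoid_def)
  also have "\<dots> = (\<Union>u'\<in>word_class r u. \<Union>v'\<in>word_class r v. word_class r (u @ v))"
    by (intro SUP_cong eq) (rule HOL.refl | assumption)+
  also have "\<dots> = word_class r (u @ v)"
    using ne by simp
  finally show ?thesis .
qed

lemma monoid_structure_monoid: "monoid (structure_monoid r)"
proof -
  have c: "carrier (structure_monoid r) = range (word_class r)"
    and o: "\<one>\<^bsub>structure_monoid r\<^esub> = word_class r []"
    by (simp_all add: structure_monoid_def)
  show ?thesis
    by (rule monoidI) (auto simp: c o mult_word_class)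
qed

lemma monoid_algebra_simps:
  "carrier (monoid_algebra G) = {f. Poly_Mapping.keys f \<subseteq> carrier G}"
  "\<one>\<^bsub>monoid_algebra G\<^esub> = Poly_Mapping.single \<one>\<^bsub>G\<^esub> 1"
  "\<zero>\<^bsub>monoid_algebra G\<^esub> = 0"
  "f \<oplus>\<^bsub>monoid_algebra G\<^esub> g = f + g"
  by (simp_all add: monoid_algebra_def)

lemma monoid_algebra_mult_superset:
  assumes "finite A" "finite B" "Poly_Mapping.keys f \<subseteq> A" "Poly_Mapping.keys g \<subseteq> B"
  shows "f \<otimes>\<^bsub>monoid_algebra G\<^esub> g = (\<Sum>x\<in>A. \<Sum>y\<in>B.
    Poly_Mapping.single (x \<otimes>\<^bsub>G\<^esub> y) (Poly_Mapping.lookup f x * Poly_Mapping.lookup g y))"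
proof -
  have "f \<otimes>\<^bsub>monoid_algebra G\<^esub> g = (\<Sum>x\<in>Poly_Mapping.keys f. \<Sum>y\<in>Poly_Mapping.keys g.
    Poly_Mapping.single (x \<otimes>\<^bsub>G\<^esub> y) (Poly_Mapping.lookup f x * Poly_Mapping.lookup g y))"
    by (simp add: monoid_algebra_def)
  also have "\<dots> = (\<Sum>x\<in>Poly_Mapping.keys f. \<Sum>y\<in>B.
    Poly_Mapping.single (x \<otimes>\<^bsub>G\<^esub> y) (Poly_Mapping.lookup f x * Poly_Mapping.lookup g y))"
    using assms by (intro sum.cong refl sum.mono_neutral_left) (auto simp: in_keys_iff)
  also have "\<dots> = (\<Sum>x\<in>A. \<Sum>y\<in>B.
    Poly_Mapping.single (x \<otimes>\<^bsub>G\<^esub> y) (Poly_Mapping.lookup f x * Poly_Mapping.lookup g y))"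
    using assms by (intro sum.mono_neutral_left) (auto simp: in_keys_iff)
  finally show ?thesis .
qed

lemma monoid_algebra_single_mult:
  "Poly_Mapping.single x a \<otimes>\<^bsub>monoid_algebra G\<^esub> Poly_Mapping.single y b
    = Poly_Mapping.single (x \<otimes>\<^bsub>G\<^esub> y) (a * b)"
  by (subst monoid_algebra_mult_superset[of "{x}" "{y}"]) auto

lemma monoid_algebra_distrib:
  fixes f g h :: "'m \<Rightarrow>\<^sub>0 'k::field"
  shows "(f + g) \<otimes>\<^bsub>monoid_algebra G\<^esub> h =
      (f \<otimes>\<^bsub>monoid_algebra G\<^esub> h) + (g \<otimes>\<^bsub>monoid_algebra G\<^esub> h)"
    and "h \<otimes>\<^bsub>monoid_algebra G\<^esub> (f + g) =
      (h \<otimes>\<^bsub>monoid_algebra G\<^esub> f) + (h \<otimes>\<^bsub>monoid_algebra G\<^esub> g)"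
proof -
  define A where "A = Poly_Mapping.keys f \<union> Poly_Mapping.keys g \<union> Poly_Mapping.keys h"
  have A: "finite A" "Poly_Mapping.keys f \<subseteq> A" "Poly_Mapping.keys g \<subseteq> A"
    "Poly_Mapping.keys h \<subseteq> A" "Poly_Mapping.keys (f + g) \<subseteq> A"
    using keys_add[of f g] by (auto simp: A_def)
  note s = monoid_algebra_mult_superset[OF A(1) A(1)]
  show "(f + g) \<otimes>\<^bsub>monoid_algebra G\<^esub> h =
      (f \<otimes>\<^bsub>monoid_algebra G\<^esub> h) + (g \<otimes>\<^bsub>monoid_algebra G\<^esub> h)"
    and "h \<otimes>\<^bsub>monoid_algebra G\<^esub> (f + g) =
      (h \<otimes>\<^bsub>monoid_algebra G\<^esub> f) + (h \<otimes>\<^bsub>monoid_algebra G\<^esub> g)"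
    unfolding s[OF A(5) A(4)] s[OF A(4) A(5)] s[OF A(2) A(4)] s[OF A(4) A(2)]
      s[OF A(3) A(4)] s[OF A(4) A(3)]
    by (simp_all only: lookup_add distrib_left distrib_right single_add sum.distrib)
qed

lemma poly_mapping_add_induct [case_names zero single add]:
  assumes "P 0" "\<And>x c. x \<in> Poly_Mapping.keys f \<Longrightarrow> P (Poly_Mapping.single x c)"
    "\<And>g h. P g \<Longrightarrow> P h \<Longrightarrow> P (g + h)"
  shows "P (f :: 'm \<Rightarrow>\<^sub>0 'k::field)"
proof -
  have "P (\<Sum>x\<in>B. Poly_Mapping.single x (Poly_Mapping.lookup f x))"
    if "B \<subseteq> Poly_Mapping.keys f" for B
  proof -
    have "finite B" using that finite_keys finite_subset by blast
    then show ?thesis using that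
      by (induction B) (auto intro: assms)
  qed
  moreover have "f = (\<Sum>x\<in>Poly_Mapping.keys f. Poly_Mapping.single x (Poly_Mapping.lookup f x))"
    by (rule poly_mapping_eqI) (auto simp: lookup_sum lookup_single when_def in_keys_iff)
  ultimately show ?thesis by (metis order_refl)
qed

lemma ring_monoid_algebra:
  fixes G (structure)
  assumes "monoid G"
  shows "ring (monoid_algebra G :: ('m \<Rightarrow>\<^sub>0 'k::field) ring)"
proof -
  interpret monoid G by fact
  let ?R = "monoid_algebra G :: ('m \<Rightarrow>\<^sub>0 'k) ring"
  note D = monoid_algebra_distrib[where G = G]
  have zero: "0 \<otimes>\<^bsub>?R\<^esub> f = 0" "f \<otimes>\<^bsub>?R\<^esub> 0 = 0" for f
    by (simp_all add: monoid_algebra_def)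
  have closed: "f \<otimes>\<^bsub>?R\<^esub> g \<in> carrier ?R" if "f \<in> carrier ?R" "g \<in> carrier ?R" for f g
  proof -
    let ?s = "\<lambda>x y. Poly_Mapping.single (x \<otimes> y)
      (Poly_Mapping.lookup f x * Poly_Mapping.lookup g y)"
    have "Poly_Mapping.keys (f \<otimes>\<^bsub>?R\<^esub> g) \<subseteq>
      (\<Union>x\<in>Poly_Mapping.keys f. Poly_Mapping.keys (\<Sum>y\<in>Poly_Mapping.keys g. ?s x y))"
      unfolding monoid_algebra_def by (simp add: keys_sum)
    also have "\<dots> \<subseteq> (\<Union>x\<in>Poly_Mapping.keys f. \<Union>y\<in>Poly_Mapping.keys g. Poly_Mapping.keys (?s x y))"
      by (intro UN_mono order_refl keys_sum)
    also have "\<dots> \<subseteq> carrier G"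
      using that by (auto simp: monoid_algebra_simps split: if_splits)
    finally show ?thesis by (simp add: monoid_algebra_simps)
  qed
  have assoc: "(f \<otimes>\<^bsub>?R\<^esub> g) \<otimes>\<^bsub>?R\<^esub> h = f \<otimes>\<^bsub>?R\<^esub> (g \<otimes>\<^bsub>?R\<^esub> h)"
    if "f \<in> carrier ?R" "g \<in> carrier ?R" "h \<in> carrier ?R" for f g h
  proof (induction f rule: poly_mapping_add_induct)
    case (single x a)
    show ?case
    proof (induction g rule: poly_mapping_add_induct)
      case (single y b)
      show ?case
      proof (induction h rule: poly_mapping_add_induct)
        case (single z c)
        have "x \<in> carrier G" "y \<in> carrier G" "z \<in> carrier G"
          using that \<open>x \<in> Poly_Mapping.keys f\<close> \<open>y \<in> Poly_Mapping.keys g\<close> single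
          by (auto simp: monoid_algebra_simps)
        then show ?case
          by (simp add: monoid_algebra_single_mult m_assoc mult.assoc)
      qed (simp_all add: zero D)
    qed (simp_all add: zero D)
  qed (simp_all add: zero D)
  have one: "\<one>\<^bsub>?R\<^esub> \<otimes>\<^bsub>?R\<^esub> f = f" "f \<otimes>\<^bsub>?R\<^esub> \<one>\<^bsub>?R\<^esub> = f"
    if "f \<in> carrier ?R" for f
  proof -
    have "\<one>\<^bsub>?R\<^esub> \<otimes>\<^bsub>?R\<^esub> f = f \<and> f \<otimes>\<^bsub>?R\<^esub> \<one>\<^bsub>?R\<^esub> = f"
    proof (induction f rule: poly_mapping_add_induct)
      case (single x a)
      then have "x \<in> carrier G" using that by (auto simp: monoid_algebra_simps)
      then show ?case by (simp add: monoid_algebra_simps monoid_algebra_single_mult)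
    qed (simp_all add: zero D)
    then show "\<one>\<^bsub>?R\<^esub> \<otimes>\<^bsub>?R\<^esub> f = f" "f \<otimes>\<^bsub>?R\<^esub> \<one>\<^bsub>?R\<^esub> = f" by auto
  qed
  show ?thesis
  proof (rule ringI)
    show "abelian_group ?R"
    proof (rule abelian_groupI)
      fix f assume "f \<in> carrier ?R"
      then show "\<exists>g\<in>carrier ?R. g \<oplus>\<^bsub>?R\<^esub> f = \<zero>\<^bsub>?R\<^esub>"
        by (intro bexI[of _ "- f"]) (auto simp: monoid_algebra_simps)
    next
      fix f g assume "f \<in> carrier ?R" "g \<in> carrier ?R"
      then show "f \<oplus>\<^bsub>?R\<^esub> g \<in> carrier ?R"
        using keys_add[of f g] by (auto simp: monoid_algebra_simps)
    qed (simp_all add: monoid_algebra_simps add_ac)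
    show "monoid ?R"
      by (rule monoidI) (auto simp: closed assoc one, simp add: monoid_algebra_simps)
  qed (simp_all add: monoid_algebra_simps(4) D)
qed

end

theory Submission
  imports Defs "HOL-Library.Multiset"
begin

text \<open>
  Reading words additively through the 1-cocycle of $\lambda$ turns the relations into
  $x + y = y + \sigma_y(x)$ with $\sigma_y$ bijective. For a suitable $N$ the sums
  $t_y = y + \dots + y$ ($N$ terms) act trivially on $X$, commute with each other, satisfy
  $a t_y = t_{\lambda_a(y)} a$, and $M$ is a finite union of cosets $fT$ of the monoid $T$ they
  generate. The product $w$ of all $t_y$ is central and lies in $M_X$, and every element of $M$
  divides a power of $w$. By Hilbert's basis argument $K[M]$ satisfies the ascending chain
  condition on right $T$-submodules, so the annihilators of the powers of $w$ stabilise, and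
  their union is $I(\eta_M)$; parts (1)--(4) follow by elementwise prime ideal arguments.

  In characteristic $0$ the radical $\mathcal J$ is homogeneous for the length grading, because it
  is stable under $x \mapsto 2^{|x|} x$, and its homogeneous elements are nilpotent. Utumi's
  argument with the chain condition then puts them into every prime ideal, so
  $\mathcal J = \mathcal B$. For $\mathcal J \subseteq I(\eta_M)$, factor $M$ by the $k$-th
  powers of the $t_y$: the quotient is a finite group, whose algebra is semisimple by Maschke, and
  these quotients for all $k$ separate the elements that $\eta_M$ separates, because
  $\mathbb{Z}^n / L$ is residually finite.
\<close>

section \<open>Chain conditions for commuting operators\<close>

context vector_space
begin

definition invariant_subspace :: "('b \<Rightarrow> 'b) set \<Rightarrow> 'b set \<Rightarrow> bool"
  where "invariant_subspace T W \<longleftrightarrow> subspace W \<and> (\<forall>t\<in>T. \<forall>x\<in>W. t x \<in> W)"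

definition ascending_chain_condition :: "('b \<Rightarrow> 'b) set \<Rightarrow> 'b set \<Rightarrow> bool"
  where "ascending_chain_condition T V \<longleftrightarrow>
    (\<forall>W :: nat \<Rightarrow> 'b set. (\<forall>i. invariant_subspace T (W i) \<and> W i \<subseteq> V \<and> W i \<subseteq> W (Suc i)) \<longrightarrow>
      (\<exists>n. \<forall>m\<ge>n. W m = W n))"

lemma invariant_subspaceD:
  assumes "invariant_subspace T W"
  shows "subspace W" "t \<in> T \<Longrightarrow> x \<in> W \<Longrightarrow> t x \<in> W" "0 \<in> W"
    "x \<in> W \<Longrightarrow> y \<in> W \<Longrightarrow> x + y \<in> W" "x \<in> W \<Longrightarrow> y \<in> W \<Longrightarrow> x - y \<in> W" "x \<in> W \<Longrightarrow> scale c x \<in> W"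
  using assms unfolding invariant_subspace_def
  by (auto intro: subspace_0 subspace_add subspace_diff subspace_scale)

lemma ascending_chain_condition_span_insert:
  assumes V: "subspace V" and acc: "ascending_chain_condition {} V"
  shows "ascending_chain_condition {} (span (insert f V))"
  unfolding ascending_chain_condition_def
proof (intro allI impI)
  fix W :: "nat \<Rightarrow> 'b set"
  assume *: "\<forall>i. invariant_subspace {} (W i) \<and> W i \<subseteq> span (insert f V) \<and> W i \<subseteq> W (Suc i)"
  have sub: "subspace (W i)" for i using * by (auto simp: invariant_subspace_def)
  have mono: "W i \<subseteq> W j" if "i \<le> j" for i j
    using lift_Suc_mono_le[of W i j] * that by blast
  have "\<exists>n. \<forall>m\<ge>n. W m \<inter> V = W n \<inter> V"
    using acc[unfolded ascending_chain_condition_def, rule_format, of "\<lambda>i. W i \<inter> V"] *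
    by (auto simp: invariant_subspace_def intro: subspace_inter V)
  then obtain n where n: "\<And>m. m \<ge> n \<Longrightarrow> W m \<inter> V = W n \<inter> V" by blast
  have dec: "\<exists>c. x - scale c f \<in> V" if "x \<in> W m" for x m
  proof -
    have "x \<in> span (insert f V)" using that * by blast
    moreover have "span V = V" using V by (simp add: span_eq_iff)
    ultimately show ?thesis using span_breakdown_eq[of x f V] by simp
  qed
  show "\<exists>n. \<forall>m\<ge>n. W m = W n"
  proof (cases "\<exists>i. \<exists>v\<in>V. f + v \<in> W i")
    case True
    then obtain i v where v: "v \<in> V" "f + v \<in> W i" by blast
    have "W m \<subseteq> W (max n i)" if m: "m \<ge> max n i" for m
    proof
      fix x assume x: "x \<in> W m"
      then obtain c where c: "x - scale c f \<in> V" using dec by blast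
      have fv: "f + v \<in> W m" "f + v \<in> W (max n i)"
        using v mono[of i m] mono[of i "max n i"] m by auto
      have "x - scale c (f + v) = (x - scale c f) - scale c v"
        by (simp add: scale_right_distrib)
      then have "x - scale c (f + v) \<in> V"
        by (simp only: subspace_diff[OF V c subspace_scale[OF V v(1)]])
      moreover have "x - scale c (f + v) \<in> W m"
        using x fv sub by (simp add: subspace_diff subspace_scale)
      ultimately have "x - scale c (f + v) \<in> W (max n i)"
        using n[of m] n[of "max n i"] m by auto
      then have "(x - scale c (f + v)) + scale c (f + v) \<in> W (max n i)"
        by (intro subspace_add[OF sub] subspace_scale[OF sub] fv(2))
      then show "x \<in> W (max n i)" by simp
    qed
    then show ?thesis using mono by (intro exI[of _ "max n i"]) blast
  next
    case False
    have "W m \<subseteq> V" for m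
    proof
      fix x assume x: "x \<in> W m"
      then obtain c where c: "x - scale c f \<in> V" using dec by blast
      have "c = 0"
      proof (rule ccontr)
        assume "c \<noteq> 0"
        then have "scale (inverse c) x = f + scale (inverse c) (x - scale c f)"
          by (simp add: scale_right_diff_distrib)
        moreover have "scale (inverse c) x \<in> W m" using x sub by (simp add: subspace_scale)
        ultimately show False using False c V by (metis subspace_scale)
      qed
      then show "x \<in> V" using c by simp
    qed
    then show ?thesis using n by (metis inf.absorb1)
  qed
qed

lemma ascending_chain_condition_span:
  assumes "finite F" shows "ascending_chain_condition {} (span F)"
  using assms
proof (induction F)
  case empty
  have "W m = W n" if "\<forall>i. invariant_subspace {} (W i) \<and> W i \<subseteq> span {} \<and> W i \<subseteq> W (Suc i)"
    for W :: "nat \<Rightarrow> 'b set" and m n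
    using that invariant_subspaceD(3) by (fastforce simp: span_empty)
  then show ?case unfolding ascending_chain_condition_def by blast
next
  case (insert x F)
  have "span (insert x (span F)) = span (insert x F)"
    by (simp only: span_insert span_span)
  then show ?case
    using ascending_chain_condition_span_insert[OF subspace_span insert.IH, of x] by simp
qed

primrec degree_filtration :: "('b \<Rightarrow> 'b) \<Rightarrow> 'b set \<Rightarrow> nat \<Rightarrow> 'b set"
  where
    "degree_filtration t V 0 = {0}"
  | "degree_filtration t V (Suc i) = {(t ^^ i) v + l | v l. v \<in> V \<and> l \<in> degree_filtration t V i}"

lemma linear_apply:
  assumes "Vector_Spaces.linear scale scale t"
  shows linear_0: "t 0 = 0" and linear_add: "t (x + y) = t x + t y"
    and linear_scale: "t (scale c x) = scale c (t x)"
proof -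
  interpret t: Vector_Spaces.linear scale scale t by fact
  show "t 0 = 0" "t (x + y) = t x + t y" "t (scale c x) = scale c (t x)"
    by (simp_all add: t.zero t.add t.scale)
qed

lemma funpow_apply:
  assumes "Vector_Spaces.linear scale scale t"
  shows funpow_0: "(t ^^ i) 0 = 0" and funpow_add: "(t ^^ i) (x + y) = (t ^^ i) x + (t ^^ i) y"
    and funpow_scale: "(t ^^ i) (scale c x) = scale c ((t ^^ i) x)"
  by (induction i) (simp_all add: linear_apply[OF assms])

context
  fixes t :: "'b \<Rightarrow> 'b" and T :: "('b \<Rightarrow> 'b) set" and V :: "'b set"
  assumes t: "Vector_Spaces.linear scale scale t"
    and T: "\<And>s. s \<in> T \<Longrightarrow> Vector_Spaces.linear scale scale s"
    and comm: "\<And>s x. s \<in> T \<Longrightarrow> s (t x) = t (s x)"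
    and V: "invariant_subspace T V"
begin

lemma commute_funpow: "s \<in> T \<Longrightarrow> s ((t ^^ i) x) = (t ^^ i) (s x)"
  by (induction i) (simp_all add: comm)

lemma invariant_subspace_degree_filtration: "invariant_subspace T (degree_filtration t V i)"
proof (induction i)
  case 0
  have "s 0 = 0" if "s \<in> T" for s using linear_0[OF T[OF that]] .
  then show ?case by (simp add: invariant_subspace_def)
next
  case (Suc i)
  note D = invariant_subspaceD[OF Suc] and VD = invariant_subspaceD[OF V]
  show ?case
    unfolding invariant_subspace_def
  proof (intro conjI ballI subspaceI)
    show "0 \<in> degree_filtration t V (Suc i)"
      using VD(3) D(3) funpow_0[OF t, of i] by (auto intro!: exI[of _ 0])
  next
    fix x y assume "x \<in> degree_filtration t V (Suc i)" "y \<in> degree_filtration t V (Suc i)"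
    then obtain v l v' l' where *: "x = (t ^^ i) v + l" "y = (t ^^ i) v' + l'" "v \<in> V" "v' \<in> V"
      "l \<in> degree_filtration t V i" "l' \<in> degree_filtration t V i" by auto
    have "x + y = (t ^^ i) (v + v') + (l + l')" by (simp add: * funpow_add[OF t])
    then show "x + y \<in> degree_filtration t V (Suc i)"
      unfolding degree_filtration.simps using VD(4)[OF *(3,4)] D(4)[OF *(5,6)] by blast
  next
    fix c x assume "x \<in> degree_filtration t V (Suc i)"
    then obtain v l where *: "x = (t ^^ i) v + l" "v \<in> V" "l \<in> degree_filtration t V i" by auto
    have "scale c x = (t ^^ i) (scale c v) + scale c l" by (simp add: * funpow_scale[OF t] scale_right_distrib)
    then show "scale c x \<in> degree_filtration t V (Suc i)"
      unfolding degree_filtration.simps using VD(6)[OF *(2)] D(6)[OF *(3)] by blast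
  next
    fix s x assume s: "s \<in> T" and "x \<in> degree_filtration t V (Suc i)"
    then obtain v l where *: "x = (t ^^ i) v + l" "v \<in> V" "l \<in> degree_filtration t V i" by auto
    have "s x = (t ^^ i) (s v) + s l" using linear_add[OF T[OF s]] by (simp add: * commute_funpow s)
    then show "s x \<in> degree_filtration t V (Suc i)"
      unfolding degree_filtration.simps using VD(2)[OF s *(2)] D(2)[OF s *(3)] by blast
  qed
qed

lemma degree_filtration_Suc_subset: "degree_filtration t V i \<subseteq> degree_filtration t V (Suc i)"
proof
  fix l assume "l \<in> degree_filtration t V i"
  then have "(t ^^ i) 0 + l \<in> degree_filtration t V (Suc i)"
    unfolding degree_filtration.simps using invariant_subspaceD(3)[OF V] by blast
  then show "l \<in> degree_filtration t V (Suc i)" by (simp add: funpow_0[OF t])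
qed

lemma degree_filtration_shift: "x \<in> degree_filtration t V i \<Longrightarrow> t x \<in> degree_filtration t V (Suc i)"
proof (induction i arbitrary: x)
  case 0
  then show ?case
    using invariant_subspaceD(3)[OF V] linear_0[OF t] by auto
next
  case (Suc i)
  then obtain v l where *: "x = (t ^^ i) v + l" "v \<in> V" "l \<in> degree_filtration t V i" by auto
  have "t x = (t ^^ Suc i) v + t l" using linear_add[OF t] by (simp add: *)
  then show ?case using * Suc.IH unfolding degree_filtration.simps(2)[of t V "Suc i"] by blast
qed

lemma invariant_subspace_UN_degree_filtration:
  "invariant_subspace (insert t T) (\<Union>i. degree_filtration t V i)"
proof -
  let ?L = "degree_filtration t V"
  note D = invariant_subspaceD[OF invariant_subspace_degree_filtration]
  have mono: "?L i \<subseteq> ?L j" if "i \<le> j" for i j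
    using lift_Suc_mono_le[of ?L, OF degree_filtration_Suc_subset that] .
  show ?thesis
    unfolding invariant_subspace_def
  proof (intro conjI ballI subspaceI)
    show "0 \<in> (\<Union>i. ?L i)" using D(3) by blast
  next
    fix x y assume "x \<in> (\<Union>i. ?L i)" "y \<in> (\<Union>i. ?L i)"
    then obtain i j where "x \<in> ?L i" "y \<in> ?L j" by blast
    then have "x \<in> ?L (max i j)" "y \<in> ?L (max i j)"
      using mono[of i "max i j"] mono[of j "max i j"] by auto
    then show "x + y \<in> (\<Union>i. ?L i)" using D(4) by blast
  next
    fix c x assume "x \<in> (\<Union>i. ?L i)"
    then show "scale c x \<in> (\<Union>i. ?L i)" using D(6) by blast
  next
    fix s x assume "s \<in> insert t T" "x \<in> (\<Union>i. ?L i)"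
    then show "s x \<in> (\<Union>i. ?L i)" using D(2) degree_filtration_shift by blast
  qed
qed

definition leading :: "'b set \<Rightarrow> nat \<Rightarrow> 'b set"
  where "leading W i = {v \<in> V. \<exists>l\<in>degree_filtration t V i. (t ^^ i) v + l \<in> W}"

lemma invariant_subspace_leading:
  assumes W: "invariant_subspace (insert t T) W"
  shows "invariant_subspace T (leading W i)"
proof -
  note LD = invariant_subspaceD[OF invariant_subspace_degree_filtration]
    and VD = invariant_subspaceD[OF V] and WD = invariant_subspaceD[OF W]
  show ?thesis
    unfolding invariant_subspace_def
  proof (intro conjI ballI subspaceI)
    show "0 \<in> leading W i"
      unfolding leading_def using VD(3) LD(3)[of i] WD(3) funpow_0[OF t] by (auto intro!: bexI[of _ 0])
  next
    fix v v' assume "v \<in> leading W i" "v' \<in> leading W i"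
    then obtain l l' where *: "v \<in> V" "v' \<in> V" "l \<in> degree_filtration t V i" "l' \<in> degree_filtration t V i"
      "(t ^^ i) v + l \<in> W" "(t ^^ i) v' + l' \<in> W" by (auto simp: leading_def)
    have "(t ^^ i) (v + v') + (l + l') = ((t ^^ i) v + l) + ((t ^^ i) v' + l')"
      by (simp add: funpow_add[OF t] algebra_simps)
    then have "(t ^^ i) (v + v') + (l + l') \<in> W" using WD(4)[OF *(5,6)] by (simp only:)
    then show "v + v' \<in> leading W i" unfolding leading_def using * VD(4) LD(4) by blast
  next
    fix c v assume "v \<in> leading W i"
    then obtain l where *: "v \<in> V" "l \<in> degree_filtration t V i" "(t ^^ i) v + l \<in> W"
      by (auto simp: leading_def)
    have "(t ^^ i) (scale c v) + scale c l = scale c ((t ^^ i) v + l)"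
      by (simp add: funpow_scale[OF t] scale_right_distrib)
    then have "(t ^^ i) (scale c v) + scale c l \<in> W" using * WD(6) by simp
    then show "scale c v \<in> leading W i" unfolding leading_def using * VD(6) LD(6) by blast
  next
    fix s v assume s: "s \<in> T" and "v \<in> leading W i"
    then obtain l where *: "v \<in> V" "l \<in> degree_filtration t V i" "(t ^^ i) v + l \<in> W"
      by (auto simp: leading_def)
    have "(t ^^ i) (s v) + s l = s ((t ^^ i) v + l)"
      using linear_add[OF T[OF s]] by (simp add: commute_funpow s)
    then have "(t ^^ i) (s v) + s l \<in> W" using * WD(2) s by simp
    then show "s v \<in> leading W i" unfolding leading_def using * VD(2) LD(2) s by blast
  qed
qed

lemma leading_Suc:
  assumes W: "invariant_subspace (insert t T) W"
  shows "leading W i \<subseteq> leading W (Suc i)"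
proof
  fix v assume "v \<in> leading W i"
  then obtain l where *: "v \<in> V" "l \<in> degree_filtration t V i" "(t ^^ i) v + l \<in> W"
    by (auto simp: leading_def)
  have "(t ^^ Suc i) v + t l = t ((t ^^ i) v + l)" using linear_add[OF t] by simp
  then have "(t ^^ Suc i) v + t l \<in> W" using * invariant_subspaceD(2)[OF W] by simp
  then show "v \<in> leading W (Suc i)"
    unfolding leading_def using * degree_filtration_shift by blast
qed

lemma eq_if_leading_eq:
  assumes W: "invariant_subspace (insert t T) W" and W': "invariant_subspace (insert t T) W'"
    and sub: "W \<subseteq> W'" "W' \<subseteq> (\<Union>i. degree_filtration t V i)"
    and eq: "\<And>i. leading W i = leading W' i"
  shows "W = W'"
proof -
  have "x \<in> W" if "x \<in> W'" "x \<in> degree_filtration t V i" for x i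
    using that
  proof (induction i arbitrary: x)
    case 0
    then show ?case using invariant_subspaceD(3)[OF W] by simp
  next
    case (Suc i)
    then obtain v l where *: "x = (t ^^ i) v + l" "v \<in> V" "l \<in> degree_filtration t V i" by auto
    then have "v \<in> leading W i" using eq Suc.prems by (auto simp: leading_def)
    then obtain l' where l': "l' \<in> degree_filtration t V i" "(t ^^ i) v + l' \<in> W"
      by (auto simp: leading_def)
    have d: "x - ((t ^^ i) v + l') = l - l'" by (simp add: *)
    have "x - ((t ^^ i) v + l') \<in> W"
    proof (rule Suc.IH)
      show "x - ((t ^^ i) v + l') \<in> W'"
        using Suc.prems l' sub invariant_subspaceD(5)[OF W'] by blast
      show "x - ((t ^^ i) v + l') \<in> degree_filtration t V i"
        unfolding d using * l' invariant_subspaceD(5)[OF invariant_subspace_degree_filtration] by blast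
    qed
    then have "x - ((t ^^ i) v + l') + ((t ^^ i) v + l') \<in> W"
      using l' invariant_subspaceD(4)[OF W] by blast
    then show ?case by simp
  qed
  then show ?thesis using sub by blast
qed

lemma ascending_chain_condition_UN_degree_filtration:
  assumes acc: "ascending_chain_condition T V"
  shows "ascending_chain_condition (insert t T) (\<Union>i. degree_filtration t V i)"
  unfolding ascending_chain_condition_def
proof (intro allI impI)
  fix W :: "nat \<Rightarrow> 'b set"
  assume *: "\<forall>i. invariant_subspace (insert t T) (W i) \<and> W i \<subseteq> (\<Union>i. degree_filtration t V i) \<and>
    W i \<subseteq> W (Suc i)"
  have mono: "W i \<subseteq> W j" if "i \<le> j" for i j
    using lift_Suc_mono_le[of W i j] * that by blast
  have lead_mono: "leading (W i) k \<subseteq> leading (W j) l" if "i \<le> j" "k \<le> l" for i j k l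
  proof -
    have "leading (W i) k \<subseteq> leading (W i) l"
      using lift_Suc_mono_le[of "leading (W i)" k l] leading_Suc * that by blast
    also have "\<dots> \<subseteq> leading (W j) l" using mono[OF that(1)] by (auto simp: leading_def)
    finally show ?thesis .
  qed
  have stable: "\<exists>n. \<forall>m\<ge>n. U m = U n"
    if "\<And>i. invariant_subspace T (U i)" "\<And>i. U i \<subseteq> V" "\<And>i. U i \<subseteq> U (Suc i)" for U
    using acc that unfolding ascending_chain_condition_def by blast
  have lead_V: "leading U k \<subseteq> V" for U k by (auto simp: leading_def)
  have inv: "invariant_subspace T (leading (W i) k)" for i k
    using * invariant_subspace_leading by blast
  have "\<exists>n. \<forall>m\<ge>n. leading (W m) m = leading (W n) n"
    by (rule stable) (simp_all add: inv lead_V lead_mono)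
  then obtain d where d: "\<And>m. m \<ge> d \<Longrightarrow> leading (W m) m = leading (W d) d" by blast
  have "\<exists>n. \<forall>m\<ge>n. leading (W m) k = leading (W n) k" for k
    by (rule stable) (simp_all add: inv lead_V lead_mono)
  then obtain n where n: "\<And>k m. m \<ge> n k \<Longrightarrow> leading (W m) k = leading (W (n k)) k" by metis
  define N where "N = Max (insert d (n ` {..<d}))"
  have N: "d \<le> N" "\<And>k. k < d \<Longrightarrow> n k \<le> N" by (auto simp: N_def)
  have "leading (W N) k = leading (W m) k" if m: "m \<ge> N" for m k
  proof (cases "k < d")
    case True
    then show ?thesis using n[of k m] n[of k N] N m by fastforce
  next
    case False
    have "leading (W i) k = leading (W d) d" if "i \<ge> d" for i
    proof
      show "leading (W d) d \<subseteq> leading (W i) k" using lead_mono False that by simp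
      have "leading (W i) k \<subseteq> leading (W (max i k)) (max i k)" by (rule lead_mono) auto
      then show "leading (W i) k \<subseteq> leading (W d) d" using d[of "max i k"] that by auto
    qed
    then show ?thesis using N m by simp
  qed
  then have "W N = W m" if "m \<ge> N" for m
    using eq_if_leading_eq[of "W N" "W m"] * mono that by blast
  then show "\<exists>n. \<forall>m\<ge>n. W m = W n" by metis
qed

end

text \<open>
  The argument of Hilbert's basis theorem, for a module over a polynomial ring that acts
  through commuting operators; the sum of the shifts of \<open>V\<close> need not be direct.
\<close>

theorem ascending_chain_condition_commuting:
  assumes "finite F" "\<And>t. t \<in> set ts \<Longrightarrow> Vector_Spaces.linear scale scale t"
    and "\<And>s t x. s \<in> set ts \<Longrightarrow> t \<in> set ts \<Longrightarrow> s (t x) = t (s x)"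
  shows "\<exists>V. invariant_subspace (set ts) V \<and> F \<subseteq> V \<and> ascending_chain_condition (set ts) V"
  using assms
proof (induction ts)
  case Nil
  then show ?case
    by (auto simp: invariant_subspace_def intro!: exI[of _ "span F"] ascending_chain_condition_span span_base)
next
  case (Cons t ts)
  then obtain V where V: "invariant_subspace (set ts) V" "F \<subseteq> V" "ascending_chain_condition (set ts) V"
    by auto
  have hyps: "Vector_Spaces.linear scale scale t" "\<And>s. s \<in> set ts \<Longrightarrow> Vector_Spaces.linear scale scale s"
    "\<And>s x. s \<in> set ts \<Longrightarrow> s (t x) = t (s x)"
    using Cons.prems by auto
  have "V \<subseteq> degree_filtration t V (Suc 0)" by auto
  then have "V \<subseteq> (\<Union>i. degree_filtration t V i)" by blast
  then show ?case
    using invariant_subspace_UN_degree_filtration[OF hyps V(1)] V(2)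
      ascending_chain_condition_UN_degree_filtration[OF hyps V(1) V(3)]
    by (metis list.simps(15) subset_trans)
qed

end

section \<open>Prime ideals and the Jacobson radical of a noncommutative ring\<close>

context ring
begin

lemma left_idealI:
  assumes "I \<subseteq> carrier R" "\<zero> \<in> I" "\<And>a b. a \<in> I \<Longrightarrow> b \<in> I \<Longrightarrow> a \<oplus> b \<in> I"
    and "\<And>a x. a \<in> I \<Longrightarrow> x \<in> carrier R \<Longrightarrow> x \<otimes> a \<in> I"
  shows "left_ideal R I"
proof -
  have neg: "\<ominus> a \<in> I" if "a \<in> I" for a
    using assms(4)[OF that, of "\<ominus> \<one>"] assms(1) that by (auto simp: l_minus)
  have "additive_subgroup I R"
    using assms neg by (intro additive_subgroup.intro add.subgroupI) (auto simp: a_inv_def)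
  then show ?thesis using assms(4) by (auto simp: left_ideal_def)
qed

lemma left_idealD:
  assumes "left_ideal R I"
  shows "I \<subseteq> carrier R" "\<zero> \<in> I" "a \<in> I \<Longrightarrow> b \<in> I \<Longrightarrow> a \<oplus> b \<in> I"
    "a \<in> I \<Longrightarrow> x \<in> carrier R \<Longrightarrow> x \<otimes> a \<in> I" "a \<in> I \<Longrightarrow> b \<in> I \<Longrightarrow> a \<ominus> b \<in> I"
proof -
  interpret additive_subgroup I R using assms by (simp add: left_ideal_def)
  show "I \<subseteq> carrier R" by (rule a_subset)
  show "\<zero> \<in> I" "a \<in> I \<Longrightarrow> b \<in> I \<Longrightarrow> a \<oplus> b \<in> I" by simp_all
  show "a \<in> I \<Longrightarrow> x \<in> carrier R \<Longrightarrow> x \<otimes> a \<in> I" using assms by (simp add: left_ideal_def)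
  show "a \<in> I \<Longrightarrow> b \<in> I \<Longrightarrow> a \<ominus> b \<in> I" using a_inv_closed by (simp add: minus_eq)
qed

lemma two_sided_idealI:
  assumes "I \<subseteq> carrier R" "\<zero> \<in> I" "\<And>a b. a \<in> I \<Longrightarrow> b \<in> I \<Longrightarrow> a \<oplus> b \<in> I"
    and "\<And>a x. a \<in> I \<Longrightarrow> x \<in> carrier R \<Longrightarrow> x \<otimes> a \<in> I"
    and "\<And>a x. a \<in> I \<Longrightarrow> x \<in> carrier R \<Longrightarrow> a \<otimes> x \<in> I"
  shows "ideal I R"
proof (rule idealI)
  show "subgroup I (add_monoid R)"
    using left_idealI[OF assms(1-4)] by (simp add: left_ideal_def additive_subgroup_def)
qed (auto intro: assms ring_axioms)

lemma two_sided_idealD: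
  assumes "ideal I R"
  shows "I \<subseteq> carrier R" "\<zero> \<in> I" "a \<in> I \<Longrightarrow> b \<in> I \<Longrightarrow> a \<oplus> b \<in> I"
    "a \<in> I \<Longrightarrow> x \<in> carrier R \<Longrightarrow> x \<otimes> a \<in> I" "a \<in> I \<Longrightarrow> x \<in> carrier R \<Longrightarrow> a \<otimes> x \<in> I"
    "a \<in> I \<Longrightarrow> b \<in> I \<Longrightarrow> a \<ominus> b \<in> I"
proof -
  interpret ideal I R by fact
  show "I \<subseteq> carrier R" by (rule a_subset)
  show "\<zero> \<in> I" "a \<in> I \<Longrightarrow> b \<in> I \<Longrightarrow> a \<oplus> b \<in> I" by simp_all
  show "a \<in> I \<Longrightarrow> x \<in> carrier R \<Longrightarrow> x \<otimes> a \<in> I" "a \<in> I \<Longrightarrow> x \<in> carrier R \<Longrightarrow> a \<otimes> x \<in> I"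
    by (simp_all add: I_l_closed I_r_closed)
  show "a \<in> I \<Longrightarrow> b \<in> I \<Longrightarrow> a \<ominus> b \<in> I" using a_inv_closed by (simp add: minus_eq)
qed

lemma left_ideal_add:
  assumes I: "left_ideal R I" and J: "left_ideal R J"
  shows "left_ideal R {a \<oplus> b | a b. a \<in> I \<and> b \<in> J}" (is "left_ideal R ?S")
proof (rule left_idealI)
  note ID = left_idealD[OF I] and JD = left_idealD[OF J]
  show "?S \<subseteq> carrier R" using ID(1) JD(1) by auto
  show "\<zero> \<in> ?S" using ID(2) JD(2) by force
  fix a assume "a \<in> ?S"
  then obtain i j where a: "a = i \<oplus> j" "i \<in> I" "j \<in> J" by auto
  then have c: "i \<in> carrier R" "j \<in> carrier R" using ID(1) JD(1) by auto
  show "x \<otimes> a \<in> ?S" if "x \<in> carrier R" for x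
  proof -
    have "x \<otimes> a = x \<otimes> i \<oplus> x \<otimes> j" using a c that by (simp add: r_distr)
    then show ?thesis using ID(4)[OF a(2) that] JD(4)[OF a(3) that] by blast
  qed
  fix b assume "b \<in> ?S"
  then obtain k l where b: "b = k \<oplus> l" "k \<in> I" "l \<in> J" by auto
  then have d: "k \<in> carrier R" "l \<in> carrier R" using ID(1) JD(1) by auto
  have "a \<oplus> b = (i \<oplus> k) \<oplus> (j \<oplus> l)" using a b c d by (simp add: a_ac)
  then show "a \<oplus> b \<in> ?S" using a b ID(3) JD(3) by blast
qed

lemma ideal_imp_left_ideal: "ideal I R \<Longrightarrow> left_ideal R I"
  by (rule left_idealI) (auto dest: two_sided_idealD)

lemma left_ideal_principal:
  assumes a: "a \<in> carrier R" shows "left_ideal R ((\<lambda>x. x \<otimes> a) ` carrier R)"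
proof (rule left_idealI)
  show "\<zero> \<in> (\<lambda>x. x \<otimes> a) ` carrier R" using a by (intro image_eqI[of _ _ \<zero>]) auto
  fix b assume "b \<in> (\<lambda>x. x \<otimes> a) ` carrier R"
  then obtain x where x: "b = x \<otimes> a" "x \<in> carrier R" by auto
  show "y \<otimes> b \<in> (\<lambda>x. x \<otimes> a) ` carrier R" if "y \<in> carrier R" for y
    using x a that by (intro image_eqI[of _ _ "y \<otimes> x"]) (auto simp: m_assoc)
  fix c assume "c \<in> (\<lambda>x. x \<otimes> a) ` carrier R"
  then obtain y where y: "c = y \<otimes> a" "y \<in> carrier R" by auto
  show "b \<oplus> c \<in> (\<lambda>x. x \<otimes> a) ` carrier R"
    using x y a by (intro image_eqI[of _ _ "x \<oplus> y"]) (auto simp: l_distr)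
qed (use a in auto)

lemma maximal_left_ideal_above:
  assumes I: "left_ideal R I" and one: "\<one> \<notin> I"
  shows "\<exists>Q. maximal_left_ideal R Q \<and> I \<subseteq> Q"
proof -
  let ?A = "{J. left_ideal R J \<and> I \<subseteq> J \<and> \<one> \<notin> J}"
  have "\<exists>Q\<in>?A. \<forall>J\<in>?A. Q \<subseteq> J \<longrightarrow> J = Q"
  proof (rule subset_Zorn_nonempty)
    have "I \<in> ?A" using I one by simp
    then show "?A \<noteq> {}" by blast
    fix C assume C: "C \<noteq> {}" "subset.chain ?A C"
    have CA: "\<And>J. J \<in> C \<Longrightarrow> left_ideal R J" "\<And>J. J \<in> C \<Longrightarrow> I \<subseteq> J" "\<And>J. J \<in> C \<Longrightarrow> \<one> \<notin> J"
      using C by (auto simp: subset_chain_def)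
    have "left_ideal R (\<Union>C)"
    proof (rule left_idealI)
      show "\<zero> \<in> \<Union>C" using C(1) CA(1) left_idealD(2) by blast
      show "a \<oplus> b \<in> \<Union>C" if ab: "a \<in> \<Union>C" "b \<in> \<Union>C" for a b
      proof -
        obtain J J' where J: "J \<in> C" "J' \<in> C" "a \<in> J" "b \<in> J'" using ab by blast
        then have "J \<subseteq> J' \<or> J' \<subseteq> J" using C(2) by (auto simp: subset_chain_def)
        then show ?thesis using J CA(1) left_idealD(3) by blast
      qed
    next
      fix a x assume "a \<in> \<Union>C" "x \<in> carrier R"
      then show "x \<otimes> a \<in> \<Union>C" using CA(1) left_idealD(4) by blast
    qed (use CA(1) left_idealD(1) in blast)
    moreover have "I \<subseteq> \<Union>C" "\<one> \<notin> \<Union>C" using CA(2,3) C(1) by blast+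
    ultimately show "\<Union>C \<in> ?A" by simp
  qed
  then obtain Q where "Q \<in> ?A" and QA: "\<forall>J\<in>?A. Q \<subseteq> J \<longrightarrow> J = Q" by (rule bexE)
  then have Q: "left_ideal R Q" "I \<subseteq> Q" "\<one> \<notin> Q" by simp_all
  have max: "J = Q" if "left_ideal R J" "I \<subseteq> J" "\<one> \<notin> J" "Q \<subseteq> J" for J
    using QA that by simp
  have "J = Q \<or> J = carrier R" if J: "left_ideal R J" "Q \<subseteq> J" for J
  proof (cases "\<one> \<in> J")
    case True
    then have "carrier R \<subseteq> J" using left_idealD(4)[OF J(1) True] by force
    then show ?thesis using left_idealD(1)[OF J(1)] by blast
  next
    case False
    then show ?thesis using max[OF J(1) _ False J(2)] Q J by blast
  qed
  then show ?thesis using Q unfolding maximal_left_ideal_def by blast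
qed

lemma one_notin_maximal_left_ideal:
  assumes "maximal_left_ideal R Q" shows "\<one> \<notin> Q"
proof
  assume one: "\<one> \<in> Q"
  have Q: "left_ideal R Q" "Q \<noteq> carrier R" using assms by (auto simp: maximal_left_ideal_def)
  have "carrier R \<subseteq> Q" using left_idealD(4)[OF Q(1) one] by force
  then show False using left_idealD(1)[OF Q(1)] Q(2) by blast
qed

lemma jacobson_radical_left_ideal: "left_ideal R (jacobson_radical R)"
proof -
  have "left_ideal R Q" if "maximal_left_ideal R Q" for Q using that by (simp add: maximal_left_ideal_def)
  then show ?thesis
    by (intro left_idealI) (auto simp: jacobson_radical_def dest: left_idealD)
qed

lemma jacobson_radical_left_inverse:
  assumes a: "a \<in> jacobson_radical R"
  shows "\<exists>u\<in>carrier R. u \<otimes> (\<one> \<ominus> a) = \<one>"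
proof (rule ccontr)
  have ac: "a \<in> carrier R" using a by (simp add: jacobson_radical_def)
  assume "\<not> ?thesis"
  then have "\<one> \<notin> (\<lambda>u. u \<otimes> (\<one> \<ominus> a)) ` carrier R" by (auto simp: image_iff)
  then obtain Q where Q: "maximal_left_ideal R Q" "(\<lambda>u. u \<otimes> (\<one> \<ominus> a)) ` carrier R \<subseteq> Q"
    using maximal_left_ideal_above[OF left_ideal_principal[of "\<one> \<ominus> a"]] ac by auto
  have "\<one> \<ominus> a \<in> Q" using Q(2) ac by (force intro: image_eqI[of _ _ \<one>])
  moreover have "a \<in> Q" using a Q(1) by (auto simp: jacobson_radical_def)
  moreover have "left_ideal R Q" using Q(1) by (simp add: maximal_left_ideal_def)
  ultimately have "(\<one> \<ominus> a) \<oplus> a \<in> Q" using left_idealD(3) by blast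
  then have "\<one> \<in> Q" using ac by (simp add: minus_eq a_assoc l_neg)
  then show False using one_notin_maximal_left_ideal Q(1) by blast
qed

lemma maximal_left_ideal_complement:
  assumes Q: "maximal_left_ideal R Q" and I: "left_ideal R I" "\<not> I \<subseteq> Q"
  shows "\<exists>b\<in>I. \<exists>q\<in>Q. \<one> = b \<oplus> q"
proof -
  have Q': "left_ideal R Q" using Q by (simp add: maximal_left_ideal_def)
  define S where "S = {a \<oplus> b | a b. a \<in> I \<and> b \<in> Q}"
  note ID = left_idealD[OF I(1)] and QD = left_idealD[OF Q']
  have memS: "a \<oplus> b \<in> S" if "a \<in> I" "b \<in> Q" for a b using that by (auto simp: S_def)
  have S: "left_ideal R S" unfolding S_def using left_ideal_add[OF I(1) Q'] .
  have QS: "Q \<subseteq> S"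
  proof
    fix q assume q: "q \<in> Q"
    then show "q \<in> S" using memS[OF ID(2) q] QD(1) by auto
  qed
  have IS: "I \<subseteq> S"
  proof
    fix q assume q: "q \<in> I"
    then show "q \<in> S" using memS[OF q QD(2)] ID(1) by auto
  qed
  have "S = Q \<or> S = carrier R"
    using Q S QS by (simp add: maximal_left_ideal_def)
  then have "S = carrier R" using IS I(2) by blast
  then have "\<one> \<in> S" by simp
  then show ?thesis unfolding S_def by blast
qed

lemma jacobson_radicalI:
  assumes a: "a \<in> carrier R"
    and inv: "\<And>x. x \<in> carrier R \<Longrightarrow> \<exists>u\<in>carrier R. u \<otimes> (\<one> \<ominus> x \<otimes> a) = \<one>"
  shows "a \<in> jacobson_radical R"
proof (rule ccontr)
  assume "a \<notin> jacobson_radical R"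
  then obtain Q where Q: "maximal_left_ideal R Q" "a \<notin> Q"
    using a by (auto simp: jacobson_radical_def)
  have "a \<in> (\<lambda>x. x \<otimes> a) ` carrier R" using a by (intro image_eqI[of _ _ \<one>]) auto
  then obtain x q where xq: "x \<in> carrier R" "q \<in> Q" "\<one> = x \<otimes> a \<oplus> q"
    using maximal_left_ideal_complement[OF Q(1) left_ideal_principal[OF a]] Q(2) by blast
  have Q': "left_ideal R Q" using Q by (simp add: maximal_left_ideal_def)
  have qc: "q \<in> carrier R" using xq(2) left_idealD(1)[OF Q'] by blast
  have "\<one> \<ominus> x \<otimes> a = (x \<otimes> a \<oplus> q) \<ominus> x \<otimes> a" using xq(3) by simp
  also have "\<dots> = q" using xq(1) a qc by (simp add: minus_eq a_ac r_neg1 r_neg2 r_neg)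
  finally obtain u where "u \<in> carrier R" "u \<otimes> q = \<one>" using inv[OF xq(1)] by auto
  then have "\<one> \<in> Q" using left_idealD(4)[OF Q' xq(2)] by metis
  then show False using one_notin_maximal_left_ideal Q(1) by blast
qed

lemma ideal_prod_subset:
  assumes P: "ideal P R" and IJ: "\<And>i j. i \<in> I \<Longrightarrow> j \<in> J \<Longrightarrow> i \<otimes> j \<in> P"
  shows "I \<cdot> J \<subseteq> P"
proof
  fix x assume "x \<in> I \<cdot> J"
  then show "x \<in> P"
    by (induction rule: ideal_prod.induct) (auto intro: IJ two_sided_idealD[OF P])
qed

text \<open>The core of a maximal left ideal is prime.\<close>

lemma prime_ideal_in_maximal_left_ideal:
  assumes Q: "maximal_left_ideal R Q"
  shows "\<exists>P. prime_ideal R P \<and> P \<subseteq> Q"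
proof -
  have Q': "left_ideal R Q" using Q by (simp add: maximal_left_ideal_def)
  note QD = left_idealD[OF Q']
  define P where "P = {a \<in> carrier R. \<forall>x\<in>carrier R. a \<otimes> x \<in> Q}"
  have PQ: "P \<subseteq> Q"
  proof
    fix a assume "a \<in> P"
    then have "a \<in> carrier R" "a \<otimes> \<one> \<in> Q" unfolding P_def by blast+
    then show "a \<in> Q" by simp
  qed
  have P: "ideal P R"
    by (rule two_sided_idealI) (auto simp: P_def l_distr m_assoc QD)
  have max: "I \<subseteq> P" if "ideal I R" "I \<subseteq> Q" for I
    using two_sided_idealD[OF that(1)] that(2) by (auto simp: P_def)
  have "I \<subseteq> P \<or> J \<subseteq> P" if I: "ideal I R" and J: "ideal J R" and IJ: "I \<cdot> J \<subseteq> P" for I J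
  proof (cases "J \<subseteq> Q")
    case True
    then show ?thesis using max J by blast
  next
    case False
    then obtain b q where b: "b \<in> J" "q \<in> Q" "\<one> = b \<oplus> q"
      using maximal_left_ideal_complement[OF Q ideal_imp_left_ideal[OF J]] by blast
    then have c: "b \<in> carrier R" "q \<in> carrier R" using two_sided_idealD(1)[OF J] QD(1) by auto
    have "a \<in> Q" if a: "a \<in> I" for a
    proof -
      have ac: "a \<in> carrier R" using a two_sided_idealD(1)[OF I] by blast
      have "a = a \<otimes> \<one>" using ac by simp
      also have "\<dots> = a \<otimes> b \<oplus> a \<otimes> q" using ac c by (subst b(3)) (simp add: r_distr)
      finally have "a = a \<otimes> b \<oplus> a \<otimes> q" .
      moreover have "a \<otimes> b \<in> Q" using IJ PQ ideal_prod.prod[OF a b(1)] by blast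
      moreover have "a \<otimes> q \<in> Q" using QD(4) b(2) ac by blast
      ultimately show "a \<in> Q" using QD(3) by metis
    qed
    then show ?thesis using max I by blast
  qed
  moreover have "P \<noteq> carrier R" using PQ one_notin_maximal_left_ideal[OF Q] by blast
  ultimately show ?thesis using P PQ unfolding prime_ideal_def by blast
qed

lemma prime_radical_subset_jacobson_radical: "prime_radical R \<subseteq> jacobson_radical R"
  using prime_ideal_in_maximal_left_ideal
  by (fastforce simp: prime_radical_def jacobson_radical_def Spec_def)

lemma prime_idealD:
  assumes "prime_ideal R P"
  shows "ideal P R" "\<one> \<notin> P"
proof -
  show P: "ideal P R" using assms by (simp add: prime_ideal_def)
  show "\<one> \<notin> P"
    using assms ideal.one_imp_carrier[OF P] by (auto simp: prime_ideal_def)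
qed

lemma prime_ideal_elements:
  assumes P: "prime_ideal R P" and a: "a \<in> carrier R" and b: "b \<in> carrier R"
    and ab: "\<And>x. x \<in> carrier R \<Longrightarrow> a \<otimes> x \<otimes> b \<in> P"
  shows "a \<in> P \<or> b \<in> P"
proof -
  note PD = two_sided_idealD[OF prime_idealD(1)[OF P]]
  define J where "J = {y \<in> carrier R. \<forall>x\<in>carrier R. a \<otimes> x \<otimes> y \<in> P}"
  define I where "I = {x \<in> carrier R. \<forall>y\<in>J. x \<otimes> y \<in> P}"
  have Jc: "J \<subseteq> carrier R" by (auto simp: J_def)
  have J: "ideal J R"
  proof (rule two_sided_idealI)
    show "\<zero> \<in> J" using a PD(2) by (auto simp: J_def)
    fix y assume y: "y \<in> J"
    then have yc: "y \<in> carrier R" by (simp add: J_def)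
    show "z \<otimes> y \<in> J" if z: "z \<in> carrier R" for z
    proof -
      have "a \<otimes> x \<otimes> (z \<otimes> y) = a \<otimes> (x \<otimes> z) \<otimes> y" if "x \<in> carrier R" for x
        using that a yc z by (simp add: m_assoc)
      then show ?thesis using y z yc by (auto simp: J_def)
    qed
    show "y \<otimes> z \<in> J" if z: "z \<in> carrier R" for z
    proof -
      have "a \<otimes> x \<otimes> (y \<otimes> z) = (a \<otimes> x \<otimes> y) \<otimes> z" if "x \<in> carrier R" for x
        using that a yc z by (simp add: m_assoc)
      then show ?thesis using y z yc PD(5) by (auto simp: J_def)
    qed
    fix y' assume "y' \<in> J"
    then show "y \<oplus> y' \<in> J" using y a PD(3) by (auto simp: J_def r_distr)
  qed (rule Jc)
  have I: "ideal I R"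
  proof (rule two_sided_idealI)
    show "\<zero> \<in> I" using Jc PD(2) by (auto simp: I_def subset_iff)
    fix x assume x: "x \<in> I"
    then have xc: "x \<in> carrier R" by (simp add: I_def)
    show "z \<otimes> x \<in> I" if z: "z \<in> carrier R" for z
      using x z xc Jc PD(4) by (auto simp: I_def m_assoc subset_iff)
    show "x \<otimes> z \<in> I" if z: "z \<in> carrier R" for z
      using x z xc Jc two_sided_idealD(4)[OF J _ z] by (auto simp: I_def m_assoc subset_iff)
    fix x' assume "x' \<in> I"
    then show "x \<oplus> x' \<in> I" using x Jc PD(3) by (auto simp: I_def l_distr subset_iff)
  qed (auto simp: I_def)
  have "I \<cdot> J \<subseteq> P" by (rule ideal_prod_subset[OF prime_idealD(1)[OF P]]) (simp add: I_def)
  then have "I \<subseteq> P \<or> J \<subseteq> P" using P I J by (auto simp: prime_ideal_def)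
  moreover have "b \<in> J" using ab b by (simp add: J_def)
  moreover have "a \<in> I"
  proof -
    have "a \<otimes> y \<in> P" if "y \<in> J" for y
    proof -
      have "a \<otimes> \<one> \<otimes> y \<in> P" using that by (auto simp: J_def)
      then show ?thesis using a by simp
    qed
    then show ?thesis using a by (simp add: I_def)
  qed
  ultimately show ?thesis by blast
qed

lemma prime_ideal_avoiding_powers:
  assumes w: "w \<in> carrier R" and nil: "\<And>k::nat. w [^] k \<noteq> \<zero>"
  shows "\<exists>P. prime_ideal R P \<and> (\<forall>k::nat. w [^] k \<notin> P)"
proof -
  let ?A = "{I. ideal I R \<and> (\<forall>k::nat. w [^] k \<notin> I)}"
  have "\<exists>P\<in>?A. \<forall>J\<in>?A. P \<subseteq> J \<longrightarrow> J = P"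
  proof (rule subset_Zorn_nonempty)
    have "{\<zero>} \<in> ?A" using zeroideal nil by simp
    then show "?A \<noteq> {}" by blast
    fix C assume C: "C \<noteq> {}" "subset.chain ?A C"
    have CA: "\<And>J. J \<in> C \<Longrightarrow> ideal J R" "\<And>J (k::nat). J \<in> C \<Longrightarrow> w [^] k \<notin> J"
      using C by (auto simp: subset_chain_def)
    have "ideal (\<Union>C) R"
    proof (rule two_sided_idealI)
      show "\<zero> \<in> \<Union>C" using C(1) CA(1) two_sided_idealD(2) by blast
      show "a \<oplus> b \<in> \<Union>C" if ab: "a \<in> \<Union>C" "b \<in> \<Union>C" for a b
      proof -
        obtain J J' where J: "J \<in> C" "J' \<in> C" "a \<in> J" "b \<in> J'" using ab by blast
        then have "J \<subseteq> J' \<or> J' \<subseteq> J" using C(2) by (auto simp: subset_chain_def)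
        then show ?thesis using J CA(1) two_sided_idealD(3) by blast
      qed
    next
      fix a x assume "a \<in> \<Union>C" "x \<in> carrier R"
      then show "x \<otimes> a \<in> \<Union>C" "a \<otimes> x \<in> \<Union>C" using CA(1) two_sided_idealD(4,5) by blast+
    qed (use CA(1) two_sided_idealD(1) in blast)
    then show "\<Union>C \<in> ?A" using CA(2) by simp
  qed
  then obtain P where "P \<in> ?A" and PA: "\<forall>J\<in>?A. P \<subseteq> J \<longrightarrow> J = P" by (rule bexE)
  then have P: "ideal P R" "\<And>k::nat. w [^] k \<notin> P" by simp_all
  have max: "J = P" if "ideal J R" "\<And>k::nat. w [^] k \<notin> J" "P \<subseteq> J" for J
    using PA that by simp
  note PD = two_sided_idealD[OF P(1)]
  have sum: "\<exists>k::nat. \<exists>a\<in>I. \<exists>p\<in>P. w [^] k = a \<oplus> p" if I: "ideal I R" "\<not> I \<subseteq> P" for I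
  proof (rule ccontr)
    assume *: "\<not> ?thesis"
    note ID = two_sided_idealD[OF I(1)]
    define S where "S = {a \<oplus> p | a p. a \<in> I \<and> p \<in> P}"
    have memS: "a \<oplus> p \<in> S" if "a \<in> I" "p \<in> P" for a p using that by (auto simp: S_def)
    have "left_ideal R S"
      unfolding S_def by (intro left_ideal_add ideal_imp_left_ideal I(1) P(1))
    note SD = left_idealD[OF this]
    have "ideal S R"
    proof (rule two_sided_idealI)
      fix s x assume "s \<in> S" and x: "x \<in> carrier R"
      then obtain a p where s: "s = a \<oplus> p" "a \<in> I" "p \<in> P" unfolding S_def by blast
      then have "s \<otimes> x = a \<otimes> x \<oplus> p \<otimes> x" using ID(1) PD(1) x by (auto simp: l_distr subset_iff)
      then show "s \<otimes> x \<in> S" using memS[OF ID(5)[OF s(2) x] PD(5)[OF s(3) x]] by simp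
    qed (fact SD)+
    moreover have "w [^] k \<notin> S" for k :: nat using * by (auto simp: S_def)
    moreover have "P \<subseteq> S"
    proof
      fix q assume q: "q \<in> P"
      then show "q \<in> S" using memS[OF ID(2) q] PD(1) by auto
    qed
    ultimately have "S = P" using max[of S] by simp
    moreover have "I \<subseteq> S"
    proof
      fix q assume q: "q \<in> I"
      then show "q \<in> S" using memS[OF q PD(2)] ID(1) by auto
    qed
    ultimately show False using I(2) by simp
  qed
  have "I \<subseteq> P \<or> J \<subseteq> P" if I: "ideal I R" and J: "ideal J R" and IJ: "I \<cdot> J \<subseteq> P" for I J
  proof (rule ccontr)
    assume "\<not> ?thesis"
    then obtain k l :: nat and a p b q where *: "a \<in> I" "p \<in> P" "w [^] k = a \<oplus> p"
      "b \<in> J" "q \<in> P" "w [^] l = b \<oplus> q" using sum I J by metis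
    then have c: "a \<in> carrier R" "p \<in> carrier R" "b \<in> carrier R" "q \<in> carrier R"
      using two_sided_idealD(1)[OF I] two_sided_idealD(1)[OF J] PD(1) by auto
    have "w [^] (k + l) = (a \<oplus> p) \<otimes> (b \<oplus> q)"
      using * w by (simp add: nat_pow_mult[symmetric])
    also have "\<dots> = a \<otimes> b \<oplus> (a \<otimes> q \<oplus> p \<otimes> (b \<oplus> q))"
      using c by (simp add: l_distr r_distr a_ac)
    also have "\<dots> \<in> P"
      using * c IJ ideal_prod.prod[of a I b J] by (intro PD(3)) (auto intro: PD)
    finally show False using P(2) by blast
  qed
  moreover have "P \<noteq> carrier R" using P(2)[of 0] by auto
  ultimately show ?thesis using P unfolding prime_ideal_def by blast
qed

lemma minimal_prime_ideal_below:
  assumes P: "prime_ideal R P"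
  shows "\<exists>Q. minimal_prime_ideal R Q \<and> Q \<subseteq> P"
proof -
  let ?A = "{- Q | Q. prime_ideal R Q \<and> Q \<subseteq> P}"
  have "\<exists>M\<in>?A. \<forall>X\<in>?A. M \<subseteq> X \<longrightarrow> X = M"
  proof (rule subset_Zorn_nonempty)
    show "?A \<noteq> {}" using P by blast
    fix C assume C: "C \<noteq> {}" "subset.chain ?A C"
    define E where "E = uminus ` C"
    have D: "\<And>Q. Q \<in> E \<Longrightarrow> prime_ideal R Q" "\<And>Q. Q \<in> E \<Longrightarrow> Q \<subseteq> P"
      "\<And>Q Q'. Q \<in> E \<Longrightarrow> Q' \<in> E \<Longrightarrow> Q \<subseteq> Q' \<or> Q' \<subseteq> Q"
      using C unfolding subset_chain_def E_def by (fastforce, fastforce, blast)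
    obtain Q0 where Q0: "Q0 \<in> E" using C(1) by (auto simp: E_def)
    have ids: "\<And>Q. Q \<in> E \<Longrightarrow> ideal Q R" using D(1) prime_idealD by blast
    have "ideal (\<Inter>E) R"
    proof (rule two_sided_idealI)
      show "\<Inter>E \<subseteq> carrier R" using Q0 two_sided_idealD(1)[OF ids] by blast
    next
      show "\<zero> \<in> \<Inter>E" using ids two_sided_idealD(2) by blast
    next
      fix a b assume "a \<in> \<Inter>E" "b \<in> \<Inter>E"
      then show "a \<oplus> b \<in> \<Inter>E" using ids two_sided_idealD(3) by blast
    next
      fix a x assume "a \<in> \<Inter>E" "x \<in> carrier R"
      then show "x \<otimes> a \<in> \<Inter>E" "a \<otimes> x \<in> \<Inter>E" using ids two_sided_idealD(4,5) by blast+
    qed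
    moreover have "I \<subseteq> \<Inter>E \<or> J \<subseteq> \<Inter>E"
      if I: "ideal I R" "ideal J R" "I \<cdot> J \<subseteq> \<Inter>E" for I J
    proof (rule ccontr)
      assume "\<not> ?thesis"
      then obtain Q Q' where Q: "Q \<in> E" "\<not> I \<subseteq> Q" "Q' \<in> E" "\<not> J \<subseteq> Q'" by blast
      have "I \<subseteq> Q'' \<or> J \<subseteq> Q''" if "Q'' \<in> E" for Q''
        using D(1)[OF that] I that unfolding prime_ideal_def by blast
      then show False using Q D(3)[of Q Q'] by blast
    qed
    moreover have "\<Inter>E \<noteq> carrier R" using Q0 prime_idealD(2)[OF D(1)[OF Q0]] by blast
    ultimately have "prime_ideal R (\<Inter>E)" unfolding prime_ideal_def by blast
    moreover have "\<Inter>E \<subseteq> P" using Q0 D(2) by blast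
    moreover have "\<Union>C = - \<Inter>E" by (auto simp: E_def)
    ultimately show "\<Union>C \<in> ?A" by blast
  qed
  then obtain M where "M \<in> ?A" and max: "\<forall>X\<in>?A. M \<subseteq> X \<longrightarrow> X = M" by (rule bexE)
  then obtain Q where M: "M = - Q" and Q: "prime_ideal R Q" "Q \<subseteq> P" by blast
  have "Q' = Q" if Q': "prime_ideal R Q'" "Q' \<subseteq> Q" for Q'
  proof -
    have "- Q' \<in> ?A" using Q' Q(2) by blast
    then have "- Q' = - Q" using max[rule_format, of "- Q'"] M Q'(2) by blast
    then show ?thesis by (rule compl_eq_compl_iff[THEN iffD1])
  qed
  then have "minimal_prime_ideal R Q" using Q by (simp add: minimal_prime_ideal_def Spec_def)
  then show ?thesis using Q by blast
qed

end

section \<open>The structure monoid as a finite extension of a commutative monoid\<close>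

lemma uniform_period_of_bijections:
  "\<exists>N>0. \<forall>f :: 'a::finite \<Rightarrow> 'a. bij f \<longrightarrow> f ^^ N = id"
proof -
  have "\<exists>n>0. bij f \<longrightarrow> f ^^ n = id" for f :: "'a \<Rightarrow> 'a"
  proof (cases "bij f")
    case True
    have "\<not> inj (\<lambda>n. f ^^ n)" using finite_imageD[of "\<lambda>n. f ^^ n" UNIV] infinite_UNIV_nat by auto
    then obtain i j where ij: "f ^^ i = f ^^ j" "i < j" by (metis (lifting) injI linorder_neqE_nat)
    have "(f ^^ i) ((f ^^ (j - i)) x) = (f ^^ i) x" for x
      using ij funpow_add[of i "j - i" f] by (metis comp_apply le_add_diff_inverse less_imp_le)
    moreover have "inj (f ^^ i)" using True by (simp add: bij_is_inj inj_fn)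
    ultimately have "f ^^ (j - i) = id" unfolding fun_eq_iff id_apply by (metis injD)
    then show ?thesis using ij(2) by (intro exI[of _ "j - i"]) auto
  qed auto
  then obtain n :: "('a \<Rightarrow> 'a) \<Rightarrow> nat" where n: "\<And>f. n f > 0" "\<And>f. bij f \<Longrightarrow> f ^^ n f = id" by metis
  have "f ^^ (\<Prod>g\<in>UNIV. n g) = id" if "bij f" for f :: "'a \<Rightarrow> 'a"
  proof -
    have "n f dvd (\<Prod>g\<in>UNIV. n g)" by (rule dvd_prodI) auto
    then obtain k where "(\<Prod>g\<in>UNIV. n g) = n f * k" by (auto elim: dvdE)
    then show ?thesis using n(2)[OF that] by (simp add: funpow_mult[symmetric])
  qed
  moreover have "(\<Prod>g\<in>UNIV. n g) > 0" using n(1) by simp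
  ultimately show ?thesis by blast
qed

locale yb_monoid = monoid M for M :: "('m, 'c) monoid_scheme" (structure) +
  fixes t :: "'x::finite \<Rightarrow> 'm" and act :: "'m \<Rightarrow> 'x \<Rightarrow> 'x" and len :: "'m \<Rightarrow> nat" and MX :: "'m set"
  assumes t_closed [simp, intro]: "t x \<in> carrier M"
    and bij_act: "a \<in> carrier M \<Longrightarrow> bij (act a)"
    and mult_t: "a \<in> carrier M \<Longrightarrow> a \<otimes> t x = t (act a x) \<otimes> a"
    and t_commute: "t x \<otimes> t y = t y \<otimes> t x"
    and finitely_generated_over_t: "\<exists>F\<subseteq>carrier M. finite F \<and>
      (\<forall>a\<in>carrier M. \<exists>xs. \<exists>f\<in>F. a = foldr (\<lambda>x b. t x \<otimes> b) xs f)"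
    and len_mult: "a \<in> carrier M \<Longrightarrow> b \<in> carrier M \<Longrightarrow> len (a \<otimes> b) = len a + len b"
    and len_eq_0: "a \<in> carrier M \<Longrightarrow> len a = 0 \<Longrightarrow> a = \<one>"
    and MX_closed: "MX \<subseteq> carrier M"
    and MX_r_mult: "a \<in> carrier M \<Longrightarrow> b \<in> MX \<Longrightarrow> b \<otimes> a \<in> MX"
    and set_power_MX_divisible:
      "a \<in> carrier M \<Longrightarrow> b \<in> set_power M MX (len a) \<Longrightarrow> \<exists>c\<in>carrier M. b = a \<otimes> c"
    and prod_t_in_MX: "(\<And>x. x \<in> set xs) \<Longrightarrow> foldr (\<lambda>x b. t x \<otimes> b) xs \<one> \<in> MX"

locale yb_solution =
  fixes r :: "'x::finite \<times> 'x \<Rightarrow> 'x \<times> 'x"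
  assumes yb: "yang_baxter r" and bij_r: "bij r" and nondeg: "left_nondegenerate r"
begin

definition lam :: "'x \<Rightarrow> 'x \<Rightarrow> 'x" where "lam x y = fst (r (x, y))"
definition rho :: "'x \<Rightarrow> 'x \<Rightarrow> 'x" where "rho x y = snd (r (x, y))"
definition linv :: "'x \<Rightarrow> 'x \<Rightarrow> 'x" where "linv x = inv_into UNIV (lam x)"

lemma bij_lam: "bij (lam x)"
  using nondeg unfolding left_nondegenerate_def lam_def[abs_def] by blast

lemma lam_linv [simp]: "lam x (linv x y) = y" and linv_lam [simp]: "linv x (lam x y) = y"
  using bij_lam[of x] by (simp_all add: linv_def bij_is_surj surj_f_inv_f bij_is_inj inv_f_f)

lemma lam_lam: "lam (lam x y) (lam (rho x y) z) = lam x (lam y z)"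
  and rho_lam: "rho (lam x y) (lam (rho x y) z) = lam (rho x (lam y z)) (rho y z)"
  using fun_cong[OF yb[unfolded yang_baxter_def], of "(x, y, z)"]
  by (simp_all add: r_id_def id_r_def lam_def rho_def prod_eq_iff case_prod_unfold)

definition sig :: "'x \<Rightarrow> 'x \<Rightarrow> 'x" where "sig y x = lam y (rho x (linv x y))"

lemma bij_sig: "bij (sig y)"
proof -
  have "inj (sig y)"
  proof (rule injI)
    fix x x' assume eq: "sig y x = sig y x'"
    then have "rho x (linv x y) = rho x' (linv x' y)"
      using bij_is_inj[OF bij_lam, of y] by (auto simp: sig_def dest: injD)
    then have "r (x, linv x y) = r (x', linv x' y)"
      using lam_linv[of x y] lam_linv[of x' y] by (simp add: lam_def rho_def prod_eq_iff del: lam_linv)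
    then have "(x, linv x y) = (x', linv x' y)" using bij_is_inj[OF bij_r] by (rule injD[rotated])
    then show "x = x'" by (rule Pair_inject)
  qed
  then show ?thesis by (simp add: bij_def finite_UNIV_inj_surj)
qed

lemma lam_sig: "lam a (sig y x) = sig (lam a y) (lam a x)"
proof -
  define z where "z = linv x y"
  have y: "y = lam x z" by (simp add: z_def)
  have "linv (lam a x) (lam a y) = lam (rho a x) z"
    unfolding y lam_lam[of a x z, symmetric] by simp
  then have "sig (lam a y) (lam a x) = lam (lam a y) (rho (lam a x) (lam (rho a x) z))"
    by (simp only: sig_def)
  also have "\<dots> = lam (lam a y) (lam (rho a y) (rho x z))"
    by (simp only: rho_lam y)
  also have "\<dots> = lam a (sig y x)" by (simp add: lam_lam sig_def z_def)
  finally show ?thesis by simp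
qed

primrec wact :: "'x list \<Rightarrow> 'x \<Rightarrow> 'x"
  where "wact [] = id" | "wact (x # u) = lam x \<circ> wact u"

lemma wact_append: "wact (u @ v) = wact u \<circ> wact v"
  by (induction u) auto

lemma bij_wact: "bij (wact u)"
proof (induction u)
  case (Cons x u)
  then show ?case unfolding wact.simps by (intro bij_comp bij_lam)
qed (simp only: wact.simps bij_id)

lemma wact_word_cong: "word_cong r u v \<Longrightarrow> wact u = wact v"
proof (induction rule: word_cong.induct)
  case (rel x y)
  show ?case using lam_lam[of x y] by (auto simp: lam_def rho_def)
qed (auto simp: wact_append)

lemma length_word_cong: "word_cong r u v \<Longrightarrow> length u = length v"
  by (induction rule: word_cong.induct) auto

lemma inv_wact_sig: "inv_into UNIV (wact u) (sig y x) = sig (inv_into UNIV (wact u) y) (inv_into UNIV (wact u) x)"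
proof -
  have "wact u (sig y x) = sig (wact u y) (wact u x)" for x y
    by (induction u) (simp_all add: lam_sig)
  then show ?thesis
    using bij_wact[of u] by (metis bij_inv_eq_iff)
qed

text \<open>
  \<open>to_word\<close> and \<open>to_sum\<close> are mutually inverse and identify $M$ with the derived (additive)
  structure monoid, in which $x + y = y + \sigma_y(x)$:
  the sum $y_1 + \dots + y_n$ stands for $y_1 \circ \lambda_{y_1}^{-1}(y_2 + \dots + y_n)$.
\<close>

function to_word :: "'x list \<Rightarrow> 'x list"
  where "to_word [] = []" | "to_word (y # ys) = y # to_word (map (linv y) ys)"
  by pat_completeness auto
termination by (relation "measure length") auto

primrec to_sum :: "'x list \<Rightarrow> 'x list"
  where "to_sum [] = []" | "to_sum (x # u) = x # map (lam x) (to_sum u)"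

lemma to_word_to_sum [simp]: "to_word (to_sum u) = u"
  by (induction u) (simp_all add: o_def)

lemma length_to_word [simp]: "length (to_word ys) = length ys"
  by (induction ys rule: to_word.induct) auto

lemma length_to_sum [simp]: "length (to_sum u) = length u"
  by (induction u) auto

lemma to_sum_to_word [simp]: "to_sum (to_word ys) = ys"
  by (induction ys rule: to_word.induct) (simp_all add: o_def)

lemma to_sum_append: "to_sum (u @ v) = to_sum u @ map (wact u) (to_sum v)"
  by (induction u) simp_all

lemma to_word_append: "to_word (ys @ zs) = to_word ys @ to_word (map (inv_into UNIV (wact (to_word ys))) zs)"
proof -
  let ?u = "to_word ys" and ?v = "to_word (map (inv_into UNIV (wact (to_word ys))) zs)"
  have "to_sum (?u @ ?v) = ys @ zs"
    using bij_wact[of ?u] by (simp add: to_sum_append o_def bij_is_surj surj_f_inv_f)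
  then show ?thesis by (metis to_word_to_sum)
qed

definition sum_cong :: "'x list \<Rightarrow> 'x list \<Rightarrow> bool"
  where "sum_cong ys zs \<longleftrightarrow> word_cong r (to_word ys) (to_word zs)"

lemma sum_cong_refl: "sum_cong ys ys"
  by (simp add: sum_cong_def word_cong.refl)

lemma sum_cong_trans [trans]: "sum_cong ys zs \<Longrightarrow> sum_cong zs us \<Longrightarrow> sum_cong ys us"
  unfolding sum_cong_def by (rule word_cong.trans)

lemma sum_cong_append: "sum_cong ys zs \<Longrightarrow> sum_cong (ys @ us) (zs @ us)"
  unfolding sum_cong_def to_word_append
  by (metis word_cong.append word_cong.refl wact_word_cong)

lemma sum_cong_swap: "sum_cong (us @ [x, y] @ vs) (us @ [y, sig y x] @ vs)"
proof -
  have "word_cong r (to_word [a, b]) (to_word [b, sig b a])" for a b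
  proof -
    have "word_cong r [a, linv a b] [lam a (linv a b), rho a (linv a b)]"
      using word_cong.rel[of r a "linv a b"] by (simp add: lam_def rho_def)
    then show ?thesis by (simp add: sig_def)
  qed
  then have base: "sum_cong ([a, b] @ ws) ([b, sig b a] @ ws)" for a b ws
    by (intro sum_cong_append) (simp add: sum_cong_def)
  let ?h = "inv_into UNIV (wact (to_word us))"
  have "sum_cong ([?h x, ?h y] @ map ?h vs) ([?h y, ?h (sig y x)] @ map ?h vs)"
    unfolding inv_wact_sig by (rule base)
  then have "sum_cong (map ?h ([x, y] @ vs)) (map ?h ([y, sig y x] @ vs))" by simp
  then show ?thesis
    unfolding sum_cong_def to_word_append[of us] by (intro word_cong.append word_cong.refl)
qed

lemma sum_cong_move: "sum_cong (us @ as @ [y] @ vs) (us @ [y] @ map (sig y) as @ vs)"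
proof (induction as arbitrary: vs rule: rev_induct)
  case Nil
  show ?case by (simp add: sum_cong_refl)
next
  case (snoc x as)
  have "sum_cong (us @ (as @ [x]) @ [y] @ vs) ((us @ as) @ [y, sig y x] @ vs)"
    using sum_cong_swap[of "us @ as" x y vs] by simp
  also have "sum_cong ((us @ as) @ [y, sig y x] @ vs) (us @ [y] @ map (sig y) as @ [sig y x] @ vs)"
    using snoc[of "[sig y x] @ vs"] by simp
  finally show ?case by simp
qed

lemma sum_cong_move_replicate:
  "sum_cong (us @ as @ replicate k y) (us @ replicate k y @ map (sig y ^^ k) as)"
proof (induction k arbitrary: us as)
  case 0
  show ?case by (simp add: sum_cong_refl)
next
  case (Suc k)
  have "sum_cong (us @ as @ replicate (Suc k) y) ((us @ [y]) @ map (sig y) as @ replicate k y)"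
    using sum_cong_move[of us as y "replicate k y"] by simp
  also have "sum_cong \<dots> ((us @ [y]) @ replicate k y @ map (sig y ^^ k) (map (sig y) as))"
    by (rule Suc)
  also have "\<dots> = us @ replicate (Suc k) y @ map (sig y ^^ Suc k) as"
    by (simp add: funpow_Suc_right del: funpow.simps)
  finally show ?case .
qed

lemma sum_cong_collect:
  assumes "k \<le> count_list us y"
  shows "\<exists>vs. sum_cong (ws @ us) (ws @ replicate k y @ vs)"
  using assms
proof (induction k arbitrary: ws us)
  case 0
  show ?case using sum_cong_refl by (metis append_Nil replicate_0)
next
  case (Suc k)
  then have "y \<in> set us" using count_notin by fastforce
  then obtain as bs where us_eq: "us = as @ y # bs" "y \<notin> set as"
    using split_list_first by metis
  then have "k \<le> count_list (map (sig y) as @ bs) y" using Suc.prems by (simp add: count_notin)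
  then obtain vs where "sum_cong ((ws @ [y]) @ map (sig y) as @ bs) ((ws @ [y]) @ replicate k y @ vs)"
    using Suc.IH by blast
  moreover have "sum_cong (ws @ us) ((ws @ [y]) @ map (sig y) as @ bs)"
    using sum_cong_move[of ws as y bs] by (simp add: us_eq)
  ultimately have "sum_cong (ws @ us) ((ws @ [y]) @ replicate k y @ vs)"
    using sum_cong_trans by blast
  then show ?case by (intro exI[of _ vs]) simp
qed

lemma wact_inverse: "\<exists>v. wact u \<circ> wact v = id"
proof -
  obtain N where N: "N > 0" "\<And>f :: 'x \<Rightarrow> 'x. bij f \<Longrightarrow> f ^^ N = id"
    using uniform_period_of_bijections by blast
  have pow: "wact (concat (replicate n u)) = wact u ^^ n" for n
    by (induction n) (simp_all add: wact_append)
  have "wact u \<circ> wact (concat (replicate (N - 1) u)) = wact u ^^ Suc (N - 1)"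
    by (simp add: pow)
  then show ?thesis using N bij_wact by auto
qed

lemma wact_append_to_word:
  "wact (to_word (ys @ zs)) = wact (to_word ys) \<circ> wact (to_word (map (inv_into UNIV (wact (to_word ys))) zs))"
  by (simp add: to_word_append wact_append)

lemma to_word_append_id:
  "wact (to_word ys) = id \<Longrightarrow> to_word (ys @ zs) = to_word ys @ to_word zs"
  by (simp add: to_word_append inv_id)

lemma trivial_action_power:
  "\<exists>n>0. sig y ^^ n = id \<and> wact (to_word (replicate n y)) = id"
proof -
  obtain N where N: "N > 0" "\<And>f :: 'x \<Rightarrow> 'x. bij f \<Longrightarrow> f ^^ N = id"
    using uniform_period_of_bijections by blast
  define g where "g k = wact (to_word (replicate (k * N) y))" for k
  have "\<not> inj g" using finite_imageD[of g UNIV] infinite_UNIV_nat by auto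
  then obtain i j where ij: "g i = g j" "i < j" by (metis (lifting) injI linorder_neqE_nat)
  have sig_kN: "sig y ^^ (k * N) = id" for k
    using N(2)[OF bij_sig, of y] by (simp add: mult.commute[of k] funpow_mult[symmetric])
  obtain v where v: "g i \<circ> wact v = id" using wact_inverse unfolding g_def by blast
  define us where "us = map (g i) (to_sum v)"
  have state: "wact (to_word (us @ replicate (k * N) y)) = id" if "g k = g i" for k
  proof -
    have "bij (g i)" by (simp add: g_def bij_wact)
    then have "map (inv_into UNIV (g i)) us = to_sum v"
      by (simp add: us_def o_def bij_is_inj inv_f_f)
    then have "wact (to_word (replicate (k * N) y @ us)) = id"
      using that v by (simp add: wact_append_to_word g_def[symmetric])
    moreover have "sum_cong (us @ replicate (k * N) y) (replicate (k * N) y @ us)"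
      using sum_cong_move_replicate[of "[]" us "k * N" y] by (simp add: sig_kN)
    ultimately show ?thesis using wact_word_cong unfolding sum_cong_def by metis
  qed
  have "j * N = i * N + (j - i) * N" using ij(2) by (simp add: add_mult_distrib[symmetric])
  then have "us @ replicate (j * N) y = (us @ replicate (i * N) y) @ replicate ((j - i) * N) y"
    by (simp add: replicate_add)
  then have "wact (to_word (replicate ((j - i) * N) y)) = id"
    using state[of i] state[of j] ij(1)
      wact_append_to_word[of "us @ replicate (i * N) y" "replicate ((j - i) * N) y"]
    by (simp add: inv_id)
  then show ?thesis using ij(2) N(1) sig_kN by (intro exI[of _ "(j - i) * N"]) auto
qed

lemma uniform_trivial_action_power:
  "\<exists>N>0. \<forall>y. sig y ^^ N = id \<and> wact (to_word (replicate N y)) = id"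
proof -
  obtain n where n: "\<And>y. n y > 0" "\<And>y. sig y ^^ n y = id" "\<And>y. wact (to_word (replicate (n y) y)) = id"
    using trivial_action_power by metis
  define N where "N = (\<Prod>y\<in>UNIV. n y)"
  have mult: "wact (to_word (replicate (k * n y) y)) = id" for k y
  proof (induction k)
    case (Suc k)
    have "replicate (Suc k * n y) y = replicate (n y) y @ replicate (k * n y) y"
      by (simp add: replicate_add)
    then show ?case using Suc n(3)[of y] by (simp add: wact_append_to_word inv_id)
  qed simp
  have "sig y ^^ N = id \<and> wact (to_word (replicate N y)) = id" for y
  proof -
    have "n y dvd N" unfolding N_def by (rule dvd_prodI) auto
    then obtain k where N: "N = n y * k" by (auto elim: dvdE)
    then have "sig y ^^ N = id" using n(2)[of y] by (simp add: funpow_mult[symmetric])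
    moreover have "wact (to_word (replicate N y)) = id"
      using mult[of k y] N by (simp add: mult.commute)
    ultimately show ?thesis by simp
  qed
  moreover have "N > 0" using n(1) by (simp add: N_def)
  ultimately show ?thesis by blast
qed

definition period :: nat
  where "period = (SOME N. N > 0 \<and> (\<forall>y. sig y ^^ N = id \<and> wact (to_word (replicate N y)) = id))"

definition tword :: "'x \<Rightarrow> 'x list" where "tword y = to_word (replicate period y)"

lemma period: "period > 0" "sig y ^^ period = id" "wact (tword y) = id"
  using someI_ex[OF uniform_trivial_action_power, folded period_def] by (simp_all add: tword_def)

lemma append_tword: "word_cong r (u @ tword y) (tword (wact u y) @ u)"
proof -
  have "u @ tword y = to_word (to_sum u @ replicate period (wact u y))"
    using bij_wact[of u] by (simp add: to_word_append tword_def bij_is_inj inv_f_f)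
  moreover have "sum_cong (to_sum u @ replicate period (wact u y)) (replicate period (wact u y) @ to_sum u)"
    using sum_cong_move_replicate[of "[]" "to_sum u" period "wact u y"] period(2) by simp
  moreover have "to_word (replicate period (wact u y) @ to_sum u) = tword (wact u y) @ u"
    using to_word_append_id[of "replicate period (wact u y)"] period(3) by (simp add: tword_def)
  ultimately show ?thesis by (simp add: sum_cong_def)
qed

lemma tword_factor:
  assumes "card (UNIV :: 'x set) * period < length u"
  shows "\<exists>y v. word_cong r u (tword y @ v)"
proof -
  have "\<exists>y. period \<le> count_list (to_sum u) y"
  proof (rule ccontr)
    assume "\<not> ?thesis"
    then have "count_list (to_sum u) y \<le> period" for y using nle_le by blast
    then have "sum (count_list (to_sum u)) UNIV \<le> card (UNIV :: 'x set) * period"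
      using sum_bounded_above[of UNIV "count_list (to_sum u)" period] by simp
    moreover have "sum (count_list (to_sum u)) UNIV = length u"
      using sum.mono_neutral_right[of UNIV "set (to_sum u)" "count_list (to_sum u)"]
        sum_count_set[of "to_sum u" "set (to_sum u)"]
      by (simp add: count_notin)
    ultimately show False using assms by simp
  qed
  then obtain y vs where "sum_cong ([] @ to_sum u) ([] @ replicate period y @ vs)"
    using sum_cong_collect by blast
  then have "word_cong r u (tword y @ to_word vs)"
    using to_word_append_id[of "replicate period y" vs] period(3)[of y]
    by (simp add: sum_cong_def tword_def)
  then show ?thesis by blast
qed

lemma tword_decomposition:
  "\<exists>ys f. length f \<le> card (UNIV :: 'x set) * period \<and> word_cong r u (concat (map tword ys) @ f)"
proof (induction u rule: length_induct)
  case (1 u)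
  show ?case
  proof (cases "length u \<le> card (UNIV :: 'x set) * period")
    case True
    then show ?thesis by (intro exI[of _ "[]"] exI[of _ u]) (simp add: word_cong.refl)
  next
    case False
    then obtain y v where yv: "word_cong r u (tword y @ v)" using tword_factor[of u] by auto
    have "length v < length u" using length_word_cong[OF yv] period(1) by (simp add: tword_def)
    then obtain ys f where "length f \<le> card (UNIV :: 'x set) * period"
      "word_cong r v (concat (map tword ys) @ f)" using 1 by blast
    moreover from this(2) have "word_cong r u (concat (map tword (y # ys)) @ f)"
      using word_cong.trans[OF yv word_cong.append[OF word_cong.refl]] by simp
    ultimately show ?thesis by blast
  qed
qed

abbreviation "cl \<equiv> word_class r"
abbreviation "Mon \<equiv> structure_monoid r"

definition class_act :: "'x list set \<Rightarrow> 'x \<Rightarrow> 'x" where "class_act A = wact (SOME u. A = cl u)"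
definition class_length :: "'x list set \<Rightarrow> nat" where "class_length A = length (SOME u. A = cl u)"

lemma some_word: "word_cong r u (SOME v. cl u = cl v)"
  using someI[of "\<lambda>v. cl u = cl v" u] by (simp add: word_class_eq_iff)

lemma class_act [simp]: "class_act (cl u) = wact u"
  unfolding class_act_def using wact_word_cong[OF some_word] by simp

lemma class_length [simp]: "class_length (cl u) = length u"
  unfolding class_length_def using length_word_cong[OF some_word] by simp

lemma carrier_Mon: "carrier Mon = range cl" and one_Mon: "\<one>\<^bsub>Mon\<^esub> = cl []"
  by (simp_all add: structure_monoid_def)

lemma move_word: "\<exists>v c. word_cong r (x # v) (w @ [c]) \<and> length v = length w"
proof (induction w arbitrary: x)
  case Nil
  show ?case by (intro exI[of _ "[]"] exI[of _ x]) (simp add: word_cong.refl)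
next
  case (Cons y w)
  let ?z = "linv x y"
  obtain v c where v: "word_cong r (rho x ?z # v) (w @ [c])" "length v = length w" using Cons by blast
  have "word_cong r [x, ?z] [y, rho x ?z]"
    using word_cong.rel[of r x ?z] lam_linv[of x y] by (simp add: lam_def rho_def del: lam_linv)
  then have "word_cong r ([x, ?z] @ v) ([y, rho x ?z] @ v)" by (intro word_cong.append word_cong.refl)
  moreover have "word_cong r ([y] @ rho x ?z # v) ([y] @ w @ [c])"
    by (intro word_cong.append word_cong.refl v)
  ultimately have "word_cong r (x # ?z # v) ((y # w) @ [c])"
    using word_cong.trans by force
  then show ?case using v(2) by (intro exI[of _ "?z # v"] exI[of _ c]) simp
qed

definition divisible_by_words :: "nat \<Rightarrow> 'x list set set"
  where "divisible_by_words m = {A. \<forall>v. length v = m \<longrightarrow> (\<exists>c. A = cl (v @ c))}"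

lemma divisible_by_wordsE:
  assumes "A \<in> divisible_by_words m" "length v = m"
  obtains c where "A = cl (v @ c)"
  using assms unfolding divisible_by_words_def by blast

lemma divisible_by_words_imp_class: "A \<in> divisible_by_words m \<Longrightarrow> \<exists>a. A = cl a"
  by (metis divisible_by_wordsE Ex_list_of_length)

lemma divisible_by_words_l_mult:
  assumes "B \<in> divisible_by_words m" shows "cl u \<otimes>\<^bsub>Mon\<^esub> B \<in> divisible_by_words m"
proof (induction u)
  case Nil
  obtain b where b: "B = cl b" using divisible_by_words_imp_class[OF assms] by blast
  then show ?case using assms by (simp add: mult_word_class)
next
  case (Cons x u)
  have "\<exists>c. cl (x # u) \<otimes>\<^bsub>Mon\<^esub> B = cl (w @ c)" if w: "length w = m" for w
  proof -
    obtain v c where v: "word_cong r (x # v) (w @ [c])" "length v = m" using move_word[of x w] w by auto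
    obtain d where d: "cl u \<otimes>\<^bsub>Mon\<^esub> B = cl (v @ d)" using divisible_by_wordsE[OF Cons v(2)] .
    obtain b where b: "B = cl b" using divisible_by_words_imp_class[OF assms] by blast
    have "cl (x # u) \<otimes>\<^bsub>Mon\<^esub> B = cl [x] \<otimes>\<^bsub>Mon\<^esub> (cl u \<otimes>\<^bsub>Mon\<^esub> B)"
      by (simp add: b mult_word_class)
    also have "\<dots> = cl ((x # v) @ d)" by (simp add: d mult_word_class)
    also have "\<dots> = cl ((w @ [c]) @ d)"
      unfolding word_class_eq_iff by (intro word_cong.append word_cong.refl v)
    finally show ?thesis by auto
  qed
  then show ?case by (simp add: divisible_by_words_def)
qed

lemma M_X_eq: "M_X r = divisible_by_words 1"
proof -
  have "A \<in> M_X r \<longleftrightarrow> (\<forall>x. \<exists>c. A = cl ([x] @ c))" for A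
    unfolding M_X_def l_coset_def by (auto simp: carrier_Mon generator_def mult_word_class)
  moreover have "A \<in> divisible_by_words 1 \<longleftrightarrow> (\<forall>x. \<exists>c. A = cl ([x] @ c))" for A
    unfolding divisible_by_words_def by (auto simp: length_Suc_conv) fastforce
  ultimately show ?thesis by (simp only: set_eq_iff simp_thms)
qed

lemma divisible_by_words_mult:
  assumes A: "A \<in> M_X r" and B: "B \<in> divisible_by_words m"
  shows "A \<otimes>\<^bsub>Mon\<^esub> B \<in> divisible_by_words (Suc m)"
proof -
  have "\<exists>c. A \<otimes>\<^bsub>Mon\<^esub> B = cl (v @ c)" if lv: "length v = Suc m" for v
  proof -
    obtain x w where v: "v = x # w" "length w = m" using lv by (cases v) auto
    obtain a where a: "A = cl ([x] @ a)" 
      by (rule divisible_by_wordsE[OF A[unfolded M_X_eq], of "[x]"]) simp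
    obtain d where d: "cl a \<otimes>\<^bsub>Mon\<^esub> B = cl (w @ d)"
      using divisible_by_wordsE[OF divisible_by_words_l_mult[OF B] v(2)] .
    obtain b where b: "B = cl b" using divisible_by_words_imp_class[OF B] by blast
    have "A \<otimes>\<^bsub>Mon\<^esub> B = cl [x] \<otimes>\<^bsub>Mon\<^esub> (cl a \<otimes>\<^bsub>Mon\<^esub> B)"
      by (simp add: a b mult_word_class)
    then show ?thesis by (auto simp: d v(1) mult_word_class)
  qed
  then show ?thesis by (simp add: divisible_by_words_def)
qed

lemma set_power_M_X: "set_power Mon (M_X r) m \<subseteq> divisible_by_words m"
proof (induction m)
  case 0
  show ?case by (auto simp: one_Mon divisible_by_words_def)
next
  case (Suc m)
  then show ?case using divisible_by_words_mult by (fastforce simp: set_mult_def)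
qed

lemma foldr_tword:
  "foldr (\<lambda>x b. cl (tword x) \<otimes>\<^bsub>Mon\<^esub> b) xs (cl f) = cl (concat (map tword xs) @ f)"
  by (induction xs) (simp_all add: mult_word_class)

lemma wact_concat_tword: "wact (concat (map tword xs)) = id"
  by (induction xs) (simp_all add: wact_append period(3))

theorem yb_monoid: "yb_monoid Mon (\<lambda>x. cl (tword x)) class_act class_length (M_X r)"
proof -
  interpret monoid Mon by (rule monoid_structure_monoid)
  have comm: "cl u \<otimes>\<^bsub>Mon\<^esub> cl (tword y) = cl (tword (wact u y)) \<otimes>\<^bsub>Mon\<^esub> cl u" for u y
    by (simp add: mult_word_class word_class_eq_iff append_tword)
  have M_X: "A \<in> M_X r \<longleftrightarrow> (\<forall>x. \<exists>c. A = cl ([x] @ c))" for A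
    unfolding M_X_eq divisible_by_words_def by (auto simp: length_Suc_conv) fastforce
  show ?thesis
  proof (unfold_locales)
    show "\<exists>F\<subseteq>carrier Mon. finite F \<and> (\<forall>a\<in>carrier Mon. \<exists>xs. \<exists>f\<in>F.
      a = foldr (\<lambda>x b. cl (tword x) \<otimes>\<^bsub>Mon\<^esub> b) xs f)"
    proof (intro exI[of _ "cl ` {f. length f \<le> card (UNIV :: 'x set) * period}"] conjI ballI)
      show "finite (cl ` {f. length f \<le> card (UNIV :: 'x set) * period})"
        using finite_lists_length_le[of "UNIV :: 'x set"] by simp
      fix a assume "a \<in> carrier Mon"
      then obtain u where u: "a = cl u" by (auto simp: carrier_Mon)
      obtain ys f where "length f \<le> card (UNIV :: 'x set) * period"
        "word_cong r u (concat (map tword ys) @ f)" using tword_decomposition by blast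
      then show "\<exists>xs. \<exists>f\<in>cl ` {f. length f \<le> card (UNIV :: 'x set) * period}.
        a = foldr (\<lambda>x b. cl (tword x) \<otimes>\<^bsub>Mon\<^esub> b) xs f"
        by (intro exI[of _ ys] bexI[of _ "cl f"]) (auto simp: foldr_tword u word_class_eq_iff)
    qed (auto simp: carrier_Mon)
  next
    fix a b assume "a \<in> carrier Mon" "b \<in> set_power Mon (M_X r) (class_length a)"
    then show "\<exists>c\<in>carrier Mon. b = a \<otimes>\<^bsub>Mon\<^esub> c"
      using set_power_M_X by (fastforce simp: carrier_Mon divisible_by_words_def mult_word_class)
  next
    fix xs :: "'x list" assume xs: "\<And>x. x \<in> set xs"
    have "\<exists>c. cl (concat (map tword xs)) = cl ([x] @ c)" for x
    proof -
      obtain as bs where "xs = as @ x # bs" using split_list[OF xs] by blast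
      then have "concat (map tword xs) = (concat (map tword as) @ tword x) @ concat (map tword bs)"
        by simp
      moreover have "word_cong r (concat (map tword as) @ tword x) (tword x @ concat (map tword as))"
        using append_tword[of "concat (map tword as)" x] by (simp add: wact_concat_tword)
      ultimately have "cl (concat (map tword xs)) =
          cl ((tword x @ concat (map tword as)) @ concat (map tword bs))"
        by (simp only: word_class_eq_iff word_cong.append word_cong.refl)
      moreover obtain n where "period = Suc n" using period(1) gr0_implies_Suc by blast
      ultimately show ?thesis by (auto simp: tword_def)
    qed
    then show "foldr (\<lambda>x b. cl (tword x) \<otimes>\<^bsub>Mon\<^esub> b) xs \<one>\<^bsub>Mon\<^esub> \<in> M_X r"
      unfolding one_Mon foldr_tword by (simp add: M_X)
  next
    fix a b assume "a \<in> carrier Mon" "b \<in> M_X r"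
    then show "b \<otimes>\<^bsub>Mon\<^esub> a \<in> M_X r"
      unfolding M_X carrier_Mon
      by (metis imageE mult_word_class append_assoc)
  next
    show "M_X r \<subseteq> carrier Mon"
      unfolding M_X_eq carrier_Mon by (blast dest: divisible_by_words_imp_class)
  next
    fix a x assume "a \<in> carrier Mon"
    then show "a \<otimes>\<^bsub>Mon\<^esub> cl (tword x) = cl (tword (class_act a x)) \<otimes>\<^bsub>Mon\<^esub> a"
      using comm by (auto simp only: carrier_Mon class_act)
  next
    fix x y
    show "cl (tword x) \<otimes>\<^bsub>Mon\<^esub> cl (tword y) = cl (tword y) \<otimes>\<^bsub>Mon\<^esub> cl (tword x)"
      using comm[of "tword x" y] by (simp only: period(3) id_apply)
  qed (auto simp: carrier_Mon one_Mon mult_word_class bij_wact)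
qed

end

section \<open>Monoid algebras and congruence ideals\<close>

interpretation pm: vector_space "scale :: 'k::field \<Rightarrow> ('m \<Rightarrow>\<^sub>0 'k) \<Rightarrow> _"
  by (rule vector_space_scale)

lemma scale_single: "scale c (Poly_Mapping.single x d) = Poly_Mapping.single x (c * d)"
  by (rule poly_mapping_eqI) (simp add: lookup_scale lookup_single when_def)

lemma single_eq_scale: "Poly_Mapping.single x c = scale c (basis_elem x)"
  by (simp add: basis_elem_def scale_single)

definition push :: "('a \<Rightarrow> 'b) \<Rightarrow> ('a \<Rightarrow>\<^sub>0 'k::field) \<Rightarrow> ('b \<Rightarrow>\<^sub>0 'k)"
  where "push h f = (\<Sum>x\<in>Poly_Mapping.keys f. Poly_Mapping.single (h x) (Poly_Mapping.lookup f x))"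

lemma push_superset:
  assumes "finite A" "Poly_Mapping.keys f \<subseteq> A"
  shows "push h f = (\<Sum>x\<in>A. Poly_Mapping.single (h x) (Poly_Mapping.lookup f x))"
  unfolding push_def using assms by (intro sum.mono_neutral_left) (auto simp: in_keys_iff)

lemma push_add: "push h (f + g) = push h f + push h g"
proof -
  let ?A = "Poly_Mapping.keys f \<union> Poly_Mapping.keys g"
  have "finite ?A" "Poly_Mapping.keys f \<subseteq> ?A" "Poly_Mapping.keys g \<subseteq> ?A" "Poly_Mapping.keys (f + g) \<subseteq> ?A"
    using keys_add[of f g] by auto
  then show ?thesis by (simp add: push_superset[of ?A] lookup_add single_add sum.distrib)
qed

lemma push_scale: "push h (scale c f) = scale c (push h f)"
proof -
  have "Poly_Mapping.keys (scale c f) \<subseteq> Poly_Mapping.keys f"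
    by (auto simp: in_keys_iff lookup_scale)
  then have "push h (scale c f) =
      (\<Sum>x\<in>Poly_Mapping.keys f. Poly_Mapping.single (h x) (Poly_Mapping.lookup (scale c f) x))"
    by (intro push_superset) auto
  then show ?thesis by (simp add: push_def lookup_scale scale_single[symmetric] pm.scale_sum_right)
qed

lemma linear_push: "Vector_Spaces.linear scale scale (push h)"
  by unfold_locales (simp_all add: push_add push_scale)

lemma push_single [simp]: "push h (Poly_Mapping.single x c) = Poly_Mapping.single (h x) c"
  by (simp add: push_def)

lemma push_basis_elem [simp]: "push h (basis_elem x) = basis_elem (h x)"
  by (simp add: basis_elem_def)

lemma push_0 [simp]: "push h 0 = 0"
  by (simp add: push_def)

lemma push_minus: "push h (f - g) = push h f - push h g"
  using push_add[of h "f - g" g] by (simp add: algebra_simps)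

lemma push_push: "push g (push h f) = push (g \<circ> h) f"
  by (induction f rule: poly_mapping_add_induct) (simp_all add: push_add)

lemma push_cong: "(\<And>x. x \<in> Poly_Mapping.keys f \<Longrightarrow> h x = h' x) \<Longrightarrow> push h f = push h' f"
  unfolding push_def by (intro sum.cong) auto

lemma push_id: "push (\<lambda>x. x) f = f"
  by (induction f rule: poly_mapping_add_induct) (simp_all add: push_add)

lemma subspace_push_eq_0: "pm.subspace {f. push h f = 0}"
  by (auto intro!: pm.subspaceI simp: push_add push_scale)

lemma poly_mapping_in_span: "f \<in> pm.span (basis_elem ` Poly_Mapping.keys f)"
  by (rule poly_mapping_add_induct[where f = f and P = "\<lambda>g. g \<in> pm.span (basis_elem ` Poly_Mapping.keys f)"])
    (auto simp: single_eq_scale intro: pm.span_add pm.span_scale pm.span_base pm.span_zero)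

lemma push_eq_0_imp_span:
  assumes "push h f = 0"
  shows "f \<in> pm.span {basis_elem x - basis_elem y | x y.
    x \<in> Poly_Mapping.keys f \<and> y \<in> Poly_Mapping.keys f \<and> h x = h y}" (is "f \<in> pm.span ?B")
proof -
  define rep where "rep s = (SOME x. x \<in> Poly_Mapping.keys f \<and> h x = s)" for s
  have rep: "rep (h x) \<in> Poly_Mapping.keys f" "h (rep (h x)) = h x" if "x \<in> Poly_Mapping.keys f" for x
    using someI[of "\<lambda>y. y \<in> Poly_Mapping.keys f \<and> h y = h x" x] that by (auto simp: rep_def)
  have "push (rep \<circ> h) f = 0"
    using push_push[of rep h f] assms by simp
  then have "f = push (\<lambda>x. x) f - push (rep \<circ> h) f"
    by (simp add: push_id)
  also have "\<dots> = (\<Sum>x\<in>Poly_Mapping.keys f.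
      scale (Poly_Mapping.lookup f x) (basis_elem x - basis_elem (rep (h x))))"
    by (simp add: push_def sum_subtractf pm.scale_right_diff_distrib single_eq_scale)
  also have "\<dots> \<in> pm.span ?B"
  proof (intro pm.span_sum pm.span_scale pm.span_base)
    fix x assume x: "x \<in> Poly_Mapping.keys f"
    then show "basis_elem x - basis_elem (rep (h x)) \<in> ?B"
      using rep[OF x] by (intro CollectI exI[of _ x] exI[of _ "rep (h x)"]) simp
  qed
  finally show ?thesis .
qed

lemma congruence_idealI:
  assumes "push h f = 0"
    and "\<And>x y. x \<in> Poly_Mapping.keys f \<Longrightarrow> y \<in> Poly_Mapping.keys f \<Longrightarrow> h x = h y \<Longrightarrow> (x, y) \<in> E"
  shows "f \<in> congruence_ideal E"
proof -
  have "{basis_elem x - basis_elem y | x y. x \<in> Poly_Mapping.keys f \<and> y \<in> Poly_Mapping.keys f \<and> h x = h y}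
      \<subseteq> {basis_elem x - basis_elem y :: _ \<Rightarrow>\<^sub>0 'b | x y. (x, y) \<in> E}"
    using assms(2) by blast
  then show ?thesis
    unfolding congruence_ideal_def using push_eq_0_imp_span[OF assms(1)] pm.span_mono by blast
qed

locale monoid_ring = monoid M for M :: "('m, 'c) monoid_scheme" (structure) +
  fixes KM :: "('m \<Rightarrow>\<^sub>0 'k::field) ring"
  assumes KM_eq: "KM = monoid_algebra M"
begin

sublocale KM: ring KM
  unfolding KM_eq using ring_monoid_algebra monoid_axioms by blast

lemma carrier_KM: "f \<in> carrier KM \<longleftrightarrow> Poly_Mapping.keys f \<subseteq> carrier M"
  and one_KM: "\<one>\<^bsub>KM\<^esub> = basis_elem \<one>"
  and zero_KM: "\<zero>\<^bsub>KM\<^esub> = 0"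
  and add_KM: "f \<oplus>\<^bsub>KM\<^esub> g = f + g"
  by (simp_all add: KM_eq monoid_algebra_simps basis_elem_def)

lemma minus_KM: "f \<in> carrier KM \<Longrightarrow> g \<in> carrier KM \<Longrightarrow> f \<ominus>\<^bsub>KM\<^esub> g = f - g"
  using KM.minus_equality[of "- g" g] by (simp add: KM.minus_eq add_KM zero_KM carrier_KM)

lemma mult_basis_elem: "f \<otimes>\<^bsub>KM\<^esub> basis_elem z = push (\<lambda>x. x \<otimes> z) f"
  unfolding KM_eq basis_elem_def push_def by (simp add: monoid_algebra_def)

lemma basis_elem_mult: "basis_elem z \<otimes>\<^bsub>KM\<^esub> f = push (\<lambda>x. z \<otimes> x) f"
  unfolding KM_eq basis_elem_def push_def by (simp add: monoid_algebra_def)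

lemma basis_elem_closed [simp, intro]: "x \<in> carrier M \<Longrightarrow> basis_elem x \<in> carrier KM"
  by (simp add: carrier_KM basis_elem_def)

lemma basis_elem_mult_basis_elem: "basis_elem x \<otimes>\<^bsub>KM\<^esub> basis_elem y = basis_elem (x \<otimes> y)"
  by (simp add: mult_basis_elem)

lemma basis_elem_pow: "basis_elem x [^]\<^bsub>KM\<^esub> (n::nat) = basis_elem (x [^] n)"
  by (induction n) (simp_all add: one_KM basis_elem_mult_basis_elem)

lemma basis_elem_nonzero: "(basis_elem x :: 'm \<Rightarrow>\<^sub>0 'k) \<noteq> 0"
  by (metis basis_elem_def lookup_single_eq lookup_zero zero_neq_one)

lemma distrib_KM:
  "(f + g) \<otimes>\<^bsub>KM\<^esub> h = f \<otimes>\<^bsub>KM\<^esub> h + g \<otimes>\<^bsub>KM\<^esub> h"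
  "h \<otimes>\<^bsub>KM\<^esub> (f + g) = h \<otimes>\<^bsub>KM\<^esub> f + h \<otimes>\<^bsub>KM\<^esub> g"
  unfolding KM_eq by (rule monoid_algebra_distrib)+

lemma mult_0_KM [simp]: "0 \<otimes>\<^bsub>KM\<^esub> f = 0" "f \<otimes>\<^bsub>KM\<^esub> 0 = 0"
  by (simp_all add: KM_eq monoid_algebra_def)

lemma scale_mult_KM: "scale c f \<otimes>\<^bsub>KM\<^esub> g = scale c (f \<otimes>\<^bsub>KM\<^esub> g)"
  and mult_scale_KM: "f \<otimes>\<^bsub>KM\<^esub> scale c g = scale c (f \<otimes>\<^bsub>KM\<^esub> g)"
proof -
  have single: "scale c (Poly_Mapping.single x a) \<otimes>\<^bsub>KM\<^esub> Poly_Mapping.single y b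
      = scale c (Poly_Mapping.single x a \<otimes>\<^bsub>KM\<^esub> Poly_Mapping.single y b)"
    "Poly_Mapping.single x a \<otimes>\<^bsub>KM\<^esub> scale c (Poly_Mapping.single y b)
      = scale c (Poly_Mapping.single x a \<otimes>\<^bsub>KM\<^esub> Poly_Mapping.single y b)" for x y a b
    by (simp_all add: KM_eq scale_single monoid_algebra_single_mult mult_ac)
  have "scale c (Poly_Mapping.single x a) \<otimes>\<^bsub>KM\<^esub> g = scale c (Poly_Mapping.single x a \<otimes>\<^bsub>KM\<^esub> g)" for x a
    by (induction g rule: poly_mapping_add_induct) (simp_all add: single distrib_KM pm.scale_right_distrib)
  then show "scale c f \<otimes>\<^bsub>KM\<^esub> g = scale c (f \<otimes>\<^bsub>KM\<^esub> g)"
    by (induction f rule: poly_mapping_add_induct) (simp_all add: distrib_KM pm.scale_right_distrib)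
  have "Poly_Mapping.single x a \<otimes>\<^bsub>KM\<^esub> scale c g = scale c (Poly_Mapping.single x a \<otimes>\<^bsub>KM\<^esub> g)" for x a
    by (induction g rule: poly_mapping_add_induct) (simp_all add: single distrib_KM pm.scale_right_distrib)
  then show "f \<otimes>\<^bsub>KM\<^esub> scale c g = scale c (f \<otimes>\<^bsub>KM\<^esub> g)"
    by (induction f rule: poly_mapping_add_induct) (simp_all add: distrib_KM pm.scale_right_distrib)
qed

lemma scale_closed: "f \<in> carrier KM \<Longrightarrow> scale c f \<in> carrier KM"
  by (auto simp: carrier_KM in_keys_iff lookup_scale)

lemma subspace_carrier: "pm.subspace (carrier KM)"
  using KM.add.m_closed KM.zero_closed by (auto intro!: pm.subspaceI simp: add_KM zero_KM scale_closed)

lemma minus_closed: "f \<in> carrier KM \<Longrightarrow> g \<in> carrier KM \<Longrightarrow> f - g \<in> carrier KM"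
  using pm.subspace_diff[OF subspace_carrier] .

lemma carrier_subsetI:
  assumes "pm.subspace S" "\<And>x. x \<in> carrier M \<Longrightarrow> basis_elem x \<in> S"
  shows "carrier KM \<subseteq> S"
proof
  fix f assume "f \<in> carrier KM"
  then have "basis_elem ` Poly_Mapping.keys f \<subseteq> S" using assms(2) by (auto simp: carrier_KM)
  then show "f \<in> S" using pm.span_minimal[OF _ assms(1)] poly_mapping_in_span by blast
qed

lemma left_ideal_scale:
  assumes I: "left_ideal KM I" and f: "f \<in> I" shows "scale c f \<in> I"
proof -
  have fc: "f \<in> carrier KM" using KM.left_idealD(1)[OF I] f by blast
  have "scale c f = scale c (\<one>\<^bsub>KM\<^esub> \<otimes>\<^bsub>KM\<^esub> f)" using fc by simp
  also have "\<dots> = scale c \<one>\<^bsub>KM\<^esub> \<otimes>\<^bsub>KM\<^esub> f" by (simp only: scale_mult_KM)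
  also have "\<dots> \<in> I" using KM.left_idealD(4)[OF I f] scale_closed by blast
  finally show ?thesis .
qed

lemma subspace_left_ideal: "left_ideal KM I \<Longrightarrow> pm.subspace I"
  using KM.left_idealD[of I] left_ideal_scale by (auto intro!: pm.subspaceI simp: add_KM zero_KM)

lemma subspace_ideal: "ideal I KM \<Longrightarrow> pm.subspace I"
  using subspace_left_ideal KM.ideal_imp_left_ideal by blast

lemma subspace_left_mult: "pm.subspace S \<Longrightarrow> pm.subspace {f. g \<otimes>\<^bsub>KM\<^esub> f \<in> S}"
  by (rule pm.subspaceI)
    (auto simp: distrib_KM mult_scale_KM pm.subspace_0 intro: pm.subspace_add pm.subspace_scale)

lemma subspace_right_mult: "pm.subspace S \<Longrightarrow> pm.subspace {f. f \<otimes>\<^bsub>KM\<^esub> g \<in> S}"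
  by (rule pm.subspaceI)
    (auto simp: distrib_KM scale_mult_KM pm.subspace_0 intro: pm.subspace_add pm.subspace_scale)

lemma prime_ideal_basis_elem:
  assumes P: "prime_ideal KM P" and a: "a \<in> carrier KM" and b: "b \<in> carrier KM"
    and ab: "\<And>x. x \<in> carrier M \<Longrightarrow> a \<otimes>\<^bsub>KM\<^esub> basis_elem x \<otimes>\<^bsub>KM\<^esub> b \<in> P"
  shows "a \<in> P \<or> b \<in> P"
proof -
  have "carrier KM \<subseteq> {x. a \<otimes>\<^bsub>KM\<^esub> x \<in> {y. y \<otimes>\<^bsub>KM\<^esub> b \<in> P}}"
    using ab KM.prime_idealD(1)[OF P]
    by (intro carrier_subsetI subspace_left_mult subspace_right_mult subspace_ideal) auto
  then show ?thesis using KM.prime_ideal_elements[OF P a b] by blast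
qed

end

section \<open>Annihilators and prime ideals\<close>

context yb_monoid
begin

definition tprod :: "'x list \<Rightarrow> 'm" where "tprod xs = foldr (\<lambda>x b. t x \<otimes> b) xs \<one>"

lemma tprod_simps [simp]: "tprod [] = \<one>" "tprod (x # xs) = t x \<otimes> tprod xs"
  by (simp_all add: tprod_def)

lemma tprod_closed [simp, intro]: "tprod xs \<in> carrier M"
  by (induction xs) auto

lemma tprod_append: "tprod (xs @ ys) = tprod xs \<otimes> tprod ys"
  by (induction xs) (auto simp: m_assoc)

lemma foldr_t: "f \<in> carrier M \<Longrightarrow> foldr (\<lambda>x b. t x \<otimes> b) xs f = tprod xs \<otimes> f"
  by (induction xs) (auto simp: m_assoc)

lemma t_tprod: "t x \<otimes> tprod xs = tprod xs \<otimes> t x"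
proof (induction xs)
  case (Cons y xs)
  have "t x \<otimes> tprod (y # xs) = (t x \<otimes> t y) \<otimes> tprod xs" by (simp add: m_assoc)
  also have "\<dots> = t y \<otimes> (t x \<otimes> tprod xs)" by (simp add: t_commute[of x y] m_assoc)
  also have "\<dots> = tprod (y # xs) \<otimes> t x" by (simp add: Cons m_assoc)
  finally show ?case .
qed simp

lemma tprod_mset: "mset xs = mset ys \<Longrightarrow> tprod xs = tprod ys"
proof (induction xs arbitrary: ys)
  case (Cons x xs)
  then have "x \<in> set ys" by (metis list.set_intros(1) set_mset_mset)
  then obtain as bs where ys: "ys = as @ x # bs" by (auto dest: split_list)
  have "tprod xs = tprod (as @ bs)" using Cons.prems by (intro Cons.IH) (simp add: ys)
  then have "tprod (x # xs) = (t x \<otimes> tprod as) \<otimes> tprod bs" by (simp add: tprod_append m_assoc)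
  also have "\<dots> = tprod ys" by (simp add: ys t_tprod tprod_append m_assoc)
  finally show ?case .
qed simp

lemma tprod_commute: "tprod xs \<otimes> tprod ys = tprod ys \<otimes> tprod xs"
  unfolding tprod_append[symmetric] by (rule tprod_mset) simp

lemma mult_tprod: "a \<in> carrier M \<Longrightarrow> a \<otimes> tprod xs = tprod (map (act a) xs) \<otimes> a"
proof (induction xs)
  case (Cons x xs)
  have "a \<otimes> tprod (x # xs) = (a \<otimes> t x) \<otimes> tprod xs" using Cons by (simp add: m_assoc)
  also have "\<dots> = t (act a x) \<otimes> (a \<otimes> tprod xs)" using Cons by (simp add: mult_t m_assoc)
  also have "\<dots> = tprod (map (act a) (x # xs)) \<otimes> a" using Cons by (simp add: m_assoc)
  finally show ?case .
qed simp

lemma tprod_mult: "a \<in> carrier M \<Longrightarrow> tprod xs \<otimes> a = a \<otimes> tprod (map (inv_into UNIV (act a)) xs)"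
  using bij_act[of a] by (simp add: mult_tprod o_def bij_is_surj surj_f_inv_f)

lemma finitely_generated_over_tprod:
  "\<exists>F\<subseteq>carrier M. finite F \<and> (\<forall>a\<in>carrier M. \<exists>xs. \<exists>f\<in>F. a = f \<otimes> tprod xs)"
proof -
  obtain F where F: "F \<subseteq> carrier M" "finite F"
    "\<And>a. a \<in> carrier M \<Longrightarrow> \<exists>xs. \<exists>f\<in>F. a = foldr (\<lambda>x b. t x \<otimes> b) xs f"
    using finitely_generated_over_t by blast
  have "\<exists>xs. \<exists>f\<in>F. a = f \<otimes> tprod xs" if a: "a \<in> carrier M" for a
  proof -
    obtain xs f where f: "f \<in> F" "a = foldr (\<lambda>x b. t x \<otimes> b) xs f" using F(3)[OF a] by blast
    then have "a = f \<otimes> tprod (map (inv_into UNIV (act f)) xs)"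
      using F(1) by (auto simp: foldr_t tprod_mult)
    then show ?thesis using f(1) by blast
  qed
  then show ?thesis using F by blast
qed

definition all_x :: "'x list" where "all_x = (SOME xs. set xs = UNIV \<and> distinct xs)"

lemma all_x: "set all_x = UNIV" "distinct all_x"
  using someI_ex[OF finite_distinct_list[of "UNIV :: 'x set"], folded all_x_def] by simp_all

definition w :: 'm where "w = tprod all_x"

lemma w_closed [simp, intro]: "w \<in> carrier M"
  by (simp add: w_def)

lemma w_in_MX: "w \<in> MX"
  unfolding w_def tprod_def by (rule prod_t_in_MX) (simp add: all_x)

lemma w_central: "a \<in> carrier M \<Longrightarrow> a \<otimes> w = w \<otimes> a"
proof -
  assume a: "a \<in> carrier M"
  have "distinct (map (act a) all_x)" "set (map (act a) all_x) = set all_x"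
    using bij_act[OF a] all_x by (simp_all add: distinct_map bij_def)
  then have "mset (map (act a) all_x) = mset all_x"
    using set_eq_iff_mset_eq_distinct all_x(2) by blast
  then have "tprod (map (act a) all_x) = w" unfolding w_def by (rule tprod_mset)
  then show ?thesis using mult_tprod[OF a, of all_x] by (simp add: w_def)
qed

lemma w_pow_central: "a \<in> carrier M \<Longrightarrow> a \<otimes> w [^] (n::nat) = w [^] n \<otimes> a"
proof (induction n)
  case (Suc n)
  have "a \<otimes> w [^] Suc n = (a \<otimes> w [^] n) \<otimes> w" using Suc.prems by (simp add: m_assoc)
  also have "\<dots> = w [^] n \<otimes> (a \<otimes> w)" using Suc by (simp add: m_assoc)
  also have "\<dots> = w [^] n \<otimes> (w \<otimes> a)" using w_central[OF Suc.prems] by simp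
  finally show ?case using Suc.prems by (simp add: m_assoc)
qed simp

lemma w_pow: "w [^] (n::nat) = tprod (concat (replicate n all_x))"
proof (induction n)
  case (Suc n)
  then show ?case using w_pow_central[of w n] by (simp add: tprod_append w_def[symmetric])
qed simp

lemma w_pow_in_set_power: "w [^] (n::nat) \<in> set_power M MX n"
proof (induction n)
  case (Suc n)
  then have "w \<otimes> w [^] n \<in> set_power M MX (Suc n)" using w_in_MX by (auto simp: set_mult_def)
  then show ?case using w_pow_central[of w n] by simp
qed simp

lemma w_pow_divisible: "a \<in> carrier M \<Longrightarrow> \<exists>c\<in>carrier M. w [^] len a = a \<otimes> c"
  using set_power_MX_divisible w_pow_in_set_power by blast

lemma set_power_MX_closed: "set_power M MX n \<subseteq> carrier M"
  using MX_closed by (induction n) (auto simp: set_mult_def)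

lemma set_power_MX_w_pow:
  assumes "b \<in> set_power M MX (len (w [^] m) + j)"
  shows "\<exists>c\<in>carrier M. b = w [^] (m::nat) \<otimes> c"
  using assms
proof (induction j arbitrary: b)
  case 0
  then show ?case using set_power_MX_divisible by simp
next
  case (Suc j)
  then obtain a c where b: "b = a \<otimes> c" "a \<in> MX" "c \<in> set_power M MX (len (w [^] m) + j)"
    by (auto simp: set_mult_def)
  then obtain d where d: "d \<in> carrier M" "c = w [^] m \<otimes> d" using Suc.IH by blast
  have a: "a \<in> carrier M" using b(2) MX_closed by blast
  have "b = (a \<otimes> w [^] m) \<otimes> d" using a d b(1) by (simp add: m_assoc)
  then have "b = w [^] m \<otimes> (a \<otimes> d)" using a d by (simp add: w_pow_central m_assoc)
  then show ?case using a d by blast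
qed

lemma eta_iff: "(a, b) \<in> eta M \<longleftrightarrow> a \<in> carrier M \<and> b \<in> carrier M \<and> (\<exists>n::nat. a \<otimes> w [^] n = b \<otimes> w [^] n)"
proof -
  have "\<exists>n::nat. a \<otimes> w [^] n = b \<otimes> w [^] n"
    if *: "a \<in> carrier M" "b \<in> carrier M" "z \<in> carrier M" "a \<otimes> z = b \<otimes> z" for z
  proof -
    obtain c where c: "c \<in> carrier M" "w [^] len z = z \<otimes> c" using w_pow_divisible *(3) by blast
    have "a \<otimes> w [^] len z = (a \<otimes> z) \<otimes> c" using *(1-3) c by (simp add: m_assoc)
    also have "\<dots> = (b \<otimes> z) \<otimes> c" by (simp only: *(4))
    also have "\<dots> = b \<otimes> w [^] len z" using *(1-3) c by (simp add: m_assoc)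
    finally show ?thesis by blast
  qed
  then show ?thesis unfolding eta_def by auto
qed

end

locale yb_algebra = yb_monoid M t act len MX + monoid_ring M KM
  for M :: "('m, 'c) monoid_scheme" (structure) and t :: "'x::finite \<Rightarrow> 'm"
    and act :: "'m \<Rightarrow> 'x \<Rightarrow> 'x" and len :: "'m \<Rightarrow> nat" and MX :: "'m set"
    and KM :: "('m \<Rightarrow>\<^sub>0 'k::field) ring"
begin

lemma ascending_chain_condition_right:
  fixes W :: "nat \<Rightarrow> ('m \<Rightarrow>\<^sub>0 'k) set"
  assumes sub: "\<And>i. pm.subspace (W i)" and carr: "\<And>i. W i \<subseteq> carrier KM"
    and mult: "\<And>i f x. f \<in> W i \<Longrightarrow> f \<otimes>\<^bsub>KM\<^esub> basis_elem (t x) \<in> W i"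
    and asc: "\<And>i. W i \<subseteq> W (Suc i)"
  shows "\<exists>n. \<forall>m\<ge>n. W m = W n"
proof -
  obtain F where F: "F \<subseteq> carrier M" "finite F" "\<And>a. a \<in> carrier M \<Longrightarrow> \<exists>xs. \<exists>f\<in>F. a = f \<otimes> tprod xs"
    using finitely_generated_over_tprod by blast
  define mul where "mul x a = (if a \<in> carrier M then a \<otimes> t x else a)" for x a
  define T where "T = map (\<lambda>x. push (mul x) :: ('m \<Rightarrow>\<^sub>0 'k) \<Rightarrow> _) all_x"
  have T: "set T = range (\<lambda>x. push (mul x))" by (simp add: T_def all_x)
  have comm: "mul x \<circ> mul y = mul y \<circ> mul x" for x y
    by (auto simp: fun_eq_iff mul_def m_assoc t_commute[of x])
  have op: "push (mul x) f = f \<otimes>\<^bsub>KM\<^esub> basis_elem (t x)" if "f \<in> carrier KM" for x f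
    unfolding mult_basis_elem using that by (intro push_cong) (auto simp: mul_def carrier_KM)
  obtain V where V: "pm.invariant_subspace (set T) V" "basis_elem ` F \<subseteq> V"
    "pm.ascending_chain_condition (set T) V"
    using pm.ascending_chain_condition_commuting[of "basis_elem ` F" T] F(2)
    by (force simp: T linear_push push_push comm)
  have "basis_elem (f \<otimes> tprod xs) \<in> V" if f: "f \<in> F" for f xs
  proof (induction xs rule: rev_induct)
    case Nil
    have "f \<in> carrier M" using F(1) f by blast
    then show ?case using V(2) f by auto
  next
    case (snoc x xs)
    have fc: "f \<in> carrier M" using f F(1) by blast
    have "push (mul x) (basis_elem (f \<otimes> tprod xs)) \<in> V"
      using pm.invariant_subspaceD(2)[OF V(1) _ snoc] by (simp add: T del: push_basis_elem)
    moreover have "mul x (f \<otimes> tprod xs) = f \<otimes> tprod (xs @ [x])"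
      using fc by (simp add: mul_def tprod_append m_assoc)
    ultimately show ?case by simp
  qed
  then have "basis_elem a \<in> V" if "a \<in> carrier M" for a using F(3)[OF that] by blast
  then have KMV: "carrier KM \<subseteq> V"
    using pm.invariant_subspaceD(1)[OF V(1)] by (intro carrier_subsetI)
  have "push (mul x) f \<in> W i" if f: "f \<in> W i" for f x i
    using mult[OF f, of x] op[of f x] carr[of i] f by (simp add: subset_iff)
  then have "pm.invariant_subspace (set T) (W i)" for i
    using sub[of i] by (simp add: pm.invariant_subspace_def T)
  moreover have "W i \<subseteq> V" for i using subset_trans[OF carr KMV] .
  ultimately show ?thesis
    by (intro V(3)[unfolded pm.ascending_chain_condition_def, rule_format] allI conjI asc)
qed

lemma mult_basis_elem_basis_elem:
  "f \<in> carrier KM \<Longrightarrow> x \<in> carrier M \<Longrightarrow> y \<in> carrier M \<Longrightarrow>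
    f \<otimes>\<^bsub>KM\<^esub> basis_elem x \<otimes>\<^bsub>KM\<^esub> basis_elem y = f \<otimes>\<^bsub>KM\<^esub> basis_elem (x \<otimes> y)"
  by (simp add: KM.m_assoc basis_elem_mult_basis_elem)

lemma mult_basis_elem_w_pow:
  "f \<in> carrier KM \<Longrightarrow> x \<in> carrier M \<Longrightarrow>
    f \<otimes>\<^bsub>KM\<^esub> basis_elem x \<otimes>\<^bsub>KM\<^esub> basis_elem (w [^] (n::nat)) =
    f \<otimes>\<^bsub>KM\<^esub> basis_elem (w [^] n) \<otimes>\<^bsub>KM\<^esub> basis_elem x"
  by (simp add: mult_basis_elem_basis_elem w_pow_central)

abbreviation I_eta :: "('m \<Rightarrow>\<^sub>0 'k) set" where "I_eta \<equiv> congruence_ideal (eta M)"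

lemma annihilator_w_pow:
  "\<exists>m. \<forall>n\<ge>m. annihilator KM {basis_elem (w [^] (n::nat))} = I_eta"
proof -
  define W where "W n = annihilator KM {basis_elem (w [^] n)}" for n :: nat
  have W: "f \<in> W n \<longleftrightarrow> f \<in> carrier KM \<and> f \<otimes>\<^bsub>KM\<^esub> basis_elem (w [^] n) = 0" for f n
    by (simp add: W_def annihilator_def zero_KM)
  have "pm.subspace {f. f \<otimes>\<^bsub>KM\<^esub> basis_elem (w [^] n) \<in> {0}}" for n :: nat
    by (intro subspace_right_mult pm.subspace_single_0)
  then have sub: "pm.subspace (W n)" for n
    using pm.subspace_inter[OF subspace_carrier]
    by (auto simp: W_def annihilator_def zero_KM Collect_conj_eq)
  have step: "W n \<subseteq> W (Suc n)" for n
  proof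
    fix f assume f: "f \<in> W n"
    then have "(f \<otimes>\<^bsub>KM\<^esub> basis_elem (w [^] n)) \<otimes>\<^bsub>KM\<^esub> basis_elem w = 0" by (simp add: W)
    then have "f \<otimes>\<^bsub>KM\<^esub> (basis_elem (w [^] n) \<otimes>\<^bsub>KM\<^esub> basis_elem w) = 0"
      using f by (subst KM.m_assoc[symmetric]) (auto simp: W)
    then show "f \<in> W (Suc n)" using f by (simp add: W basis_elem_mult_basis_elem)
  qed
  have "\<exists>m. \<forall>n\<ge>m. W n = W m"
  proof (rule ascending_chain_condition_right)
    fix n f x assume f: "f \<in> W n"
    have "f \<otimes>\<^bsub>KM\<^esub> basis_elem (t x) \<otimes>\<^bsub>KM\<^esub> basis_elem (w [^] n) =
        f \<otimes>\<^bsub>KM\<^esub> basis_elem (w [^] n) \<otimes>\<^bsub>KM\<^esub> basis_elem (t x)"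
      using f by (intro mult_basis_elem_w_pow) (simp_all add: W)
    then show "f \<otimes>\<^bsub>KM\<^esub> basis_elem (t x) \<in> W n" using f by (simp add: W)
  qed (auto simp: sub step W simp del: nat_pow_Suc)
  then obtain m where m: "\<And>n. n \<ge> m \<Longrightarrow> W n = W m" by blast
  have mono: "W i \<subseteq> W j" if "i \<le> j" for i j
    using lift_Suc_mono_le[of W, OF step that] .
  have "I_eta \<subseteq> W m"
    unfolding congruence_ideal_def
  proof (rule pm.span_minimal[OF _ sub], clarify)
    fix x y assume "(x, y) \<in> eta M"
    then obtain n :: nat where n: "x \<in> carrier M" "y \<in> carrier M" "x \<otimes> w [^] n = y \<otimes> w [^] n"
      by (auto simp: eta_iff)
    then have "basis_elem x - basis_elem y \<in> W n"
      by (simp add: W minus_closed mult_basis_elem push_minus)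
    then show "basis_elem x - basis_elem y \<in> W m"
      using mono[of n "max n m"] m[of "max n m"] by auto
  qed
  moreover have "W m \<subseteq> I_eta"
  proof
    fix f assume "f \<in> W m"
    then have "push (\<lambda>x. x \<otimes> w [^] m) f = 0" "Poly_Mapping.keys f \<subseteq> carrier M"
      by (simp_all add: W mult_basis_elem carrier_KM)
    then show "f \<in> I_eta" by (intro congruence_idealI) (auto simp: eta_iff)
  qed
  ultimately show ?thesis using m unfolding W_def by blast
qed

theorem annihilator_eq_I_eta:
  "\<exists>m\<ge>1. I_eta = annihilator KM {basis_elem (w [^] (m::nat))} \<and>
    I_eta = annihilator KM (basis_elem ` set_power M MX m)"
proof -
  obtain m :: nat where m: "\<And>n. n \<ge> m \<Longrightarrow> annihilator KM {basis_elem (w [^] n)} = I_eta"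
    using annihilator_w_pow by blast
  define n where "n = len (w [^] m) + (m + 1)"
  have n: "n \<ge> m" "n \<ge> 1" by (simp_all add: n_def)
  have "annihilator KM (basis_elem ` set_power M MX n) \<subseteq> annihilator KM {basis_elem (w [^] n)}"
    using w_pow_in_set_power by (auto simp: annihilator_def)
  moreover have "f \<otimes>\<^bsub>KM\<^esub> basis_elem b = \<zero>\<^bsub>KM\<^esub>"
    if f: "f \<in> annihilator KM {basis_elem (w [^] m)}" and b: "b \<in> set_power M MX n" for f b
  proof -
    obtain c where c: "c \<in> carrier M" "b = w [^] m \<otimes> c" using set_power_MX_w_pow b unfolding n_def by blast
    have f': "f \<in> carrier KM" "f \<otimes>\<^bsub>KM\<^esub> basis_elem (w [^] m) = \<zero>\<^bsub>KM\<^esub>" using f by (auto simp: annihilator_def)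
    have "f \<otimes>\<^bsub>KM\<^esub> basis_elem b = f \<otimes>\<^bsub>KM\<^esub> basis_elem (w [^] m) \<otimes>\<^bsub>KM\<^esub> basis_elem c"
      unfolding c(2) using f'(1) c(1) by (intro mult_basis_elem_basis_elem[symmetric]) auto
    then show ?thesis using f' c by simp
  qed
  then have "annihilator KM {basis_elem (w [^] m)} \<subseteq> annihilator KM (basis_elem ` set_power M MX n)"
    by (auto simp: annihilator_def)
  ultimately show ?thesis using m[of m] m[of n] n by (intro exI[of _ n]) auto
qed

theorem I_eta_subset_prime:
  assumes P: "prime_ideal KM P" and "P \<inter> basis_elem ` carrier M = {}"
  shows "I_eta \<subseteq> P"
proof
  fix f assume f: "f \<in> I_eta"
  obtain m :: nat where "I_eta = annihilator KM {basis_elem (w [^] m)}"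
    using annihilator_eq_I_eta by blast
  then have f': "f \<in> carrier KM" "f \<otimes>\<^bsub>KM\<^esub> basis_elem (w [^] m) = \<zero>\<^bsub>KM\<^esub>"
    using f by (auto simp: annihilator_def)
  have "f \<otimes>\<^bsub>KM\<^esub> basis_elem x \<otimes>\<^bsub>KM\<^esub> basis_elem (w [^] m) \<in> P" if "x \<in> carrier M" for x
  proof -
    have "f \<otimes>\<^bsub>KM\<^esub> basis_elem x \<otimes>\<^bsub>KM\<^esub> basis_elem (w [^] m) =
        f \<otimes>\<^bsub>KM\<^esub> basis_elem (w [^] m) \<otimes>\<^bsub>KM\<^esub> basis_elem x"
      using f'(1) that by (rule mult_basis_elem_w_pow)
    then show ?thesis using f' that KM.two_sided_idealD(2)[OF KM.prime_idealD(1)[OF P]] by simp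
  qed
  then have "f \<in> P \<or> basis_elem (w [^] m) \<in> P" using f' by (intro prime_ideal_basis_elem[OF P]) auto
  then show "f \<in> P" using assms(2) by auto
qed

theorem MX_subset_prime:
  assumes P: "prime_ideal KM P" and ne: "P \<inter> basis_elem ` carrier M \<noteq> {}"
  shows "basis_elem ` MX \<subseteq> P"
proof -
  note PD = KM.two_sided_idealD[OF KM.prime_idealD(1)[OF P]]
  have step: "basis_elem ` MX \<subseteq> P" if "basis_elem ` set_power M MX n \<subseteq> P" for n
    using that
  proof (induction n)
    case 0
    then show ?case using KM.prime_idealD(2)[OF P] by (simp add: one_KM)
  next
    case (Suc n)
    show ?case
    proof (rule ccontr)
      assume no: "\<not> basis_elem ` MX \<subseteq> P"
      then obtain a where a: "a \<in> MX" "basis_elem a \<notin> P" by blast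
      have ac: "a \<in> carrier M" using a(1) MX_closed by blast
      have "basis_elem c \<in> P" if c: "c \<in> set_power M MX n" for c
      proof -
        have cc: "c \<in> carrier M" using c set_power_MX_closed by blast
        have "basis_elem a \<otimes>\<^bsub>KM\<^esub> basis_elem x \<otimes>\<^bsub>KM\<^esub> basis_elem c \<in> P" if "x \<in> carrier M" for x
        proof -
          have "(a \<otimes> x) \<otimes> c \<in> set_power M MX (Suc n)"
            using MX_r_mult[OF that a(1)] c by (auto simp: set_mult_def)
          then show ?thesis using Suc.prems by (auto simp: basis_elem_mult_basis_elem)
        qed
        then show ?thesis using prime_ideal_basis_elem[OF P, of "basis_elem a" "basis_elem c"] a(2) ac cc by auto
      qed
      then show False using Suc.IH no by blast
    qed
  qed
  obtain u where u: "u \<in> carrier M" "basis_elem u \<in> P" using ne by blast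
  have "basis_elem b \<in> P" if b: "b \<in> set_power M MX (len u)" for b
  proof -
    obtain c where c: "c \<in> carrier M" "b = u \<otimes> c" using set_power_MX_divisible[OF u(1) b] by blast
    then have "basis_elem b = basis_elem u \<otimes>\<^bsub>KM\<^esub> basis_elem c" by (simp add: basis_elem_mult_basis_elem)
    then show ?thesis using PD(5)[OF u(2)] c by simp
  qed
  then show ?thesis by (intro step[of "len u"]) blast
qed

theorem minimal_prime_avoiding_M:
  "\<exists>P. minimal_prime_ideal KM P \<and> P \<inter> basis_elem ` carrier M = {}"
proof -
  obtain P where P: "prime_ideal KM P" "\<And>k::nat. basis_elem w [^]\<^bsub>KM\<^esub> k \<notin> P"
    using KM.prime_ideal_avoiding_powers[of "basis_elem w"]
    by (auto simp: basis_elem_pow zero_KM basis_elem_nonzero)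
  obtain Q where Q: "minimal_prime_ideal KM Q" "Q \<subseteq> P"
    using KM.minimal_prime_ideal_below[OF P(1)] by blast
  have "prime_ideal KM Q" using Q(1) by (simp add: minimal_prime_ideal_def Spec_def)
  moreover have "basis_elem w \<notin> Q" using Q(2) P(2)[of 1] by (auto simp: basis_elem_pow)
  ultimately have "Q \<inter> basis_elem ` carrier M = {}"
    using MX_subset_prime w_in_MX by blast
  then show ?thesis using Q(1) by blast
qed

end

section \<open>The grading by length and the Jacobson radical\<close>

definition weight :: "('m \<Rightarrow> 'k) \<Rightarrow> ('m \<Rightarrow>\<^sub>0 'k::field) \<Rightarrow> ('m \<Rightarrow>\<^sub>0 'k)"
  where "weight g f = (\<Sum>x\<in>Poly_Mapping.keys f. Poly_Mapping.single x (g x * Poly_Mapping.lookup f x))"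

lemma lookup_weight: "Poly_Mapping.lookup (weight g f) x = g x * Poly_Mapping.lookup f x"
  by (auto simp: weight_def lookup_sum lookup_single when_def in_keys_iff)

lemma weight_add: "weight g (f + h) = weight g f + weight g h"
  by (rule poly_mapping_eqI) (simp add: lookup_weight lookup_add ring_distribs)

lemma weight_minus: "weight g (f - h) = weight g f - weight g h"
  by (rule poly_mapping_eqI) (simp add: lookup_weight lookup_minus ring_distribs)

lemma weight_sum: "weight g (\<Sum>i\<in>A. f i) = (\<Sum>i\<in>A. weight g (f i))"
  by (rule poly_mapping_eqI) (simp add: lookup_weight lookup_sum sum_distrib_left)

lemma weight_0 [simp]: "weight g 0 = 0"
  by (rule poly_mapping_eqI) (simp add: lookup_weight)

lemma weight_scale: "weight g (scale c f) = scale c (weight g f)"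
  by (rule poly_mapping_eqI) (simp add: lookup_weight lookup_scale mult_ac)

lemma weight_single: "weight g (Poly_Mapping.single x c) = Poly_Mapping.single x (g x * c)"
  by (rule poly_mapping_eqI) (simp add: lookup_weight lookup_single when_def)

lemma keys_weight: "Poly_Mapping.keys (weight g f) \<subseteq> Poly_Mapping.keys f"
  by (auto simp: in_keys_iff lookup_weight)

lemma weight_const: "(\<And>x. x \<in> Poly_Mapping.keys f \<Longrightarrow> g x = c) \<Longrightarrow> weight g f = scale c f"
  by (rule poly_mapping_eqI) (auto simp: lookup_weight lookup_scale in_keys_iff)

context yb_algebra
begin

lemma len_one: "len \<one> = 0"
  using len_mult[of \<one> \<one>] by simp

lemma weight_closed: "f \<in> carrier KM \<Longrightarrow> weight g f \<in> carrier KM"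
  using keys_weight[of g f] by (auto simp: carrier_KM)

definition component :: "nat \<Rightarrow> ('m \<Rightarrow>\<^sub>0 'k) \<Rightarrow> ('m \<Rightarrow>\<^sub>0 'k)"
  where "component d = weight (\<lambda>x. if len x = d then 1 else 0)"

definition dilation :: "'k \<Rightarrow> ('m \<Rightarrow>\<^sub>0 'k) \<Rightarrow> ('m \<Rightarrow>\<^sub>0 'k)"
  where "dilation c = weight (\<lambda>x. c ^ len x)"

definition homogeneous :: "nat \<Rightarrow> ('m \<Rightarrow>\<^sub>0 'k) \<Rightarrow> bool"
  where "homogeneous d f \<longleftrightarrow> f \<in> carrier KM \<and> (\<forall>x\<in>Poly_Mapping.keys f. len x = d)"

lemma homogeneous_component: "f \<in> carrier KM \<Longrightarrow> homogeneous d (component d f)"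
  using weight_closed[of f] by (auto simp: homogeneous_def component_def in_keys_iff lookup_weight split: if_splits)

lemma component_homogeneous: "homogeneous d f \<Longrightarrow> component n f = (if n = d then f else 0)"
  by (rule poly_mapping_eqI) (auto simp: homogeneous_def component_def lookup_weight in_keys_iff)

lemma sum_components: "(\<Sum>d\<in>len ` Poly_Mapping.keys f. component d f) = f"
proof (rule poly_mapping_eqI)
  fix x
  have "Poly_Mapping.lookup (\<Sum>d\<in>len ` Poly_Mapping.keys f. component d f) x =
      (\<Sum>d\<in>len ` Poly_Mapping.keys f. if len x = d then Poly_Mapping.lookup f x else 0)"
    unfolding lookup_sum by (intro sum.cong) (simp_all add: component_def lookup_weight)
  then show "Poly_Mapping.lookup (\<Sum>d\<in>len ` Poly_Mapping.keys f. component d f) x = Poly_Mapping.lookup f x"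
    by (auto simp: in_keys_iff)
qed

lemma component_add: "component d (f + g) = component d f + component d g"
  by (simp add: component_def weight_add)

lemma component_eq_0:
  assumes "d \<notin> len ` Poly_Mapping.keys f" shows "component d f = 0"
  using assms by (intro poly_mapping_eqI) (auto simp: component_def lookup_weight in_keys_iff)

lemma dilation_homogeneous: "homogeneous d f \<Longrightarrow> dilation c f = scale (c ^ d) f"
  unfolding dilation_def by (rule weight_const) (simp add: homogeneous_def)

lemma homogeneous_basis_elem_mult:
  assumes "x \<in> carrier M" "homogeneous d f"
  shows "homogeneous (len x + d) (basis_elem x \<otimes>\<^bsub>KM\<^esub> f)"
proof -
  have f: "f \<in> carrier KM" using assms(2) by (simp add: homogeneous_def)
  have "Poly_Mapping.keys (push (\<lambda>y. x \<otimes> y) f) \<subseteq> (\<lambda>y. x \<otimes> y) ` Poly_Mapping.keys f"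
    unfolding push_def
    by (rule order_trans[OF keys_sum]) (auto split: if_splits)
  then have "len y = len x + d" if "y \<in> Poly_Mapping.keys (basis_elem x \<otimes>\<^bsub>KM\<^esub> f)" for y
    using that assms f by (auto simp: basis_elem_mult homogeneous_def carrier_KM len_mult subset_iff)
  then show ?thesis unfolding homogeneous_def using assms(1) f by auto
qed

lemma homogeneous_add: "homogeneous d f \<Longrightarrow> homogeneous d g \<Longrightarrow> homogeneous d (f + g)"
  using keys_add[of f g] by (auto simp: homogeneous_def carrier_KM)

lemma homogeneous_scale: "homogeneous d f \<Longrightarrow> homogeneous d (scale c f)"
  by (auto simp: homogeneous_def scale_closed in_keys_iff lookup_scale)

lemma homogeneous_0: "homogeneous d 0"
  by (simp add: homogeneous_def carrier_KM)

lemma homogeneous_mult: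
  assumes f: "homogeneous d f" and g: "homogeneous e g"
  shows "homogeneous (d + e) (f \<otimes>\<^bsub>KM\<^esub> g)"
proof (rule poly_mapping_add_induct[where f = f and P = "\<lambda>f. homogeneous (d + e) (f \<otimes>\<^bsub>KM\<^esub> g)"])
  fix x c assume "x \<in> Poly_Mapping.keys f"
  then have "x \<in> carrier M" "len x = d" using f by (auto simp: homogeneous_def carrier_KM)
  then show "homogeneous (d + e) (Poly_Mapping.single x c \<otimes>\<^bsub>KM\<^esub> g)"
    using homogeneous_basis_elem_mult[of x e g] g
    by (simp add: single_eq_scale scale_mult_KM homogeneous_scale)
qed (simp_all add: homogeneous_0 homogeneous_add distrib_KM)

lemma homogeneous_one: "homogeneous 0 \<one>\<^bsub>KM\<^esub>"
  by (auto simp: homogeneous_def one_KM basis_elem_def len_one carrier_KM)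

lemma homogeneous_pow: "homogeneous d f \<Longrightarrow> homogeneous (n * d) (f [^]\<^bsub>KM\<^esub> n)"
  by (induction n) (auto simp: homogeneous_one intro: homogeneous_mult dest: homogeneous_mult[of _ _ d f] simp: add.commute)

lemma component_mult_homogeneous:
  assumes u: "u \<in> carrier KM" and f: "homogeneous d f"
  shows "component n (u \<otimes>\<^bsub>KM\<^esub> f) = (if d \<le> n then component (n - d) u \<otimes>\<^bsub>KM\<^esub> f else 0)"
proof (rule poly_mapping_add_induct[where f = u and P = "\<lambda>u. component n (u \<otimes>\<^bsub>KM\<^esub> f) =
    (if d \<le> n then component (n - d) u \<otimes>\<^bsub>KM\<^esub> f else 0)"])
  fix x c assume "x \<in> Poly_Mapping.keys u"
  then have x: "x \<in> carrier M" using u by (auto simp: carrier_KM)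
  have h: "homogeneous (len x) (Poly_Mapping.single x c)"
    using x by (auto simp: homogeneous_def carrier_KM)
  show "component n (Poly_Mapping.single x c \<otimes>\<^bsub>KM\<^esub> f) =
      (if d \<le> n then component (n - d) (Poly_Mapping.single x c) \<otimes>\<^bsub>KM\<^esub> f else 0)"
    unfolding component_homogeneous[OF homogeneous_mult[OF h f]] component_homogeneous[OF h]
    by auto
qed (auto simp: component_def distrib_KM weight_add)

lemma dilation_mult:
  assumes "f \<in> carrier KM" "g \<in> carrier KM"
  shows "dilation c (f \<otimes>\<^bsub>KM\<^esub> g) = dilation c f \<otimes>\<^bsub>KM\<^esub> dilation c g"
proof (rule poly_mapping_add_induct[where f = f and P = "\<lambda>f. dilation c (f \<otimes>\<^bsub>KM\<^esub> g) =
    dilation c f \<otimes>\<^bsub>KM\<^esub> dilation c g"])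
  fix x a assume "x \<in> Poly_Mapping.keys f"
  then have x: "x \<in> carrier M" using assms by (auto simp: carrier_KM)
  show "dilation c (Poly_Mapping.single x a \<otimes>\<^bsub>KM\<^esub> g) =
      dilation c (Poly_Mapping.single x a) \<otimes>\<^bsub>KM\<^esub> dilation c g"
  proof (rule poly_mapping_add_induct[where f = g and P = "\<lambda>g. dilation c (Poly_Mapping.single x a \<otimes>\<^bsub>KM\<^esub> g) =
      dilation c (Poly_Mapping.single x a) \<otimes>\<^bsub>KM\<^esub> dilation c g"])
    fix y b assume "y \<in> Poly_Mapping.keys g"
    then have y: "y \<in> carrier M" using assms by (auto simp: carrier_KM)
    show "dilation c (Poly_Mapping.single x a \<otimes>\<^bsub>KM\<^esub> Poly_Mapping.single y b) =
        dilation c (Poly_Mapping.single x a) \<otimes>\<^bsub>KM\<^esub> dilation c (Poly_Mapping.single y b)"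
      using x y by (simp add: dilation_def weight_single KM_eq monoid_algebra_single_mult len_mult
          power_add mult_ac)
  qed (simp_all add: dilation_def distrib_KM weight_add)
qed (simp_all add: dilation_def distrib_KM weight_add)

lemma dilation_one: "dilation c \<one>\<^bsub>KM\<^esub> = \<one>\<^bsub>KM\<^esub>"
  by (simp add: dilation_def one_KM basis_elem_def weight_single len_one)

lemma dilation_inverse: "c \<noteq> 0 \<Longrightarrow> dilation c (dilation (inverse c) f) = f"
  by (rule poly_mapping_eqI) (simp add: dilation_def lookup_weight power_mult_distrib[symmetric] mult.assoc[symmetric])

lemma dilation_closed: "f \<in> carrier KM \<Longrightarrow> dilation c f \<in> carrier KM"
  by (simp add: dilation_def weight_closed)

abbreviation "J \<equiv> jacobson_radical KM"

lemma J_closed: "f \<in> J \<Longrightarrow> f \<in> carrier KM"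
  by (simp add: jacobson_radical_def)

lemma subspace_J: "pm.subspace J"
  by (rule subspace_left_ideal[OF KM.jacobson_radical_left_ideal])

lemma dilation_J:
  assumes a: "a \<in> J" and c: "c \<noteq> 0" shows "dilation c a \<in> J"
proof (rule KM.jacobson_radicalI)
  note ac = J_closed[OF a]
  show "dilation c a \<in> carrier KM" using ac by (rule dilation_closed)
  fix x assume x: "x \<in> carrier KM"
  let ?y = "dilation (inverse c) x \<otimes>\<^bsub>KM\<^esub> a"
  have yc: "dilation (inverse c) x \<in> carrier KM" "?y \<in> carrier KM" using x ac by (simp_all add: dilation_closed)
  have "?y \<in> J" using KM.left_idealD(4)[OF KM.jacobson_radical_left_ideal a yc(1)] .
  then obtain u where u: "u \<in> carrier KM" "u \<otimes>\<^bsub>KM\<^esub> (\<one>\<^bsub>KM\<^esub> \<ominus>\<^bsub>KM\<^esub> ?y) = \<one>\<^bsub>KM\<^esub>"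
    using KM.jacobson_radical_left_inverse by blast
  have "\<one>\<^bsub>KM\<^esub> = dilation c (u \<otimes>\<^bsub>KM\<^esub> (\<one>\<^bsub>KM\<^esub> - ?y))" using u yc by (simp add: minus_KM dilation_one)
  also have "\<dots> = dilation c u \<otimes>\<^bsub>KM\<^esub> dilation c (\<one>\<^bsub>KM\<^esub> - ?y)"
    using u yc minus_closed by (intro dilation_mult) auto
  also have "dilation c (\<one>\<^bsub>KM\<^esub> - ?y) = \<one>\<^bsub>KM\<^esub> - dilation c ?y"
    by (simp add: dilation_def weight_minus) (simp add: dilation_def[symmetric] dilation_one)
  also have "dilation c ?y = x \<otimes>\<^bsub>KM\<^esub> dilation c a"
    using dilation_mult[OF yc(1) ac] dilation_inverse[OF c] by simp
  finally have "dilation c u \<otimes>\<^bsub>KM\<^esub> (\<one>\<^bsub>KM\<^esub> \<ominus>\<^bsub>KM\<^esub> x \<otimes>\<^bsub>KM\<^esub> dilation c a) = \<one>\<^bsub>KM\<^esub>"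
    using x ac by (simp add: minus_KM dilation_closed)
  then show "\<exists>u\<in>carrier KM. u \<otimes>\<^bsub>KM\<^esub> (\<one>\<^bsub>KM\<^esub> \<ominus>\<^bsub>KM\<^esub> x \<otimes>\<^bsub>KM\<^esub> dilation c a) = \<one>\<^bsub>KM\<^esub>"
    using u(1) dilation_closed by blast
qed

lemma dilation_eigenvectors_in_subspace:
  assumes char: "CHAR('k) = 0" and S: "pm.subspace S" and inv: "\<And>f. f \<in> S \<Longrightarrow> dilation 2 f \<in> S"
    and "finite D" "(\<Sum>d\<in>D. g d) \<in> S" "\<And>d. d \<in> D \<Longrightarrow> dilation 2 (g d) = scale (2 ^ d) (g d)" "d \<in> D"
  shows "g d \<in> S"
  using assms(4-)
proof (induction D arbitrary: g d)
  case (insert e D)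
  have pow_inj: "(2::'k) ^ d \<noteq> 2 ^ e" if "d \<noteq> e" for d e :: nat
  proof
    assume "(2::'k) ^ d = 2 ^ e"
    moreover have "(2::'k) ^ i \<noteq> 2 ^ j" if "i < j" for i j :: nat
    proof
      assume "(2::'k) ^ i = 2 ^ j"
      then have "(of_nat (2 ^ j - 2 ^ i) :: 'k) = 0"
        using that by (simp add: of_nat_diff power_increasing)
      then have "(2::nat) ^ j - 2 ^ i = 0"
        using char by (simp only: of_nat_eq_0_iff_char_dvd dvd_0_left_iff)
      then show False using power_strict_increasing[OF that, of "2::nat"] by simp
    qed
    ultimately show False using that by (metis linorder_neqE_nat)
  qed
  let ?F = "\<Sum>d\<in>insert e D. g d"
  have "dilation 2 ?F - scale (2 ^ e) ?F = (\<Sum>d\<in>insert e D. dilation 2 (g d) - scale (2 ^ e) (g d))"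
    unfolding dilation_def weight_sum by (simp add: pm.scale_sum_right sum_subtractf pm.scale_right_distrib insert.hyps)
  also have "\<dots> = (\<Sum>d\<in>insert e D. scale (2 ^ d - 2 ^ e) (g d))"
    using insert.prems(2) by (intro sum.cong) (simp_all add: pm.scale_left_diff_distrib)
  also have "\<dots> = (\<Sum>d\<in>D. scale (2 ^ d - 2 ^ e) (g d))"
    using insert.hyps by simp
  finally have "(\<Sum>d\<in>D. scale (2 ^ d - 2 ^ e) (g d)) \<in> S"
    using inv[OF insert.prems(1)] insert.prems(1) S
    by (metis pm.subspace_diff pm.subspace_scale)
  then have *: "scale (2 ^ d - 2 ^ e) (g d) \<in> S" if "d \<in> D" for d
    using insert.prems(2) that
    by (intro insert.IH[of "\<lambda>d. scale (2 ^ d - 2 ^ e) (g d)"])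
      (auto simp: dilation_def weight_scale mult_ac)
  have D: "g d \<in> S" if "d \<in> D" for d
  proof -
    have "d \<noteq> e" using that insert.hyps by blast
    then have "scale (inverse (2 ^ d - 2 ^ e)) (scale (2 ^ d - 2 ^ e) (g d)) = g d"
      using pow_inj[of d e] by simp
    then show ?thesis using pm.subspace_scale[OF S *[OF that]] by metis
  qed
  have "g e = ?F - (\<Sum>d\<in>D. g d)" using insert.hyps by simp
  then have "g e \<in> S" using insert.prems(1) D by (metis S pm.subspace_diff pm.subspace_sum)
  then show ?case using D insert.prems(3) by blast
qed simp

lemma component_J:
  assumes "CHAR('k) = 0" "f \<in> J" shows "component d f \<in> J"
proof (cases "d \<in> len ` Poly_Mapping.keys f")
  case True
  have two: "(2::'k) \<noteq> 0"
    using of_nat_eq_0_iff_char_dvd[of 2, where 'a = 'k] assms(1) by simp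
  show ?thesis
  proof (rule dilation_eigenvectors_in_subspace[OF assms(1) subspace_J, of "len ` Poly_Mapping.keys f" "\<lambda>d. component d f"])
    show "dilation 2 (component d f) = scale (2 ^ d) (component d f)" for d
      by (rule dilation_homogeneous[OF homogeneous_component[OF J_closed[OF assms(2)]]])
  qed (use True assms(2) two in \<open>auto simp: sum_components dilation_J\<close>)
next
  case False
  then show ?thesis using pm.subspace_0[OF subspace_J] by (simp add: component_eq_0)
qed

lemma homogeneous_J_nilpotent:
  assumes a: "a \<in> J" and h: "homogeneous d a"
  shows "\<exists>n::nat. a [^]\<^bsub>KM\<^esub> n = \<zero>\<^bsub>KM\<^esub>"
proof (cases "d = 0")
  case True
  note ac = J_closed[OF a]
  have "x = \<one>" if "x \<in> Poly_Mapping.keys a" for x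
    using that h True ac len_eq_0 by (auto simp: homogeneous_def carrier_KM)
  then have a1: "a = scale (Poly_Mapping.lookup a \<one>) \<one>\<^bsub>KM\<^esub>"
    by (intro poly_mapping_eqI) (auto simp: lookup_scale one_KM basis_elem_def lookup_single when_def in_keys_iff)
  have "Poly_Mapping.lookup a \<one> = 0"
  proof (rule ccontr)
    assume "Poly_Mapping.lookup a \<one> \<noteq> 0"
    then have "\<one>\<^bsub>KM\<^esub> = scale (inverse (Poly_Mapping.lookup a \<one>)) a" by (subst a1) simp
    then have "\<one>\<^bsub>KM\<^esub> \<in> J" using pm.subspace_scale[OF subspace_J a] by metis
    then obtain u where "u \<in> carrier KM" "u \<otimes>\<^bsub>KM\<^esub> (\<one>\<^bsub>KM\<^esub> \<ominus>\<^bsub>KM\<^esub> \<one>\<^bsub>KM\<^esub>) = \<one>\<^bsub>KM\<^esub>"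
      using KM.jacobson_radical_left_inverse by blast
    then have "\<one>\<^bsub>KM\<^esub> = (0 :: 'm \<Rightarrow>\<^sub>0 'k)" by (simp add: KM.minus_eq KM.r_neg zero_KM)
    then show False using basis_elem_nonzero by (simp add: one_KM)
  qed
  then have "a = 0" using a1 by simp
  then show ?thesis using ac by (intro exI[of _ 1]) (simp add: zero_KM)
next
  case False
  note ac = J_closed[OF a]
  obtain u where u: "u \<in> carrier KM" "u \<otimes>\<^bsub>KM\<^esub> (\<one>\<^bsub>KM\<^esub> \<ominus>\<^bsub>KM\<^esub> a) = \<one>\<^bsub>KM\<^esub>"
    using KM.jacobson_radical_left_inverse[OF a] by blast
  have "u \<otimes>\<^bsub>KM\<^esub> (\<one>\<^bsub>KM\<^esub> \<ominus>\<^bsub>KM\<^esub> a) \<oplus>\<^bsub>KM\<^esub> u \<otimes>\<^bsub>KM\<^esub> a = u \<otimes>\<^bsub>KM\<^esub> ((\<one>\<^bsub>KM\<^esub> \<ominus>\<^bsub>KM\<^esub> a) \<oplus>\<^bsub>KM\<^esub> a)"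
    using u ac by (simp add: KM.r_distr)
  also have "\<dots> = u" using u ac by (simp add: KM.minus_eq KM.a_assoc KM.l_neg)
  finally have ueq: "u = \<one>\<^bsub>KM\<^esub> + u \<otimes>\<^bsub>KM\<^esub> a" using u(2) by (simp add: add_KM)
  have comp: "component n u = (if n = 0 then \<one>\<^bsub>KM\<^esub> else 0) +
      (if d \<le> n then component (n - d) u \<otimes>\<^bsub>KM\<^esub> a else 0)" for n
    by (subst ueq) (simp add: component_add component_mult_homogeneous[OF u(1) h]
        component_homogeneous[OF homogeneous_one])
  have "component (n * d) u = a [^]\<^bsub>KM\<^esub> n" for n
  proof (induction n)
    case 0
    show ?case using comp[of 0] False by simp
  next
    case (Suc n)
    then show ?case using comp[of "Suc n * d"] False by simp
  qed
  moreover have "\<exists>n. n * d \<notin> len ` Poly_Mapping.keys u"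
  proof (rule ccontr)
    assume "\<not> ?thesis"
    then have "range (\<lambda>n. n * d) \<subseteq> len ` Poly_Mapping.keys u" by blast
    then have "finite (range (\<lambda>n. n * d))" by (rule finite_subset) simp
    then show False using False finite_imageD[of "\<lambda>n. n * d" UNIV] infinite_UNIV_nat
      by (auto simp: inj_on_def)
  qed
  ultimately show ?thesis using component_eq_0 by (metis zero_KM)
qed

lemma maximal_right_invariant:
  assumes ne: "\<F> \<noteq> {}"
    and F: "\<And>U. U \<in> \<F> \<Longrightarrow> pm.subspace U \<and> U \<subseteq> carrier KM \<and>
      (\<forall>f\<in>U. \<forall>x. f \<otimes>\<^bsub>KM\<^esub> basis_elem (t x) \<in> U)"
  shows "\<exists>U\<in>\<F>. \<forall>V\<in>\<F>. U \<subseteq> V \<longrightarrow> V = U"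
proof (rule ccontr)
  assume "\<not> ?thesis"
  then have step: "\<exists>V. V \<in> \<F> \<and> U \<subset> V" if "U \<in> \<F>" for U using that by blast
  have "\<exists>W. \<forall>n. W n \<in> \<F> \<and> W n \<subset> W (Suc n)"
  proof (rule dependent_nat_choice)
    show "\<exists>U. U \<in> \<F>" using ne by blast
  qed (fact step)
  then obtain W where W: "\<And>n. W n \<in> \<F>" "\<And>n. W n \<subset> W (Suc n)" by blast
  have "\<exists>n. \<forall>m\<ge>n. W m = W n"
  proof (rule ascending_chain_condition_right)
    show "W i \<subseteq> W (Suc i)" for i using W(2)[of i] by blast
    show "pm.subspace (W i)" "W i \<subseteq> carrier KM" for i using F[OF W(1)[of i]] by blast+
    show "f \<otimes>\<^bsub>KM\<^esub> basis_elem (t x) \<in> W i" if "f \<in> W i" for i f x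
      using F[OF W(1)[of i]] that by blast
  qed
  then obtain n where "\<forall>m\<ge>n. W m = W n" by (rule exE)
  then have "W (Suc n) = W n" by (metis le_SucI order_refl)
  then show False using W(2)[of n] by blast
qed

text \<open>
  Utumi's argument: for a homogeneous $a \in J \setminus P$ with maximal right annihilator modulo $P$,
  nilpotency of $xa$ forces $axa \in P$ for all $x \in M$, contradicting primeness.
\<close>

lemma homogeneous_J_subset_prime:
  assumes P: "prime_ideal KM P" and a0: "a0 \<in> J" "homogeneous d0 a0"
  shows "a0 \<in> P"
proof (rule ccontr)
  note PI = KM.prime_idealD(1)[OF P]
  note PD = KM.two_sided_idealD[OF PI] and JD = KM.left_idealD[OF KM.jacobson_radical_left_ideal]
  define ann where "ann a = carrier KM \<inter> {y. a \<otimes>\<^bsub>KM\<^esub> y \<in> P}" for a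
  define A where "A = {a \<in> J. (\<exists>d. homogeneous d a) \<and> a \<notin> P}"
  assume "a0 \<notin> P"
  then have "a0 \<in> A" using a0 by (auto simp: A_def)
  have "\<exists>U\<in>ann ` A. \<forall>V\<in>ann ` A. U \<subseteq> V \<longrightarrow> V = U"
  proof (rule maximal_right_invariant)
    show "ann ` A \<noteq> {}" using \<open>a0 \<in> A\<close> by blast
    fix U assume "U \<in> ann ` A"
    then obtain a where a: "U = ann a" "a \<in> carrier KM" by (auto simp: A_def J_closed)
    have "pm.subspace U"
      unfolding a(1) ann_def
      by (intro pm.subspace_inter subspace_carrier subspace_left_mult subspace_ideal PI)
    moreover have "f \<otimes>\<^bsub>KM\<^esub> basis_elem (t x) \<in> U" if f: "f \<in> U" for f x
    proof -
      have fc: "f \<in> carrier KM" "a \<otimes>\<^bsub>KM\<^esub> f \<in> P" using f by (auto simp: a(1) ann_def)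
      have "a \<otimes>\<^bsub>KM\<^esub> (f \<otimes>\<^bsub>KM\<^esub> basis_elem (t x)) = (a \<otimes>\<^bsub>KM\<^esub> f) \<otimes>\<^bsub>KM\<^esub> basis_elem (t x)"
        using a(2) fc(1) by (simp add: KM.m_assoc)
      then show ?thesis using PD(5)[OF fc(2), of "basis_elem (t x)"] fc(1) by (simp add: a(1) ann_def)
    qed
    ultimately show "pm.subspace U \<and> U \<subseteq> carrier KM \<and>
        (\<forall>f\<in>U. \<forall>x. f \<otimes>\<^bsub>KM\<^esub> basis_elem (t x) \<in> U)"
      by (auto simp: a(1) ann_def)
  qed
  then obtain a where a: "a \<in> A" and max: "\<And>b. b \<in> A \<Longrightarrow> ann a \<subseteq> ann b \<Longrightarrow> ann b = ann a" by blast
  obtain d where d: "homogeneous d a" using a by (auto simp: A_def)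
  have aJ: "a \<in> J" "a \<notin> P" and ac: "a \<in> carrier KM" using a by (auto simp: A_def J_closed)
  have "a \<otimes>\<^bsub>KM\<^esub> basis_elem x \<otimes>\<^bsub>KM\<^esub> a \<in> P" if x: "x \<in> carrier M" for x
  proof -
    define c where "c = basis_elem x \<otimes>\<^bsub>KM\<^esub> a"
    have cc: "c \<in> carrier KM" using x ac by (simp add: c_def)
    have cJ: "c \<in> J" using JD(4)[OF aJ(1)] x by (auto simp: c_def)
    have ch: "homogeneous (len x + d) c" unfolding c_def by (rule homogeneous_basis_elem_mult[OF x d])
    define e where "e n = a \<otimes>\<^bsub>KM\<^esub> c [^]\<^bsub>KM\<^esub> n" for n :: nat
    have ec: "e n \<in> carrier KM" for n using ac cc by (simp add: e_def)
    have e_Suc: "e (Suc n) = e n \<otimes>\<^bsub>KM\<^esub> c" for n using ac cc by (simp add: e_def KM.m_assoc)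
    have eJ: "e n \<in> J" for n
    proof (cases n)
      case 0
      then show ?thesis using ac aJ by (simp add: e_def)
    next
      case (Suc k)
      then show ?thesis using JD(4)[OF cJ ec[of k]] by (simp add: e_Suc)
    qed
    have eh: "homogeneous (d + n * (len x + d)) (e n)" for n
      unfolding e_def by (intro homogeneous_mult homogeneous_pow d ch)
    have ann_e: "ann a \<subseteq> ann (e n)" for n
    proof (induction n)
      case 0
      then show ?case using ac by (simp add: e_def)
    next
      case (Suc n)
      have "e (Suc n) \<otimes>\<^bsub>KM\<^esub> y \<in> P" if y: "y \<in> ann a" for y
      proof -
        have yc: "y \<in> carrier KM" "a \<otimes>\<^bsub>KM\<^esub> y \<in> P" using y by (auto simp: ann_def)
        have "e (Suc n) \<otimes>\<^bsub>KM\<^esub> y = (e n \<otimes>\<^bsub>KM\<^esub> basis_elem x) \<otimes>\<^bsub>KM\<^esub> (a \<otimes>\<^bsub>KM\<^esub> y)"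
          using ec[of n] ac yc(1) x by (simp add: e_Suc c_def KM.m_assoc)
        then show ?thesis using PD(4)[OF yc(2)] ec[of n] x by simp
      qed
      then show ?case by (auto simp: ann_def)
    qed
    obtain n :: nat where "c [^]\<^bsub>KM\<^esub> n = \<zero>\<^bsub>KM\<^esub>" using homogeneous_J_nilpotent[OF cJ ch] by blast
    then have "e n \<in> P" using ac PD(2) by (simp add: e_def)
    moreover have "e 0 \<notin> P" using ac aJ by (simp add: e_def)
    ultimately obtain k where k: "e k \<notin> P" "e (Suc k) \<in> P"
      using ex_least_nat_less[of "\<lambda>n. e n \<in> P" n] by blast
    have "e k \<in> A" using k(1) eJ eh by (auto simp: A_def)
    then have "ann (e k) = ann a" using max ann_e by blast
    moreover have "c \<in> ann (e k)" using k(2) cc by (simp add: ann_def e_Suc)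
    ultimately have "a \<otimes>\<^bsub>KM\<^esub> c \<in> P" by (auto simp: ann_def)
    then show ?thesis using ac x by (simp add: c_def KM.m_assoc)
  qed
  then show False using prime_ideal_basis_elem[OF P ac ac] aJ(2) by blast
qed

theorem jacobson_radical_eq_prime_radical:
  assumes "CHAR('k) = 0"
  shows "J = prime_radical KM"
proof -
  have "f \<in> P" if f: "f \<in> J" and P: "prime_ideal KM P" for f P
  proof -
    have "component d f \<in> P" for d
      using homogeneous_J_subset_prime[OF P component_J[OF assms f]]
        homogeneous_component[OF J_closed[OF f]] by blast
    then have "(\<Sum>d\<in>len ` Poly_Mapping.keys f. component d f) \<in> P"
      by (intro pm.subspace_sum subspace_ideal KM.prime_idealD(1)[OF P])
    then show ?thesis by (simp add: sum_components)
  qed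
  then have "J \<subseteq> prime_radical KM" by (auto simp: prime_radical_def Spec_def J_closed)
  then show ?thesis using KM.prime_radical_subset_jacobson_radical by blast
qed

end

section \<open>Finite group quotients\<close>

text \<open>
  Residual finiteness of $\mathbb{Z}^n / L$: a vector outside the subgroup \<open>L\<close> stays outside
  $L + k\mathbb{Z}^n$ for some \<open>k\<close>.
\<close>

lemma separate_from_subgroup:
  fixes L :: "('x \<Rightarrow> int) set"
  assumes L: "\<And>l m a b. l \<in> L \<Longrightarrow> m \<in> L \<Longrightarrow> (\<lambda>x. a * l x + b * m x) \<in> L" and L0: "(\<lambda>x. 0) \<in> L"
    and "finite S" "u \<notin> L" "\<And>x. x \<notin> S \<Longrightarrow> u x = 0"
  shows "\<exists>k>0. \<forall>l\<in>L. \<forall>v. (\<forall>x. x \<notin> S \<longrightarrow> v x = 0) \<longrightarrow> u \<noteq> (\<lambda>x. l x + int k * v x)"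
  using assms(3-)
proof (induction S arbitrary: u)
  case empty
  then have "u = (\<lambda>x. 0)" by auto
  then show ?case using empty L0 by simp
next
  case (insert s S)
  define L' where "L' = {l \<in> L. \<forall>x. x \<notin> insert s S \<longrightarrow> l x = 0}"
  have L'_if: "l \<in> L'" if "l \<in> L" "u = (\<lambda>x. l x + c * v x)" "\<And>x. x \<notin> insert s S \<Longrightarrow> v x = 0" for l c v
  proof -
    have "l x = 0" if "x \<notin> insert s S" for x
      using fun_cong[OF \<open>u = _\<close>, of x] insert.prems(2)[OF that] \<open>\<And>x. x \<notin> insert s S \<Longrightarrow> v x = 0\<close>[OF that] by simp
    then show ?thesis using that(1) by (simp add: L'_def)
  qed
  show ?case
  proof (cases "\<forall>l\<in>L'. l s = 0")
    case True
    show ?thesis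
    proof (cases "u s = 0")
      case us: True
      then obtain k where k: "k > 0" "\<And>l v. l \<in> L \<Longrightarrow> (\<And>x. x \<notin> S \<Longrightarrow> v x = 0) \<Longrightarrow> u \<noteq> (\<lambda>x. l x + int k * v x)"
        using insert.IH[of u] insert.prems by (metis insertE)
      have False if lv: "l \<in> L" "\<And>x. x \<notin> insert s S \<Longrightarrow> v x = 0" "u = (\<lambda>x. l x + int k * v x)" for l v
      proof -
        have "l s = 0" using True L'_if lv by blast
        then have "v s = 0" using fun_cong[OF lv(3), of s] us k(1) by simp
        then have "v x = 0" if "x \<notin> S" for x using lv(2)[of x] that by (cases "x = s") auto
        then show False using k(2)[OF lv(1)] lv(3) by blast
      qed
      then show ?thesis using k(1) by blast
    next
      case us: False
      have False if lv: "l \<in> L" "\<And>x. x \<notin> insert s S \<Longrightarrow> v x = 0"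
        "u = (\<lambda>x. l x + int (nat (\<bar>u s\<bar> + 1)) * v x)" for l v
      proof -
        have "l s = 0" using True L'_if lv by blast
        then have eq: "u s = (\<bar>u s\<bar> + 1) * v s" using fun_cong[OF lv(3), of s] by simp
        then have "\<bar>u s\<bar> + 1 dvd u s" by (metis dvd_triv_left)
        then have "\<bar>\<bar>u s\<bar> + 1\<bar> \<le> \<bar>u s\<bar>" using us by (intro dvd_imp_le_int)
        then show False by simp
      qed
      then show ?thesis by (intro exI[of _ "nat (\<bar>u s\<bar> + 1)"]) auto
    qed
  next
    case False
    then obtain l1 where l1: "l1 \<in> L'" "l1 s \<noteq> 0" by blast
    have comb: "(\<lambda>x. a * l x + b * m x) \<in> L'" if "l \<in> L'" "m \<in> L'" for a b l m
      using that L by (simp add: L'_def)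
    define Q where "Q n \<longleftrightarrow> 0 < n \<and> (\<exists>l\<in>L'. l s = int n)" for n
    have QI: "Q n" if "l \<in> L'" "l s = int n" "0 < n" for l n using that unfolding Q_def by blast
    have "(\<lambda>x. sgn (l1 s) * l1 x + 0 * l1 x) \<in> L'" by (rule comb[OF l1(1) l1(1)])
    moreover have "sgn (l1 s) * l1 s + 0 * l1 s = int (nat \<bar>l1 s\<bar>)" by (simp add: sgn_if)
    ultimately have "Q (nat \<bar>l1 s\<bar>)" by (rule QI) (use l1(2) in simp)
    define d where "d = (LEAST n. Q n)"
    have "Q d" unfolding d_def using \<open>Q (nat \<bar>l1 s\<bar>)\<close> by (rule LeastI)
    then obtain l0 where l0: "l0 \<in> L'" "l0 s = int d" and d: "d > 0" by (auto simp: Q_def)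
    have dvd: "int d dvd l s" if l: "l \<in> L'" for l
    proof (rule ccontr)
      assume no: "\<not> int d dvd l s"
      let ?m = "\<lambda>x. 1 * l x + (- (l s div int d)) * l0 x"
      have m: "?m s = l s mod int d" by (simp add: l0 minus_div_mult_eq_mod)
      have "l s mod int d \<noteq> 0" using no by (simp only: mod_eq_0_iff_dvd not_False_eq_True)
      moreover have "l s mod int d \<ge> 0" using d by (intro pos_mod_sign) simp
      ultimately have pos: "0 < l s mod int d" by linarith
      then have "Q (nat (l s mod int d))"
        by (intro QI[OF comb[OF l l0(1), of 1 "- (l s div int d)"]]) ((subst m)?, use pos in simp)+
      then have "d \<le> nat (l s mod int d)" unfolding d_def by (rule Least_le)
      then show False using pos_mod_bound[of "int d" "l s"] d by linarith
    qed
    show ?thesis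
    proof (cases "int d dvd u s")
      case no: False
      have False if lv: "l \<in> L" "\<And>x. x \<notin> insert s S \<Longrightarrow> v x = 0" "u = (\<lambda>x. l x + int d * v x)" for l v
      proof -
        have "int d dvd l s" using dvd L'_if lv by blast
        then have "int d dvd l s + int d * v s" by simp
        then show False using no fun_cong[OF lv(3), of s] by simp
      qed
      then show ?thesis using d by blast
    next
      case True
      then obtain q where q: "u s = int d * q" by (auto elim: dvdE)
      define u' where "u' x = u x - q * l0 x" for x
      have l0L: "l0 \<in> L" using l0 by (simp add: L'_def)
      have "u' \<notin> L"
      proof
        assume "u' \<in> L"
        then have "(\<lambda>x. 1 * u' x + q * l0 x) \<in> L" using L l0L by blast
        then show False using insert.prems(1) by (simp add: u'_def)
      qed
      moreover have "u' x = 0" if "x \<notin> S" for x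
      proof (cases "x = s")
        case True
        then show ?thesis by (simp add: u'_def q l0)
      next
        case False
        then show ?thesis using that insert.prems(2)[of x] l0(1) by (simp add: u'_def L'_def)
      qed
      ultimately obtain k where k: "k > 0"
        "\<And>l v. l \<in> L \<Longrightarrow> (\<And>x. x \<notin> S \<Longrightarrow> v x = 0) \<Longrightarrow> u' \<noteq> (\<lambda>x. l x + int k * v x)"
        using insert.IH[of u'] by metis
      have False if lv: "l \<in> L" "\<And>x. x \<notin> insert s S \<Longrightarrow> v x = 0" "u = (\<lambda>x. l x + int (k * d) * v x)" for l v
      proof -
        let ?l = "\<lambda>x. 1 * l x + (int k * v s - q) * l0 x" and ?v = "\<lambda>x. int d * v x - v s * l0 x"
        have "?l \<in> L" using L lv(1) l0L by blast
        moreover have "?v x = 0" if "x \<notin> S" for x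
        proof (cases "x = s")
          case True
          then show ?thesis by (simp add: l0)
        next
          case False
          then show ?thesis using that lv(2)[of x] l0(1) by (simp add: L'_def)
        qed
        ultimately have "u' \<noteq> (\<lambda>x. ?l x + int k * ?v x)" by (rule k(2))
        moreover have "u' x = ?l x + int k * ?v x" for x
          using fun_cong[OF lv(3), of x] by (simp only: u'_def) (simp add: algebra_simps)
        ultimately show False by (simp only: fun_eq_iff) simp
      qed
      moreover have "k * d > 0" using k(1) d by simp
      ultimately show ?thesis by blast
    qed
  qed
qed

context yb_monoid
begin

definition counts_divisible :: "nat \<Rightarrow> 'x list \<Rightarrow> bool"
  where "counts_divisible k xs \<longleftrightarrow> (\<forall>x. k dvd count (mset xs) x)"

lemma counts_divisible_append: "counts_divisible k xs \<Longrightarrow> counts_divisible k ys \<Longrightarrow> counts_divisible k (xs @ ys)"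
  by (simp add: counts_divisible_def)

lemma counts_divisible_map:
  assumes "bij f" "counts_divisible k xs" shows "counts_divisible k (map f xs)"
  unfolding counts_divisible_def
proof
  fix y
  obtain x where y: "y = f x" using assms(1) by (metis bij_pointE)
  have "count (mset (map f zs)) (f x) = count (mset zs) x" for zs
    using bij_is_inj[OF assms(1)] by (induction zs) (auto dest: injD)
  then show "k dvd count (mset (map f xs)) y"
    using assms(2) by (simp only: y counts_divisible_def)
qed

definition kcong :: "nat \<Rightarrow> 'm \<Rightarrow> 'm \<Rightarrow> bool"
  where "kcong k a b \<longleftrightarrow> (\<exists>xs ys. a \<otimes> tprod xs = b \<otimes> tprod ys \<and> counts_divisible k xs \<and> counts_divisible k ys)"

lemma kcong_refl: "kcong k a a"
  unfolding kcong_def counts_divisible_def by (intro exI[of _ "[]"]) simp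

lemma kcong_sym: "kcong k a b \<Longrightarrow> kcong k b a"
  unfolding kcong_def by metis

lemma kcong_trans:
  assumes "kcong k a b" "kcong k b c" "a \<in> carrier M" "b \<in> carrier M" "c \<in> carrier M"
  shows "kcong k a c"
proof -
  obtain xs ys xs' ys' where *: "a \<otimes> tprod xs = b \<otimes> tprod ys" "b \<otimes> tprod xs' = c \<otimes> tprod ys'"
    "counts_divisible k xs" "counts_divisible k ys" "counts_divisible k xs'" "counts_divisible k ys'"
    using assms by (auto simp: kcong_def)
  have "a \<otimes> tprod (xs @ xs') = (b \<otimes> tprod ys) \<otimes> tprod xs'"
    using assms by (simp add: tprod_append m_assoc[symmetric] *(1))
  also have "\<dots> = b \<otimes> (tprod xs' \<otimes> tprod ys)" using assms by (simp add: m_assoc tprod_commute[of ys])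
  also have "\<dots> = (b \<otimes> tprod xs') \<otimes> tprod ys" using assms by (simp add: m_assoc)
  also have "\<dots> = c \<otimes> tprod (ys' @ ys)" using assms by (simp add: tprod_append m_assoc *(2))
  finally show ?thesis using *(3-) counts_divisible_append unfolding kcong_def by blast
qed

lemma kcong_l_mult:
  assumes "kcong k a b" "a \<in> carrier M" "b \<in> carrier M" "c \<in> carrier M"
  shows "kcong k (c \<otimes> a) (c \<otimes> b)"
  using assms unfolding kcong_def by (metis m_assoc tprod_closed)

lemma kcong_r_mult:
  assumes "kcong k a b" "a \<in> carrier M" "b \<in> carrier M" "c \<in> carrier M"
  shows "kcong k (a \<otimes> c) (b \<otimes> c)"
proof -
  obtain xs ys where *: "a \<otimes> tprod xs = b \<otimes> tprod ys" "counts_divisible k xs" "counts_divisible k ys"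
    using assms by (auto simp: kcong_def)
  let ?i = "inv_into UNIV (act c)"
  have move: "(d \<otimes> c) \<otimes> tprod (map ?i zs) = (d \<otimes> tprod zs) \<otimes> c" if "d \<in> carrier M" for d zs
    using that assms(4) by (simp add: m_assoc tprod_mult)
  have "bij ?i" using bij_act[OF assms(4)] by (rule bij_imp_bij_inv)
  moreover have "(a \<otimes> c) \<otimes> tprod (map ?i xs) = (b \<otimes> c) \<otimes> tprod (map ?i ys)"
    using assms by (simp only: move *(1))
  ultimately show ?thesis unfolding kcong_def using *(2,3) counts_divisible_map by blast
qed

lemma kcong_dvd: "kcong k' a b \<Longrightarrow> k dvd k' \<Longrightarrow> kcong k a b"
  unfolding kcong_def counts_divisible_def by (meson dvd_trans)

lemma kcong_separates:
  assumes a: "a \<in> carrier M" and b: "b \<in> carrier M" and ab: "(a, b) \<notin> eta M"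
  shows "\<exists>k>0. \<not> kcong k a b"
proof (cases "\<exists>p q. a \<otimes> tprod p = b \<otimes> tprod q")
  case False
  then show ?thesis unfolding kcong_def by blast
next
  case True
  then obtain p q where pq: "a \<otimes> tprod p = b \<otimes> tprod q" by blast
  define vec where "vec xs ys x = int (count (mset ys) x) - int (count (mset xs) x)" for xs ys :: "'x list" and x
  define L where "L = {vec xs ys | xs ys. b \<otimes> tprod xs = b \<otimes> tprod ys}"
  have add: "(\<lambda>x. l x + m x) \<in> L" if lm: "l \<in> L" "m \<in> L" for l m
  proof -
    obtain xs ys xs' ys' where *: "l = vec xs ys" "m = vec xs' ys'"
      "b \<otimes> tprod xs = b \<otimes> tprod ys" "b \<otimes> tprod xs' = b \<otimes> tprod ys'" using lm by (auto simp: L_def)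
    have "b \<otimes> tprod (xs @ xs') = (b \<otimes> tprod ys) \<otimes> tprod xs'"
      using b by (simp add: tprod_append m_assoc[symmetric] *(3))
    also have "\<dots> = (b \<otimes> tprod xs') \<otimes> tprod ys" using b by (simp add: m_assoc tprod_commute[of ys])
    also have "\<dots> = b \<otimes> tprod (ys' @ ys)" using b by (simp add: tprod_append m_assoc[symmetric] *(4))
    finally have "vec (xs @ xs') (ys' @ ys) \<in> L" by (auto simp: L_def)
    moreover have "vec (xs @ xs') (ys' @ ys) = (\<lambda>x. l x + m x)" by (auto simp: vec_def *(1,2))
    ultimately show ?thesis by simp
  qed
  have neg: "(\<lambda>x. - l x) \<in> L" if l: "l \<in> L" for l
  proof -
    obtain xs ys where *: "l = vec xs ys" "b \<otimes> tprod xs = b \<otimes> tprod ys" using l by (auto simp: L_def)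
    have "vec ys xs \<in> L" using *(2)[symmetric] by (auto simp: L_def)
    moreover have "vec ys xs = (\<lambda>x. - l x)" by (auto simp: vec_def *(1))
    ultimately show ?thesis by simp
  qed
  have zero: "(\<lambda>x. 0) \<in> L"
  proof -
    have "vec [] [] \<in> L" by (auto simp: L_def)
    then show ?thesis by (simp add: vec_def[abs_def])
  qed
  have nat_mult: "(\<lambda>x. int n * l x) \<in> L" if l: "l \<in> L" for l n
  proof (induction n)
    case (Suc n)
    then show ?case using add[OF l Suc] by (simp add: algebra_simps)
  qed (simp add: zero)
  have int_mult: "(\<lambda>x. c * l x) \<in> L" if l: "l \<in> L" for l and c :: int
  proof (cases c rule: int_cases2)
    case (nonneg n)
    then show ?thesis using nat_mult[OF l] by simp
  next
    case (nonpos n)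
    then show ?thesis using neg[OF nat_mult[OF l, of n]] by simp
  qed
  have "vec p q \<notin> L"
  proof
    assume "vec p q \<in> L"
    then have "(\<lambda>x. - vec p q x) \<in> L" by (rule neg)
    then obtain xs ys where *: "(\<lambda>x. - vec p q x) = vec xs ys" "b \<otimes> tprod xs = b \<otimes> tprod ys"
      by (auto simp: L_def)
    have "mset (p @ xs) = mset (ys @ q)"
    proof (rule multiset_eqI)
      fix x
      show "count (mset (p @ xs)) x = count (mset (ys @ q)) x"
        using fun_cong[OF *(1), of x] by (simp add: vec_def)
    qed
    then have mseq: "tprod (ys @ q) = tprod (p @ xs)" by (rule tprod_mset[symmetric])
    have "a \<otimes> tprod (p @ xs) = (b \<otimes> tprod q) \<otimes> tprod xs"
      using a by (simp add: tprod_append m_assoc[symmetric] pq)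
    also have "\<dots> = (b \<otimes> tprod xs) \<otimes> tprod q" using b by (simp add: m_assoc tprod_commute[of q])
    also have "\<dots> = b \<otimes> tprod (ys @ q)" using b by (simp add: *(2) tprod_append m_assoc)
    also have "\<dots> = b \<otimes> tprod (p @ xs)" by (simp only: mseq)
    finally show False using ab a b by (auto simp: eta_def)
  qed
  then obtain k where k: "k > 0" "\<And>l v. l \<in> L \<Longrightarrow> vec p q \<noteq> (\<lambda>x. l x + int k * v x)"
    using separate_from_subgroup[of L UNIV "vec p q"] add[OF int_mult int_mult] zero by auto
  have "\<not> kcong k a b"
  proof
    assume "kcong k a b"
    then obtain xs ys where *: "a \<otimes> tprod xs = b \<otimes> tprod ys" "counts_divisible k xs" "counts_divisible k ys"
      by (auto simp: kcong_def)
    have "b \<otimes> tprod (ys @ p) = (a \<otimes> tprod xs) \<otimes> tprod p"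
      using b by (simp add: tprod_append m_assoc[symmetric] *(1))
    also have "\<dots> = (a \<otimes> tprod p) \<otimes> tprod xs" using a by (simp add: m_assoc tprod_commute[of xs])
    also have "\<dots> = b \<otimes> tprod (q @ xs)" using b by (simp add: tprod_append m_assoc[symmetric] pq)
    finally have "vec (ys @ p) (q @ xs) \<in> L" by (auto simp: L_def)
    moreover have "\<forall>x. \<exists>c. int (count (mset ys) x) - int (count (mset xs) x) = int k * c"
      using *(2,3) unfolding counts_divisible_def by (metis dvd_diff dvd_def int_dvd_int_iff)
    then obtain v where "\<And>x. int (count (mset ys) x) - int (count (mset xs) x) = int k * v x" by metis
    then have "vec p q = (\<lambda>x. vec (ys @ p) (q @ xs) x + int k * v x)"
      by (auto simp: vec_def fun_eq_iff) (smt (verit))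
    ultimately show False using k(2) by blast
  qed
  then show ?thesis using k(1) by blast
qed

lemma count_concat_replicate:
  "distinct xs \<Longrightarrow> count (mset (concat (map (\<lambda>y. replicate (c y) y) xs))) x = (if x \<in> set xs then c x else 0)"
  by (induction xs) auto

lemma finite_kcong_representatives:
  assumes k: "k > 0"
  shows "\<exists>G\<subseteq>carrier M. finite G \<and> (\<forall>a\<in>carrier M. \<exists>g\<in>G. kcong k a g)"
proof -
  obtain F where F: "F \<subseteq> carrier M" "finite F" "\<And>a. a \<in> carrier M \<Longrightarrow> \<exists>xs. \<exists>f\<in>F. a = f \<otimes> tprod xs"
    using finitely_generated_over_tprod by blast
  let ?X = "{xs :: 'x list. length xs \<le> length all_x * k}"
  let ?G = "(\<lambda>(f, xs). f \<otimes> tprod xs) ` (F \<times> ?X)"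
  have "finite ?X" using finite_lists_length_le[of "UNIV :: 'x set"] by simp
  then have "finite ?G" using F(2) by simp
  moreover have "?G \<subseteq> carrier M" using F(1) by auto
  moreover have "\<exists>g\<in>?G. kcong k a g" if a: "a \<in> carrier M" for a
  proof -
    obtain f xs where f: "f \<in> F" "a = f \<otimes> tprod xs" using F(3)[OF a] by blast
    have fc: "f \<in> carrier M" using F(1) f(1) by blast
    define spread where "spread c = concat (map (\<lambda>y. replicate (c y) y) all_x)" for c :: "'x \<Rightarrow> nat"
    have count: "count (mset (spread c)) x = c x" for c x
      unfolding spread_def using count_concat_replicate[OF all_x(2)] all_x(1) by simp
    have len: "length (concat (map (\<lambda>y. replicate (c y) y) ys)) \<le> length ys * k"
      if "\<And>x. c x \<le> k" for c and ys :: "'x list"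
      using that by (induction ys) (auto simp: add_mono)
    let ?ys = "spread (\<lambda>x. count (mset xs) x mod k)" and ?zs = "spread (\<lambda>x. k * (count (mset xs) x div k))"
    have "mset xs = mset (?ys @ ?zs)" by (rule multiset_eqI) (simp add: count)
    then have "tprod xs = tprod (?ys @ ?zs)" by (rule tprod_mset)
    then have "a \<otimes> tprod [] = (f \<otimes> tprod ?ys) \<otimes> tprod ?zs"
      using fc by (simp add: f(2) tprod_append m_assoc)
    moreover have "counts_divisible k []" "counts_divisible k ?zs" by (simp_all add: counts_divisible_def count)
    ultimately have "kcong k a (f \<otimes> tprod ?ys)" unfolding kcong_def by blast
    moreover have "?ys \<in> ?X"
      using len[of "\<lambda>x. count (mset xs) x mod k" all_x] k by (simp add: spread_def less_imp_le)
    ultimately show ?thesis using f(1) by (intro bexI[of _ "f \<otimes> tprod ?ys"]) auto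
  qed
  ultimately show ?thesis by (intro exI[of _ ?G] conjI ballI)
qed

lemma kcong_right_inverse:
  assumes k: "k > 0" and a: "a \<in> carrier M"
  shows "\<exists>b\<in>carrier M. kcong k (a \<otimes> b) \<one>"
proof -
  obtain c where c: "c \<in> carrier M" "w [^] len a = a \<otimes> c" using w_pow_divisible[OF a] by blast
  have "len a * k = len a + len a * (k - 1)" using k by (cases k) auto
  then have "w [^] (len a * k) = w [^] len a \<otimes> w [^] (len a * (k - 1))"
    by (simp only: nat_pow_mult[OF w_closed])
  then have "w [^] (len a * k) = a \<otimes> (c \<otimes> w [^] (len a * (k - 1)))"
    using a c by (simp add: m_assoc)
  then have "a \<otimes> (c \<otimes> w [^] (len a * (k - 1))) \<otimes> tprod [] = \<one> \<otimes> tprod (concat (replicate (len a * k) all_x))"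
    using a c by (simp add: w_pow[symmetric])
  moreover have "count (mset (concat (replicate n all_x))) x = n * count (mset all_x) x" for n x
    by (induction n) auto
  then have "counts_divisible k (concat (replicate (len a * k) all_x))" "counts_divisible k []"
    by (simp_all add: counts_divisible_def)
  ultimately show ?thesis using c unfolding kcong_def
    by (intro bexI[of _ "c \<otimes> w [^] (len a * (k - 1))"]) blast+
qed

lemma kcong_inverse:
  assumes k: "k > 0" and a: "a \<in> carrier M"
  shows "\<exists>b\<in>carrier M. kcong k (a \<otimes> b) \<one> \<and> kcong k (b \<otimes> a) \<one>"
proof -
  obtain b where b: "b \<in> carrier M" "kcong k (a \<otimes> b) \<one>" using kcong_right_inverse[OF k a] by blast
  obtain c where c: "c \<in> carrier M" "kcong k (b \<otimes> c) \<one>" using kcong_right_inverse[OF k b(1)] by blast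
  have "kcong k (b \<otimes> (a \<otimes> b) \<otimes> c) (b \<otimes> \<one> \<otimes> c)"
    using a b c by (intro kcong_r_mult kcong_l_mult) auto
  then have "kcong k (b \<otimes> a \<otimes> (b \<otimes> c)) (b \<otimes> c)" using a b c by (simp add: m_assoc)
  moreover have "kcong k (b \<otimes> a \<otimes> (b \<otimes> c)) (b \<otimes> a \<otimes> \<one>)"
    using a b c by (intro kcong_l_mult) auto
  ultimately have "kcong k (b \<otimes> a \<otimes> \<one>) \<one>"
    using a b c kcong_trans[of k "b \<otimes> a \<otimes> \<one>" "b \<otimes> a \<otimes> (b \<otimes> c)" "b \<otimes> c"] kcong_sym
      kcong_trans[of k "b \<otimes> a \<otimes> \<one>" "b \<otimes> c" \<one>] by simp
  then show ?thesis using a b by auto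
qed

end

context yb_algebra
begin

definition kclass :: "nat \<Rightarrow> 'm \<Rightarrow> 'm set" where "kclass k a = {b \<in> carrier M. kcong k a b}"

lemma kclass_eq_iff:
  assumes "a \<in> carrier M" "b \<in> carrier M"
  shows "kclass k a = kclass k b \<longleftrightarrow> kcong k a b"
proof
  assume "kclass k a = kclass k b"
  then show "kcong k a b" using kcong_refl assms(2) by (auto simp: kclass_def)
next
  assume ab: "kcong k a b"
  have "kcong k a c \<longleftrightarrow> kcong k b c" if c: "c \<in> carrier M" for c
    using kcong_trans[OF ab _ assms c] kcong_trans[OF kcong_sym[OF ab] _ assms(2,1) c] by blast
  then show "kclass k a = kclass k b" by (auto simp: kclass_def)
qed

lemma finite_kclasses:
  assumes "k > 0" shows "finite (kclass k ` carrier M)"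
proof -
  obtain G where "G \<subseteq> carrier M \<and> finite G \<and> (\<forall>a\<in>carrier M. \<exists>g\<in>G. kcong k a g)"
    using finite_kcong_representatives[OF assms] by (rule exE)
  then have G: "G \<subseteq> carrier M" "finite G" "\<And>a. a \<in> carrier M \<Longrightarrow> \<exists>g\<in>G. kcong k a g"
    by simp_all
  have "kclass k ` carrier M \<subseteq> kclass k ` G"
  proof clarify
    fix a assume a: "a \<in> carrier M"
    then obtain g where "g \<in> G" "kcong k a g" using G(3) by blast
    then have "kclass k a = kclass k g" using a G(1) by (simp add: kclass_eq_iff subset_iff)
    then show "kclass k a \<in> kclass k ` G" using \<open>g \<in> G\<close> by blast
  qed
  then show ?thesis using G(2) finite_subset by blast
qed

definition keq :: "nat \<Rightarrow> ('m \<Rightarrow>\<^sub>0 'k) \<Rightarrow> ('m \<Rightarrow>\<^sub>0 'k) \<Rightarrow> bool"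
  where "keq k f g \<longleftrightarrow> push (kclass k) f = push (kclass k) g"

lemma keq_basis_elem: "kcong k a b \<Longrightarrow> a \<in> carrier M \<Longrightarrow> b \<in> carrier M \<Longrightarrow> keq k (basis_elem a) (basis_elem b)"
  by (simp add: keq_def kclass_eq_iff[symmetric])

lemma keq_left:
  assumes "keq k f g" "f \<in> carrier KM" "g \<in> carrier KM" "x \<in> carrier M"
  shows "keq k (basis_elem x \<otimes>\<^bsub>KM\<^esub> f) (basis_elem x \<otimes>\<^bsub>KM\<^esub> g)"
proof -
  define H where "H C = kclass k (x \<otimes> (SOME y. y \<in> C))" for C
  have H: "kclass k (x \<otimes> y) = H (kclass k y)" if y: "y \<in> carrier M" for y
  proof -
    have "y \<in> kclass k y" using y by (simp add: kclass_def kcong_refl)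
    then have "(SOME z. z \<in> kclass k y) \<in> kclass k y" by (rule someI)
    then show ?thesis using y assms(4) by (simp add: H_def kclass_eq_iff kclass_def[of k y] kcong_l_mult)
  qed
  have "push (kclass k) (basis_elem x \<otimes>\<^bsub>KM\<^esub> h) = push H (push (kclass k) h)" if "h \<in> carrier KM" for h
    unfolding basis_elem_mult push_push using that
    by (intro push_cong) (auto simp: H carrier_KM)
  then show ?thesis using assms by (simp add: keq_def)
qed

lemma keq_mult_kcong:
  assumes f: "f \<in> carrier KM" and "kcong k x y" "x \<in> carrier M" "y \<in> carrier M"
  shows "keq k (basis_elem x \<otimes>\<^bsub>KM\<^esub> f) (basis_elem y \<otimes>\<^bsub>KM\<^esub> f)"
  unfolding keq_def basis_elem_mult push_push using f assms(2-)
  by (intro push_cong) (auto simp: carrier_KM kclass_eq_iff kcong_r_mult subset_iff)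

definition kernel :: "nat \<Rightarrow> ('m \<Rightarrow>\<^sub>0 'k) set"
  where "kernel k = {f \<in> carrier KM. push (kclass k) f = 0}"

lemma kernel_iff: "f \<in> kernel k \<longleftrightarrow> f \<in> carrier KM \<and> keq k f 0"
  by (simp add: kernel_def keq_def)

lemma keq_diff: "f \<in> carrier KM \<Longrightarrow> g \<in> carrier KM \<Longrightarrow> keq k f g \<longleftrightarrow> f - g \<in> kernel k"
  by (simp add: kernel_def keq_def push_minus minus_closed)

lemma subspace_kernel: "pm.subspace (kernel k)"
proof -
  have "kernel k = carrier KM \<inter> {f. push (kclass k) f = 0}" by (auto simp: kernel_def)
  then show ?thesis by (simp add: pm.subspace_inter subspace_carrier subspace_push_eq_0)
qed

lemma kernel_l_mult:
  assumes i: "i \<in> kernel k" and f: "f \<in> carrier KM" shows "f \<otimes>\<^bsub>KM\<^esub> i \<in> kernel k"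
proof -
  have ic: "i \<in> carrier KM" using i by (simp add: kernel_def)
  have "basis_elem x \<otimes>\<^bsub>KM\<^esub> i \<in> kernel k" if "x \<in> carrier M" for x
    using keq_left[of k i 0 x] i ic that subspace_carrier by (auto simp: kernel_iff pm.subspace_0)
  then have "carrier KM \<subseteq> {f. f \<otimes>\<^bsub>KM\<^esub> i \<in> kernel k}"
    by (intro carrier_subsetI subspace_right_mult subspace_kernel) auto
  then show ?thesis using f by blast
qed

text \<open>
  Maschke's theorem for the finite group $M/{\sim_k}$, carried out in $K[M]$ modulo the kernel of
  $K[M] \to K[M/{\sim_k}]$: averaging a linear projection onto a left ideal \<open>L\<close> that contains
  the kernel yields an element that acts on \<open>L\<close> as a right identity.
\<close>

lemma maschke:
  assumes char: "CHAR('k) = 0" and k: "k > 0"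
    and L: "left_ideal KM L" and ker: "kernel k \<subseteq> L"
  shows "\<exists>e\<in>L. \<forall>f\<in>L. keq k f (f \<otimes>\<^bsub>KM\<^esub> e)"
proof -
  note LD = KM.left_idealD[OF L] and LS = subspace_left_ideal[OF L]
  have Lc: "f \<in> carrier KM" if "f \<in> L" for f using that LD(1) by blast
  interpret pp: vector_space_pair "scale :: 'k \<Rightarrow> ('m \<Rightarrow>\<^sub>0 'k) \<Rightarrow> _" "scale :: 'k \<Rightarrow> ('m \<Rightarrow>\<^sub>0 'k) \<Rightarrow> _"
    by unfold_locales
  obtain p where p: "range p \<subseteq> L" "Vector_Spaces.linear scale scale p" "\<And>f. f \<in> L \<Longrightarrow> p f = f"
    using pp.linear_exists_left_inverse_on[OF pm.linear_id[unfolded id_def] LS] by auto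
  have pL: "p f \<in> L" for f using p(1) by blast
  have pc: "p f \<in> carrier KM" for f using Lc pL by blast
  note p_lin = pm.linear_add[OF p(2)] pm.linear_scale[OF p(2)]
  have p_diff: "p (f - g) = p f - p g" for f g
    using p_lin(1)[of "f - g" g] by (simp add: algebra_simps)
  have p_keq: "keq k (p f) (p g)" if fg: "f \<in> carrier KM" "g \<in> carrier KM" "keq k f g" for f g
  proof -
    have "f - g \<in> kernel k" using fg keq_diff by blast
    then have "p f - p g \<in> kernel k" using p(3)[of "f - g"] ker by (auto simp: p_diff)
    then show ?thesis using keq_diff pc by blast
  qed
  define Q where "Q = kclass k ` carrier M"
  have "\<exists>a. a \<in> carrier M \<and> kclass k a = q" if "q \<in> Q" for q using that by (auto simp: Q_def)
  then obtain rep where rep: "\<And>q. q \<in> Q \<Longrightarrow> rep q \<in> carrier M" "\<And>q. q \<in> Q \<Longrightarrow> kclass k (rep q) = q"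
    by metis
  obtain inve where inve: "\<And>a. a \<in> carrier M \<Longrightarrow> inve a \<in> carrier M"
    "\<And>a. a \<in> carrier M \<Longrightarrow> kcong k (a \<otimes> inve a) \<one>" "\<And>a. a \<in> carrier M \<Longrightarrow> kcong k (inve a \<otimes> a) \<one>"
    using kcong_inverse[OF k] by metis
  have finQ: "finite Q" and neQ: "Q \<noteq> {}" using finite_kclasses[OF k] one_closed by (auto simp: Q_def)
  define n where "n = card Q"
  have n: "(of_nat n :: 'k) \<noteq> 0"
    using finQ neQ char by (simp add: n_def of_nat_eq_0_iff_char_dvd)
  define summand where "summand f q = basis_elem (rep q) \<otimes>\<^bsub>KM\<^esub> p (basis_elem (inve (rep q)) \<otimes>\<^bsub>KM\<^esub> f)" for f q
  define \<pi> where "\<pi> f = scale (inverse (of_nat n)) (\<Sum>q\<in>Q. summand f q)" for f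
  have summand_L: "summand f q \<in> L" if "q \<in> Q" for f q
    unfolding summand_def using LD(4)[OF pL] rep(1)[OF that] by blast
  have \<pi>_L: "\<pi> f \<in> L" for f
    unfolding \<pi>_def by (intro pm.subspace_scale[OF LS] pm.subspace_sum[OF LS] summand_L)
  have average: "keq k (\<pi> f) g" if "\<And>q. q \<in> Q \<Longrightarrow> keq k (summand f q) g" for f g
  proof -
    have "push (kclass k) (\<pi> f) = scale (inverse (of_nat n)) (\<Sum>q\<in>Q. push (kclass k) g)"
      unfolding \<pi>_def push_scale module_hom.sum[OF Vector_Spaces.linear.axioms(3)[OF linear_push]]
      using that by (simp add: keq_def)
    also have "(\<Sum>q\<in>Q. push (kclass k) g) = scale (of_nat n) (push (kclass k) g)"
      using pm.sum_constant_scale by (simp add: n_def)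
    finally show ?thesis using n by (simp add: keq_def)
  qed
  have \<pi>_id: "keq k f (\<pi> f)" if f: "f \<in> L" for f
  proof -
    have fc: "f \<in> carrier KM" using Lc f .
    have "keq k (summand f q) f" if q: "q \<in> Q" for q
    proof -
      have r: "rep q \<in> carrier M" "inve (rep q) \<in> carrier M" using rep inve q by auto
      have "p (basis_elem (inve (rep q)) \<otimes>\<^bsub>KM\<^esub> f) = basis_elem (inve (rep q)) \<otimes>\<^bsub>KM\<^esub> f"
        using p(3) LD(4)[OF f] r by auto
      then have "summand f q = basis_elem (rep q \<otimes> inve (rep q)) \<otimes>\<^bsub>KM\<^esub> f"
        using r fc by (simp add: summand_def KM.m_assoc[symmetric] basis_elem_mult_basis_elem)
      moreover have "keq k (basis_elem (rep q \<otimes> inve (rep q)) \<otimes>\<^bsub>KM\<^esub> f) (basis_elem \<one> \<otimes>\<^bsub>KM\<^esub> f)"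
        using r inve(2)[OF r(1)] by (intro keq_mult_kcong fc) auto
      moreover have "basis_elem \<one> \<otimes>\<^bsub>KM\<^esub> f = f" using fc by (simp add: one_KM[symmetric])
      ultimately show ?thesis by simp
    qed
    then show ?thesis using average by (simp add: keq_def)
  qed
  define e where "e = \<pi> (basis_elem \<one>)"
  have ec: "e \<in> carrier KM" using Lc \<pi>_L by (simp add: e_def)
  have \<pi>_basis: "keq k (\<pi> (basis_elem m)) (basis_elem m \<otimes>\<^bsub>KM\<^esub> e)" if m: "m \<in> carrier M" for m
  proof -
    define \<sigma> where "\<sigma> q = kclass k (inve m \<otimes> rep q)" for q
    have \<sigma>Q: "\<sigma> q \<in> Q" if "q \<in> Q" for q using that rep(1) inve(1)[OF m] by (simp add: \<sigma>_def Q_def)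
    have rep\<sigma>: "kcong k (m \<otimes> rep (\<sigma> q)) (rep q)" if q: "q \<in> Q" for q
    proof -
      have c: "rep q \<in> carrier M" "rep (\<sigma> q) \<in> carrier M" "inve m \<in> carrier M"
        using rep(1)[OF q] rep(1)[OF \<sigma>Q[OF q]] inve(1)[OF m] by auto
      have "kcong k (rep (\<sigma> q)) (inve m \<otimes> rep q)"
        using rep(2)[OF \<sigma>Q[OF q]] c by (simp add: \<sigma>_def kclass_eq_iff[symmetric])
      then have "kcong k (m \<otimes> rep (\<sigma> q)) (m \<otimes> (inve m \<otimes> rep q))" using c m by (intro kcong_l_mult) auto
      moreover have "kcong k (m \<otimes> inve m \<otimes> rep q) (\<one> \<otimes> rep q)"
        using c m inve(2)[OF m] by (intro kcong_r_mult) auto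
      then have "kcong k (m \<otimes> (inve m \<otimes> rep q)) (rep q)" using c m by (simp add: m_assoc)
      ultimately show ?thesis using c m by (auto intro: kcong_trans)
    qed
    have inv\<sigma>: "kcong k (inve (rep q) \<otimes> m) (inve (rep (\<sigma> q)))" if q: "q \<in> Q" for q
    proof -
      let ?r = "rep q" and ?s = "rep (\<sigma> q)"
      have c: "?r \<in> carrier M" "?s \<in> carrier M" "inve ?r \<in> carrier M" "inve ?s \<in> carrier M"
        using rep(1)[OF q] rep(1)[OF \<sigma>Q[OF q]] inve(1) by auto
      have "kcong k (inve ?r \<otimes> (m \<otimes> ?s) \<otimes> inve ?s) (inve ?r \<otimes> ?r \<otimes> inve ?s)"
        using c m rep\<sigma>[OF q] by (intro kcong_r_mult kcong_l_mult) auto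
      moreover have "kcong k (inve ?r \<otimes> ?r \<otimes> inve ?s) (\<one> \<otimes> inve ?s)"
        using c inve(3)[OF c(1)] by (intro kcong_r_mult) auto
      moreover have "kcong k (inve ?r \<otimes> m \<otimes> (?s \<otimes> inve ?s)) (inve ?r \<otimes> m \<otimes> \<one>)"
        using c m inve(2)[OF c(2)] by (intro kcong_l_mult) auto
      moreover have "inve ?r \<otimes> (m \<otimes> ?s) \<otimes> inve ?s = inve ?r \<otimes> m \<otimes> (?s \<otimes> inve ?s)"
        using c m by (simp add: m_assoc)
      ultimately have "kcong k (inve ?r \<otimes> m \<otimes> \<one>) (\<one> \<otimes> inve ?s)"
        using c m
        by (intro kcong_trans[of k "inve ?r \<otimes> m \<otimes> \<one>" "inve ?r \<otimes> m \<otimes> (?s \<otimes> inve ?s)" "\<one> \<otimes> inve ?s"]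
            kcong_trans[of k "inve ?r \<otimes> m \<otimes> (?s \<otimes> inve ?s)" "inve ?r \<otimes> ?r \<otimes> inve ?s" "\<one> \<otimes> inve ?s"])
          (auto intro: kcong_sym)
      then show ?thesis using c m by simp
    qed
    have inj: "inj_on \<sigma> Q"
    proof (rule inj_onI)
      fix q q' assume q: "q \<in> Q" "q' \<in> Q" "\<sigma> q = \<sigma> q'"
      have c: "rep q \<in> carrier M" "rep q' \<in> carrier M" "m \<otimes> rep (\<sigma> q) \<in> carrier M"
        using rep(1) q \<sigma>Q m by auto
      have "kcong k (rep q) (rep q')"
        using kcong_trans[OF kcong_sym[OF rep\<sigma>[OF q(1)]], of "rep q'"] rep\<sigma>[OF q(2)] q(3) c by simp
      then have "kclass k (rep q) = kclass k (rep q')" using c kclass_eq_iff by blast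
      then show "q = q'" using rep(2) q by simp
    qed
    have bij: "bij_betw \<sigma> Q Q"
      using inj \<sigma>Q finQ by (intro bij_betw_imageI endo_inj_surj) auto
    have step: "push (kclass k) (summand (basis_elem m) q) =
        push (kclass k) (basis_elem m \<otimes>\<^bsub>KM\<^esub> summand (basis_elem \<one>) (\<sigma> q))" if q: "q \<in> Q" for q
    proof -
      let ?r = "rep q" and ?s = "rep (\<sigma> q)"
      have c: "?r \<in> carrier M" "?s \<in> carrier M" "inve ?r \<in> carrier M" "inve ?s \<in> carrier M"
        using rep(1)[OF q] rep(1)[OF \<sigma>Q[OF q]] inve(1) by auto
      let ?x = "p (basis_elem (inve ?r \<otimes> m))" and ?y = "p (basis_elem (inve ?s))"
      have "keq k ?x ?y"
        using c m inv\<sigma>[OF q] by (intro p_keq keq_basis_elem) auto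
      then have "keq k (basis_elem ?r \<otimes>\<^bsub>KM\<^esub> ?x) (basis_elem ?r \<otimes>\<^bsub>KM\<^esub> ?y)"
        using c pc by (intro keq_left)
      moreover have "keq k (basis_elem (m \<otimes> ?s) \<otimes>\<^bsub>KM\<^esub> ?y) (basis_elem ?r \<otimes>\<^bsub>KM\<^esub> ?y)"
        using c m pc rep\<sigma>[OF q] by (intro keq_mult_kcong) auto
      moreover have "basis_elem (m \<otimes> ?s) \<otimes>\<^bsub>KM\<^esub> ?y = basis_elem m \<otimes>\<^bsub>KM\<^esub> (basis_elem ?s \<otimes>\<^bsub>KM\<^esub> ?y)"
        using c m pc by (simp add: KM.m_assoc[symmetric] basis_elem_mult_basis_elem)
      ultimately show ?thesis
        using c by (simp add: keq_def summand_def basis_elem_mult_basis_elem)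
    qed
    have "basis_elem m \<otimes>\<^bsub>KM\<^esub> e = scale (inverse (of_nat n)) (\<Sum>q\<in>Q. basis_elem m \<otimes>\<^bsub>KM\<^esub> summand (basis_elem \<one>) q)"
      unfolding e_def \<pi>_def mult_scale_KM
      unfolding basis_elem_mult module_hom.sum[OF Vector_Spaces.linear.axioms(3)[OF linear_push]] ..
    also have "(\<Sum>q\<in>Q. basis_elem m \<otimes>\<^bsub>KM\<^esub> summand (basis_elem \<one>) q) =
        (\<Sum>q\<in>Q. basis_elem m \<otimes>\<^bsub>KM\<^esub> summand (basis_elem \<one>) (\<sigma> q))"
      by (rule sum.reindex_bij_betw[OF bij, symmetric])
    finally show ?thesis
      by (simp add: keq_def \<pi>_def push_scale step
          module_hom.sum[OF Vector_Spaces.linear.axioms(3)[OF linear_push]])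
  qed
  have "carrier KM \<subseteq> {f. push (kclass k) (\<pi> f) = push (kclass k) (f \<otimes>\<^bsub>KM\<^esub> e)}"
  proof (rule carrier_subsetI)
    have add: "summand (f + g) q = summand f q + summand g q" and sc: "summand (scale c f) q = scale c (summand f q)" for f g c q
      by (simp_all add: summand_def distrib_KM p_lin mult_scale_KM)
    have \<pi>_add: "\<pi> (f + g) = \<pi> f + \<pi> g" for f g
      by (simp add: \<pi>_def add sum.distrib pm.scale_right_distrib)
    have \<pi>_scale: "\<pi> (scale c f) = scale c (\<pi> f)" for c f
      by (simp add: \<pi>_def sc pm.scale_sum_right[symmetric] mult.commute)
    have "\<pi> 0 = 0" using \<pi>_scale[of 0 0] by simp
    then show "pm.subspace {f. push (kclass k) (\<pi> f) = push (kclass k) (f \<otimes>\<^bsub>KM\<^esub> e)}"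
      by (intro pm.subspaceI) (simp_all add: \<pi>_add \<pi>_scale distrib_KM scale_mult_KM push_add push_scale)
  qed (use \<pi>_basis in \<open>auto simp: keq_def\<close>)
  then have "keq k f (f \<otimes>\<^bsub>KM\<^esub> e)" if "f \<in> L" for f
    using \<pi>_id[OF that] Lc[OF that] by (auto simp: keq_def)
  then show ?thesis using \<pi>_L unfolding e_def by blast
qed

lemma J_subset_kernel:
  assumes char: "CHAR('k) = 0" and k: "k > 0"
  shows "J \<subseteq> kernel k"
proof -
  note JL = KM.jacobson_radical_left_ideal
  have "left_ideal KM (kernel k)"
    using kernel_l_mult pm.subspace_0[OF subspace_kernel] pm.subspace_add[OF subspace_kernel]
    by (intro KM.left_idealI) (auto simp: kernel_def zero_KM add_KM)
  then have L: "left_ideal KM {a \<oplus>\<^bsub>KM\<^esub> b | a b. a \<in> J \<and> b \<in> kernel k}" (is "left_ideal KM ?L")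
    by (rule KM.left_ideal_add[OF JL])
  have JL': "f \<in> ?L" if "f \<in> J" for f
    using that pm.subspace_0[OF subspace_kernel] by (intro CollectI exI[of _ f] exI[of _ 0]) (simp add: add_KM)
  have "kernel k \<subseteq> ?L"
  proof
    fix f assume "f \<in> kernel k"
    then show "f \<in> ?L"
      using pm.subspace_0[OF subspace_J] by (intro CollectI exI[of _ 0] exI[of _ f]) (simp add: add_KM)
  qed
  then obtain e where e: "e \<in> ?L" "\<And>f. f \<in> ?L \<Longrightarrow> keq k f (f \<otimes>\<^bsub>KM\<^esub> e)"
    using maschke[OF char k L] by blast
  then obtain j i where ji: "e = j + i" "j \<in> J" "i \<in> kernel k" by (auto simp: add_KM)
  have jc: "j \<in> carrier KM" and ic: "i \<in> carrier KM" using ji J_closed by (auto simp: kernel_def)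
  have right_id: "f - f \<otimes>\<^bsub>KM\<^esub> j \<in> kernel k" if f: "f \<in> J" for f
  proof -
    have fc: "f \<in> carrier KM" using f by (rule J_closed)
    have "keq k f (f \<otimes>\<^bsub>KM\<^esub> j + f \<otimes>\<^bsub>KM\<^esub> i)" using e(2)[OF JL'[OF f]] by (simp add: ji(1) distrib_KM)
    moreover have "keq k (f \<otimes>\<^bsub>KM\<^esub> j + f \<otimes>\<^bsub>KM\<^esub> i) (f \<otimes>\<^bsub>KM\<^esub> j)"
      using kernel_l_mult[OF ji(3) fc] by (simp add: keq_def push_add kernel_def)
    ultimately have "keq k f (f \<otimes>\<^bsub>KM\<^esub> j)" by (simp add: keq_def)
    then show ?thesis using keq_diff fc jc by simp
  qed
  obtain u where u: "u \<in> carrier KM" "u \<otimes>\<^bsub>KM\<^esub> (\<one>\<^bsub>KM\<^esub> \<ominus>\<^bsub>KM\<^esub> j) = \<one>\<^bsub>KM\<^esub>"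
    using KM.jacobson_radical_left_inverse[OF ji(2)] by blast
  have "j = u \<otimes>\<^bsub>KM\<^esub> (\<one>\<^bsub>KM\<^esub> \<ominus>\<^bsub>KM\<^esub> j) \<otimes>\<^bsub>KM\<^esub> j" using u jc by simp
  also have "\<dots> = u \<otimes>\<^bsub>KM\<^esub> (j \<ominus>\<^bsub>KM\<^esub> j \<otimes>\<^bsub>KM\<^esub> j)"
    using u(1) jc by (simp add: KM.m_assoc KM.minus_eq KM.l_distr KM.l_minus)
  also have "\<dots> \<in> kernel k" using right_id[OF ji(2)] u(1) jc by (intro kernel_l_mult) (simp_all add: minus_KM)
  finally have j: "j \<in> kernel k" .
  show ?thesis
  proof
    fix f assume f: "f \<in> J"
    have "(f - f \<otimes>\<^bsub>KM\<^esub> j) + f \<otimes>\<^bsub>KM\<^esub> j \<in> kernel k"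
      using right_id[OF f] kernel_l_mult[OF j J_closed[OF f]] pm.subspace_add[OF subspace_kernel] by blast
    then show "f \<in> kernel k" by simp
  qed
qed

theorem jacobson_radical_subset_I_eta:
  assumes char: "CHAR('k) = 0"
  shows "J \<subseteq> I_eta"
proof
  fix f assume f: "f \<in> J"
  have keys: "Poly_Mapping.keys f \<subseteq> carrier M" using J_closed[OF f] by (simp add: carrier_KM)
  define B where "B = Poly_Mapping.keys f \<times> Poly_Mapping.keys f - eta M"
  have "\<exists>k>0. \<not> kcong k (fst z) (snd z)" if "z \<in> B" for z
  proof -
    have "fst z \<in> carrier M" "snd z \<in> carrier M" "(fst z, snd z) \<notin> eta M"
      using that keys by (auto simp: B_def)
    then show ?thesis by (rule kcong_separates)
  qed
  then obtain sep where sep: "\<And>z. z \<in> B \<Longrightarrow> sep z > (0::nat)" "\<And>z. z \<in> B \<Longrightarrow> \<not> kcong (sep z) (fst z) (snd z)"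
    by metis
  have finB: "finite B" by (simp add: B_def)
  define k where "k = prod sep B"
  have k: "k > 0" using sep(1) by (simp add: k_def prod_pos)
  show "f \<in> I_eta"
  proof (rule congruence_idealI)
    show "push (kclass k) f = 0" using J_subset_kernel[OF char k] f by (auto simp: kernel_def)
    fix x y assume xy: "x \<in> Poly_Mapping.keys f" "y \<in> Poly_Mapping.keys f" "kclass k x = kclass k y"
    then have "kcong k x y" using keys kclass_eq_iff by blast
    moreover have "sep z dvd k" if "z \<in> B" for z
      unfolding k_def using finB that by (rule dvd_prodI)
    ultimately show "(x, y) \<in> eta M"
      using sep(2)[of "(x, y)"] kcong_dvd xy(1,2) unfolding B_def by fastforce
  qed
qed

theorem prime_radical_eq:
  assumes char: "CHAR('k) = 0"
  shows "prime_radical KM = I_eta \<inter> \<Inter>{P \<in> Spec KM. P \<inter> basis_elem ` carrier M \<noteq> {}}"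
proof
  show "prime_radical KM \<subseteq> I_eta \<inter> \<Inter>{P \<in> Spec KM. P \<inter> basis_elem ` carrier M \<noteq> {}}"
    using jacobson_radical_subset_I_eta[OF char] jacobson_radical_eq_prime_radical[OF char]
    by (auto simp: prime_radical_def)
  have "I_eta \<subseteq> carrier KM"
    using annihilator_eq_I_eta by (auto simp: annihilator_def)
  then show "I_eta \<inter> \<Inter>{P \<in> Spec KM. P \<inter> basis_elem ` carrier M \<noteq> {}} \<subseteq> prime_radical KM"
    using I_eta_subset_prime by (fastforce simp: prime_radical_def Spec_def)
qed

end

theorem theorem6p5:
  fixes r :: "'x::finite \<times> 'x \<Rightarrow> 'x \<times> 'x"
  defines "M \<equiv> structure_monoid r"
  defines "KM \<equiv> (monoid_algebra M :: ('x list set \<Rightarrow>\<^sub>0 'k::field) ring)"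
  defines "I_eta \<equiv> (congruence_ideal (eta M) :: ('x list set \<Rightarrow>\<^sub>0 'k) set)"
  defines "as_in_1 \<equiv> (\<lambda>w m. w \<in> M_X r \<inter> monoid_center M \<and> 1 \<le> (m::nat) \<and>
      I_eta = annihilator KM {basis_elem (w [^]\<^bsub>M\<^esub> m)} \<and>
      I_eta = annihilator KM (basis_elem ` set_power M (M_X r) m))"
  defines "\<P> \<equiv> {P \<in> Spec KM. P \<inter> basis_elem ` carrier M \<noteq> {}}"
  assumes "yang_baxter r" and "bij r" and "left_nondegenerate r"
  shows
    "(\<exists>w m. as_in_1 w m) \<and>
     (\<forall>P\<in>Spec KM. P \<inter> basis_elem ` carrier M = {} \<longrightarrow> I_eta \<subseteq> P) \<and>
     (\<forall>P\<in>Spec KM. P \<inter> basis_elem ` carrier M \<noteq> {} \<longrightarrow>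
        basis_elem ` M_X r \<subseteq> P \<and> (\<forall>w m. as_in_1 w m \<longrightarrow> basis_elem w \<in> P)) \<and>
     (\<exists>P. minimal_prime_ideal KM P \<and> P \<inter> basis_elem ` carrier M = {}) \<and>
     (CHAR('k) = 0 \<longrightarrow>
        jacobson_radical KM = prime_radical KM \<and>
        prime_radical KM = I_eta \<inter> \<Inter>\<P> \<and>
        (\<forall>w m. as_in_1 w m \<longrightarrow> \<P> = {P \<in> Spec KM. basis_elem w \<in> P}))"
proof -
  interpret S: yb_solution r by standard fact+
  interpret A: yb_algebra M "\<lambda>x. word_class r (S.tword x)" S.class_act S.class_length "M_X r" KM
    unfolding M_def
    by (intro yb_algebra.intro monoid_ring.intro monoid_ring_axioms.intro S.yb_monoid monoid_structure_monoid)
      (simp add: KM_def M_def)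
  have in_P: "basis_elem w \<in> P" if "P \<in> \<P>" "as_in_1 w m" for P w m
    using A.MX_subset_prime[of P] that by (auto simp: \<P>_def as_in_1_def Spec_def)
  have "\<exists>w m. as_in_1 w m"
    using A.annihilator_eq_I_eta A.w_in_MX A.w_central
    by (auto simp: as_in_1_def I_eta_def monoid_center_def intro!: exI[of _ A.w])
  moreover have "\<P> = {P \<in> Spec KM. basis_elem w \<in> P}" if "as_in_1 w m" for w m
  proof -
    have "w \<in> carrier M" using that A.MX_closed by (auto simp: as_in_1_def)
    then show ?thesis using in_P[OF _ that] by (auto simp: \<P>_def)
  qed
  moreover have "basis_elem ` M_X r \<subseteq> P \<and> (\<forall>w m. as_in_1 w m \<longrightarrow> basis_elem w \<in> P)"
    if "P \<in> Spec KM" "P \<inter> basis_elem ` carrier M \<noteq> {}" for P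
  proof -
    have "P \<in> \<P>" using that by (simp add: \<P>_def)
    then show ?thesis using A.MX_subset_prime[of P] that in_P by (auto simp: Spec_def)
  qed
  ultimately show ?thesis
    using A.I_eta_subset_prime A.minimal_prime_avoiding_M
      A.jacobson_radical_eq_prime_radical A.prime_radical_eq
    unfolding \<P>_def I_eta_def Spec_def by simp
qed

end
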